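(* Let $G$ be a $T_1$ topological locally compact fan loop for which there exists a compact subgroup $N_0=N_0(G)$ in $N(G)$ such that $t(a,b,c)\in N_0$ and $p(a,b,c)\in N_0$ for all $a,b,c\in G$. Then there exists a regular $\sigma$-additive measure $\mu:\mathcal B(G)\to[0,\infty]$ on the Borel $\sigma$-algebra $\mathcal B(G)$ of $G$ such that (1) $\mu(U)>0$ for each nonempty open subset $U$ of $G$; (2) $\mu(A)<\infty$ for each compact subset $A$ of $G$; (3) $\mu(bB)=\mu(B)$ for each $B\in\mathcal B(G)$ and $b\in G$, where $bB=\{bx: x\in B\}$. Moreover, such $\mu$ can be chosen corresponding to (i.e. with $J(f)=\int_G f\,d\mu$ for all $f\in C^+_{0,0}(G)$) a functional $J$ on $C^+_{0,0}(G)$ satisfying: $J(f)\ge0$ for each $f\in C^+_{0,0}(G)$ and $J(f)>0$ if $f$ is nonzero; $J(\alpha_1f_1+\dots+\alpha_nf_n)=\alpha_1J(f_1)+\dots+\alpha_nJ(f_n)$ for all $f_i\in C^+_{0,0}(G)$, $\alpha_i\ge0$; and $J({}_bf)=J(f)$ for each $b\in G$, $f\in C^+_{0,0}(G)$, where ${}_bf(x)=f(bx)$.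
   Context: A loop is a set $G$ with a binary multiplication such that for all $a,b\in G$ there is a unique $x$ with $ax=b$ (written $x=a\backslash b$) and a unique $y$ with $ya=b$ (written $y=b/a$), and there is $e\in G$ with $eg=ge=g$ for all $g$. The nucleus is $N(G)=\{a\in G:\ (ab)c=a(bc),\ (ba)c=b(ac),\ (bc)a=b(ca)\ \text{for all } b,c\in G\}$; it is a group. A fan loop is a loop such that for all $a,b,c\in G$ there are $t(a,b,c),p(a,b,c)\in N(G)$ with $(ab)c=t(a,b,c)\,(a(bc))$ and $(ab)c=(a(bc))\,p(a,b,c)$ (these elements are then unique). A topological fan loop is a fan loop with a topology for which multiplication, $(a,b)\mapsto a\backslash b$ and $(a,b)\mapsto b/a$ are jointly continuous. The fan $N_0(G)$ is the minimal closed subgroup of $G$ containing all $t(a,b,c)$ and $p(a,b,c)$. $C_{0,0}^+(G)$ is the set of continuous functions $f:G\to[0,\infty)$ with compact support. Regular means: $\mu(U)=\sup\{\mu(X): X\text{ compact},\ X\subset U\}$ for each open $U\subset G$, and $\mu(A)=\inf\{\mu(V): V\text{ open},\ A\subset V\subset G\}$ for each $A\in\mathcal B(G)$. *)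

theory Defs
  imports "HOL-Analysis.Analysis" "HOL-Algebra.Group"
begin

text \<open>The underlying set of the loop is the whole type \<open>'a\<close>.\<close>

locale loop =
  fixes m :: "'a \<Rightarrow> 'a \<Rightarrow> 'a"  (infixl \<open>\<cdot>\<close> 70)
    and e :: 'a
  assumes ldiv_ex1: "\<And>a b. \<exists>!x. a \<cdot> x = b"
    and rdiv_ex1: "\<And>a b. \<exists>!y. y \<cdot> a = b"
    and left_unit: "\<And>g. e \<cdot> g = g"
    and right_unit: "\<And>g. g \<cdot> e = g"
begin

definition ldiv :: "'a \<Rightarrow> 'a \<Rightarrow> 'a" where
  "ldiv a b = (THE x. a \<cdot> x = b)"

text \<open>The arguments are in the order of the infix notation, \<open>rdiv b a\<close> being \<open>b / a\<close>.\<close>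

definition rdiv :: "'a \<Rightarrow> 'a \<Rightarrow> 'a" where
  "rdiv b a = (THE y. y \<cdot> a = b)"

definition nucleus :: "'a set" where
  "nucleus = {a. \<forall>b c. (a \<cdot> b) \<cdot> c = a \<cdot> (b \<cdot> c)
                   \<and> (b \<cdot> a) \<cdot> c = b \<cdot> (a \<cdot> c)
                   \<and> (b \<cdot> c) \<cdot> a = b \<cdot> (c \<cdot> a)}"

text \<open>
  A subgroup of a loop is a subset that is a group under the multiplication of the loop.
  Its neutral element is necessarily \<open>e\<close>, the only idempotent of the loop.
\<close>

definition is_subgroup :: "'a set \<Rightarrow> bool" where
  "is_subgroup H \<longleftrightarrow> group \<lparr>carrier = H, mult = (\<cdot>), one = e\<rparr>"

end

locale fan_loop = loop +
  assumes ex_t: "\<And>a b c. \<exists>n\<in>nucleus. (a \<cdot> b) \<cdot> c = n \<cdot> (a \<cdot> (b \<cdot> c))"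
    and ex_p: "\<And>a b c. \<exists>n\<in>nucleus. (a \<cdot> b) \<cdot> c = (a \<cdot> (b \<cdot> c)) \<cdot> n"
begin

definition t :: "'a \<Rightarrow> 'a \<Rightarrow> 'a \<Rightarrow> 'a" where
  "t a b c = (THE n. n \<in> nucleus \<and> (a \<cdot> b) \<cdot> c = n \<cdot> (a \<cdot> (b \<cdot> c)))"

definition p :: "'a \<Rightarrow> 'a \<Rightarrow> 'a \<Rightarrow> 'a" where
  "p a b c = (THE n. n \<in> nucleus \<and> (a \<cdot> b) \<cdot> c = (a \<cdot> (b \<cdot> c)) \<cdot> n)"

end

locale topological_fan_loop = fan_loop m e
  for m :: "'a::topological_space \<Rightarrow> 'a \<Rightarrow> 'a"  (infixl \<open>\<cdot>\<close> 70) and e :: 'a +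
  assumes continuous_mult: "continuous_on UNIV (\<lambda>(a, b). a \<cdot> b)"
    and continuous_ldiv: "continuous_on UNIV (\<lambda>(a, b). ldiv a b)"
    and continuous_rdiv: "continuous_on UNIV (\<lambda>(a, b). rdiv b a)"
begin

definition fan :: "'a set" where
  "fan = \<Inter>{H. closed H \<and> is_subgroup H \<and> (\<forall>a b c. t a b c \<in> H \<and> p a b c \<in> H)}"

end

definition C00_plus :: "('a::topological_space \<Rightarrow> real) set" where
  "C00_plus = {f. continuous_on UNIV f \<and> (\<forall>x. 0 \<le> f x) \<and> compact (closure {x. f x \<noteq> 0})}"

text \<open>
  The supremum is meaningful when compact sets are Borel sets, e.g. in Hausdorff spaces;
  a \<open>T\<^sub>1\<close> topological loop is Hausdorff, its diagonal being the preimage of the closed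
  set \<open>{e}\<close> under \<open>ldiv\<close>.
\<close>

definition regular_borel_measure :: "'a::topological_space measure \<Rightarrow> bool" where
  "regular_borel_measure \<mu> \<longleftrightarrow>
     sets \<mu> = sets borel \<and>
     (\<forall>U. open U \<longrightarrow> emeasure \<mu> U = (SUP X\<in>{X. compact X \<and> X \<subseteq> U}. emeasure \<mu> X)) \<and>
     (\<forall>A\<in>sets borel. emeasure \<mu> A = (INF V\<in>{V. open V \<and> A \<subseteq> V}. emeasure \<mu> V))"

end

theory Submission
  imports Defs
begin

text \<open>
Haar's covering argument needs neighbourhoods of points that are carried into one another by the
translations \<open>x \<mapsto> b x\<close>. In a fan loop these maps do not compose to translations, and \<open>b (x U)\<close>
differs from \<open>(b x) U\<close> by factors \<open>t(b, x, u)\<close> over which, as \<open>b\<close> and \<open>x\<close> vary, there is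
no uniform control. These factors lie in the compact fan \<open>N\<close>, however, and the measure can be built from
the directions along \<open>N\<close> and the directions transversal to it.

The first ingredient is that \<open>N\<close> is normal, \<open>x N = N x\<close> for all \<open>x\<close>
(\<open>conj_left\<close>, \<open>conjugate_surj\<close>): an associativity computation shows that each \<open>t(a, b, c)\<close> and
\<open>p(a, b, c)\<close> is moved across \<open>x\<close> within \<open>N\<close>, and the fan is the smallest closed subgroup containing
them. Consequently \<open>b (x U) = (b x) U\<close> holds whenever \<open>U\<close> is a tube, a neighbourhood of
\<open>N\<close> with \<open>N U = U\<close> (\<open>tube_ball_translate\<close>). The covering numbers formed with
tubes are invariant, and their normalised limit is an invariant additive functional \<open>I\<close> on
\<open>N\<close>-invariant functions (\<open>exists_invariant_functional\<close>, \<open>invariant_uc_class\<close>).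

The second ingredient is the invariant mean \<open>M\<close> on the compact group \<open>N\<close>, obtained as the unique constant
approximated by averages of translates (\<open>left_mean_exists\<close>, \<open>left_right_mean_eq\<close>). The
fibrewise mean \<open>A f (x) = M (n \<mapsto> f (n x))\<close> is an \<open>N\<close>-invariant function, and it commutes with
translations: \<open>b (n x) = n' (b x)\<close> where \<open>n \<mapsto> n'\<close> is an automorphism of \<open>N\<close>, and the
mean, being unique, does not notice automorphisms (\<open>fibre_mean_translate\<close>). Hence
\<open>J f = I (A f)\<close> is a left invariant positive functional on \<open>C00_plus\<close>.

The measure is the Radon measure of \<open>J\<close>, constructed from the outer measure
induced by \<open>sup {J f | f \<le> indicator U}\<close> on open sets \<open>U\<close>; its invariance is inherited from
\<open>J\<close> (\<open>radon_homeomorphism\<close>, \<open>radon_integral\<close>).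
\<close>

section \<open>Covering numbers for an invariant system of neighbourhoods\<close>

text \<open>
A combinatorial substitute for a uniform structure that is invariant under a transitive family of
bijections. The family \<open>E\<close> may be coarser than the topology that the underlying type carries; in the
application its neighbourhoods shrink to the cosets of a compact subgroup and not to points. Total boundedness of
the neighbourhoods stands in for local compactness.
\<close>

locale invariant_entourages =
  fixes E :: "('a \<Rightarrow> 'a set) set" and L :: "'b \<Rightarrow> 'a \<Rightarrow> 'a"
  assumes E_nonempty: "E \<noteq> {}"
    and directed: "\<And>V W. V \<in> E \<Longrightarrow> W \<in> E \<Longrightarrow> \<exists>U\<in>E. \<forall>x. U x \<subseteq> V x \<inter> W x"
    and centre: "\<And>V x. V \<in> E \<Longrightarrow> x \<in> V x"
    and ball_totally_bounded: "\<And>V W x. V \<in> E \<Longrightarrow> W \<in> E \<Longrightarrow> \<exists>Y. finite Y \<and> V x \<subseteq> (\<Union>y\<in>Y. W y)"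
    and invariant: "\<And>V b x y. V \<in> E \<Longrightarrow> L b x \<in> V (L b y) \<longleftrightarrow> x \<in> V y"
    and surj_L: "\<And>b. surj (L b)"
    and transitive: "\<And>x y. \<exists>b. L b x = y"
begin

text \<open>
A list of pairs \<open>(c, y)\<close> encodes the linear combination of the indicators of the neighbourhoods
\<open>V y\<close> with coefficients \<open>c\<close>. With lists, sums of combinations are concatenations.
\<close>

definition step :: "('a \<Rightarrow> 'a set) \<Rightarrow> (real \<times> 'a) list \<Rightarrow> 'a \<Rightarrow> real" where
  "step V cs x = (\<Sum>(c, y)\<leftarrow>cs. c * indicator (V y) x)"

definition weight :: "(real \<times> 'a) list \<Rightarrow> real" where
  "weight cs = (\<Sum>(c, y)\<leftarrow>cs. c)"

definition covers :: "('a \<Rightarrow> 'a set) \<Rightarrow> ('a \<Rightarrow> real) \<Rightarrow> (real \<times> 'a) list set" where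
  "covers V f = {cs. (\<forall>(c, y)\<in>set cs. 0 \<le> c) \<and> (\<forall>x. f x \<le> step V cs x)}"

text \<open>
Haar's covering number \<open>(f : V)\<close>, in the version that covers by indicators instead of continuous functions.
\<close>

definition cov :: "('a \<Rightarrow> 'a set) \<Rightarrow> ('a \<Rightarrow> real) \<Rightarrow> real" where
  "cov V f = Inf (weight ` covers V f)"

definition totally_bounded :: "'a set \<Rightarrow> bool" where
  "totally_bounded A \<longleftrightarrow> (\<forall>V\<in>E. \<exists>Y. finite Y \<and> A \<subseteq> (\<Union>y\<in>Y. V y))"

definition bounded_class :: "('a \<Rightarrow> real) set" where
  "bounded_class = {f. (\<forall>x. 0 \<le> f x) \<and> (\<exists>C. \<forall>x. f x \<le> C) \<and> totally_bounded {x. f x \<noteq> 0}}"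

definition ucont :: "('a \<Rightarrow> real) \<Rightarrow> bool" where
  "ucont f \<longleftrightarrow> (\<forall>\<epsilon>>0. \<exists>V\<in>E. \<forall>x. \<forall>y\<in>V x. \<bar>f y - f x\<bar> \<le> \<epsilon>)"

definition uc_class :: "('a \<Rightarrow> real) set" where
  "uc_class = {f \<in> bounded_class. ucont f}"

lemma step_append: "step V (cs @ ds) x = step V cs x + step V ds x"
  and weight_append: "weight (cs @ ds) = weight cs + weight ds"
  by (simp_all add: step_def weight_def)

lemma step_scale: "step V (map (\<lambda>(c, y). (k * c, y)) cs) x = k * step V cs x"
  and weight_scale: "weight (map (\<lambda>(c, y). (k * c, y)) cs) = k * weight cs"
  by (induction cs) (auto simp: step_def weight_def algebra_simps)

lemma weight_nonneg: "(\<forall>(c, y)\<in>set cs. 0 \<le> c) \<Longrightarrow> 0 \<le> weight cs"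
  by (induction cs) (auto simp: weight_def)

lemma step_le_weight: "(\<forall>(c, y)\<in>set cs. 0 \<le> c) \<Longrightarrow> step V cs x \<le> weight cs"
  by (induction cs) (auto simp: weight_def step_def indicator_def)

lemma step_nonneg: "(\<forall>(c, y)\<in>set cs. 0 \<le> c) \<Longrightarrow> 0 \<le> step V cs x"
  by (induction cs) (auto simp: step_def)

lemma covers_nonempty:
  assumes "f \<in> bounded_class" "V \<in> E"
  shows "covers V f \<noteq> {}"
proof -
  obtain C where C: "\<And>x. f x \<le> C" using assms by (auto simp: bounded_class_def)
  obtain Y where Y: "finite Y" "{x. f x \<noteq> 0} \<subseteq> (\<Union>y\<in>Y. V y)"
    using assms by (auto simp: bounded_class_def totally_bounded_def)
  obtain ys where ys: "set ys = Y" using Y(1) finite_list by blast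
  let ?cs = "map (\<lambda>y. (max C 0, y)) ys"
  have nn: "\<forall>(c, y)\<in>set ?cs. 0 \<le> c" by auto
  have "f x \<le> step V ?cs x" for x
  proof (cases "f x = 0")
    case True then show ?thesis using step_nonneg[OF nn] by simp
  next
    case False
    then obtain y where y: "y \<in> set ys" "x \<in> V y" using Y ys by blast
    have "max C 0 \<le> step V ?cs x"
      using y
    proof (induction ys)
      case (Cons a ys)
      have *: "0 \<le> step V (map (\<lambda>y. (max C 0, y)) ys) x"
        by (rule step_nonneg) auto
      show ?case
      proof (cases "y = a")
        case True then show ?thesis using Cons * by (simp add: step_def)
      next
        case False then show ?thesis using Cons by (auto simp: step_def indicator_def)
      qed
    qed simp
    then show ?thesis using C[of x] by linarith
  qed
  then have "?cs \<in> covers V f" using nn by (simp add: covers_def)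
  then show ?thesis by blast
qed

lemma bdd_below_weights: "bdd_below (weight ` covers V f)"
  by (rule bdd_belowI[of _ 0]) (auto simp: covers_def weight_nonneg)

lemma cov_le: "cs \<in> covers V f \<Longrightarrow> cov V f \<le> weight cs"
  unfolding cov_def by (intro cInf_lower bdd_below_weights) auto

lemma cov_greatest:
  assumes "f \<in> bounded_class" "V \<in> E" "\<And>cs. cs \<in> covers V f \<Longrightarrow> k \<le> weight cs"
  shows "k \<le> cov V f"
  unfolding cov_def using assms covers_nonempty by (intro cInf_greatest) auto

lemma cov_approx:
  assumes "f \<in> bounded_class" "V \<in> E" "0 < \<epsilon>"
  obtains cs where "cs \<in> covers V f" "weight cs < cov V f + \<epsilon>"
  using cInf_lessD[of "weight ` covers V f" "cov V f + \<epsilon>"] covers_nonempty assms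
  by (auto simp: cov_def)

lemma cov_nonneg: "f \<in> bounded_class \<Longrightarrow> V \<in> E \<Longrightarrow> 0 \<le> cov V f"
  by (rule cov_greatest) (auto simp: covers_def weight_nonneg)

lemma totally_bounded_subset: "totally_bounded A \<Longrightarrow> B \<subseteq> A \<Longrightarrow> totally_bounded B"
  unfolding totally_bounded_def by (meson order_trans)

lemma totally_bounded_Un: 
  assumes "totally_bounded A" "totally_bounded B" shows "totally_bounded (A \<union> B)"
  unfolding totally_bounded_def
proof
  fix V assume V: "V \<in> E"
  obtain Y Z where "finite Y" "A \<subseteq> (\<Union>y\<in>Y. V y)" "finite Z" "B \<subseteq> (\<Union>y\<in>Z. V y)"
    using assms V unfolding totally_bounded_def by meson
  then show "\<exists>Y. finite Y \<and> A \<union> B \<subseteq> (\<Union>y\<in>Y. V y)"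
    by (intro exI[of _ "Y \<union> Z"]) auto
qed

lemma bounded_class_le:
  assumes "g \<in> bounded_class" "\<And>x. 0 \<le> f x" "\<And>x. f x \<le> g x"
  shows "f \<in> bounded_class"
proof -
  obtain C where "\<And>x. g x \<le> C" using assms by (auto simp: bounded_class_def)
  then have "\<And>x. f x \<le> C" using assms(3) order_trans by blast
  moreover have "{x. f x \<noteq> 0} \<subseteq> {x. g x \<noteq> 0}"
    using assms(2,3) by (metis (mono_tags, lifting) Collect_mono order_antisym)
  ultimately show ?thesis
    using assms totally_bounded_subset unfolding bounded_class_def by blast
qed

lemma bounded_class_add:
  assumes "f \<in> bounded_class" "g \<in> bounded_class"
  shows "(\<lambda>x. f x + g x) \<in> bounded_class"
proof -
  obtain C D where "\<And>x. f x \<le> C" "\<And>x. g x \<le> D" using assms by (auto simp: bounded_class_def)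
  then have "\<And>x. f x + g x \<le> C + D" by (meson add_mono)
  moreover have "totally_bounded {x. f x + g x \<noteq> 0}"
    using assms unfolding bounded_class_def
    by (auto intro!: totally_bounded_subset[OF totally_bounded_Un[of "{x. f x \<noteq> 0}" "{x. g x \<noteq> 0}"]])
  ultimately show ?thesis
    using assms unfolding bounded_class_def by auto
qed

lemma bounded_class_scale:
  assumes "f \<in> bounded_class" "0 \<le> k"
  shows "(\<lambda>x. k * f x) \<in> bounded_class"
proof -
  obtain C where "\<And>x. f x \<le> C" using assms by (auto simp: bounded_class_def)
  then have "\<And>x. k * f x \<le> k * C" using assms by (simp add: mult_left_mono)
  moreover have "totally_bounded {x. k * f x \<noteq> 0}"
    using assms unfolding bounded_class_def
    by (auto intro!: totally_bounded_subset[of "{x. f x \<noteq> 0}"])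
  ultimately show ?thesis
    using assms unfolding bounded_class_def by auto
qed

lemma indicator_bounded_class:
  "totally_bounded A \<Longrightarrow> (indicator A :: 'a \<Rightarrow> real) \<in> bounded_class"
  unfolding bounded_class_def
  by (auto simp: indicator_def intro!: exI[of _ 1] totally_bounded_subset[of A])

lemma totally_bounded_ball: "V \<in> E \<Longrightarrow> totally_bounded (V x)"
  using ball_totally_bounded by (simp add: totally_bounded_def)

lemma indicator_ball_bounded_class: "V \<in> E \<Longrightarrow> (indicator (V x) :: 'a \<Rightarrow> real) \<in> bounded_class"
  by (simp add: indicator_bounded_class totally_bounded_ball)

lemma cov_mono:
  assumes "f \<in> bounded_class" "g \<in> bounded_class" "V \<in> E" "\<And>x. f x \<le> g x"
  shows "cov V f \<le> cov V g"
proof (rule cov_greatest)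
  fix cs assume "cs \<in> covers V g"
  then have "cs \<in> covers V f" using assms(4) by (auto simp: covers_def intro: order_trans)
  then show "cov V f \<le> weight cs" by (rule cov_le)
qed (use assms in auto)

lemma cov_add:
  assumes "f \<in> bounded_class" "g \<in> bounded_class" "V \<in> E"
  shows "cov V (\<lambda>x. f x + g x) \<le> cov V f + cov V g"
proof (rule field_le_epsilon)
  fix \<epsilon> :: real assume "0 < \<epsilon>"
  then have e: "0 < \<epsilon> / 2" by simp
  obtain cs where cs: "cs \<in> covers V f" "weight cs < cov V f + \<epsilon> / 2"
    using cov_approx[OF assms(1,3) e] by blast
  obtain ds where ds: "ds \<in> covers V g" "weight ds < cov V g + \<epsilon> / 2"
    using cov_approx[OF assms(2,3) e] by blast
  have "cs @ ds \<in> covers V (\<lambda>x. f x + g x)"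
    using cs ds by (auto simp: covers_def step_append add_mono)
  then have "cov V (\<lambda>x. f x + g x) \<le> weight cs + weight ds"
    by (metis cov_le weight_append)
  then show "cov V (\<lambda>x. f x + g x) \<le> cov V f + cov V g + \<epsilon>"
    using cs ds by linarith
qed

text \<open>
Only this inequality needs an argument with covers; the reverse one, for \<open>k > 0\<close>, is the same
statement for \<open>1 / k\<close>.
\<close>

lemma cov_scale_le:
  assumes "f \<in> bounded_class" "V \<in> E" "0 \<le> k"
  shows "cov V (\<lambda>x. k * f x) \<le> k * cov V f"
proof (rule field_le_epsilon)
  fix \<epsilon> :: real assume e: "0 < \<epsilon>"
  then have "0 < \<epsilon> / (k + 1)" using assms(3) by simp
  then obtain cs where cs: "cs \<in> covers V f" "weight cs < cov V f + \<epsilon> / (k + 1)"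
    using cov_approx[OF assms(1,2)] by blast
  have "map (\<lambda>(c, y). (k * c, y)) cs \<in> covers V (\<lambda>x. k * f x)"
    using cs assms(3) by (auto simp: covers_def step_scale mult_left_mono)
  then have "cov V (\<lambda>x. k * f x) \<le> k * weight cs"
    by (metis cov_le weight_scale)
  also have "\<dots> \<le> k * (cov V f + \<epsilon> / (k + 1))"
    using cs assms(3) by (simp add: mult_left_mono)
  also have "\<dots> \<le> k * cov V f + \<epsilon>"
    using e assms(3) by (simp add: field_simps)
  finally show "cov V (\<lambda>x. k * f x) \<le> k * cov V f + \<epsilon>" .
qed

lemma cov_scale:
  assumes "f \<in> bounded_class" "V \<in> E" "0 < k"
  shows "cov V (\<lambda>x. k * f x) = k * cov V f"
proof (rule antisym)
  show "cov V (\<lambda>x. k * f x) \<le> k * cov V f" using cov_scale_le assms by simp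
  have "cov V (\<lambda>x. (1/k) * (k * f x)) \<le> (1/k) * cov V (\<lambda>x. k * f x)"
    using assms by (intro cov_scale_le bounded_class_scale) auto
  then show "k * cov V f \<le> cov V (\<lambda>x. k * f x)"
    using assms by (simp add: field_simps)
qed

lemma bounded_class_translate:
  assumes "f \<in> bounded_class" shows "(\<lambda>x. f (L b x)) \<in> bounded_class"
proof -
  have "totally_bounded {x. f (L b x) \<noteq> 0}"
    unfolding totally_bounded_def
  proof
    fix V assume V: "V \<in> E"
    obtain Y where Y: "finite Y" "{x. f x \<noteq> 0} \<subseteq> (\<Union>y\<in>Y. V y)"
      using assms V unfolding bounded_class_def totally_bounded_def by blast
    have "{x. f (L b x) \<noteq> 0} \<subseteq> (\<Union>y\<in>inv_into UNIV (L b) ` Y. V y)"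
    proof
      fix x assume "x \<in> {x. f (L b x) \<noteq> 0}"
      then obtain y where y: "y \<in> Y" "L b x \<in> V y" using Y by auto
      then have "x \<in> V (inv_into UNIV (L b) y)"
        using invariant[OF V, of b x "inv_into UNIV (L b) y"] by (simp add: surj_f_inv_f surj_L)
      then show "x \<in> (\<Union>y\<in>inv_into UNIV (L b) ` Y. V y)" using y by auto
    qed
    then show "\<exists>Y. finite Y \<and> {x. f (L b x) \<noteq> 0} \<subseteq> (\<Union>y\<in>Y. V y)"
      using Y(1) by blast
  qed
  then show ?thesis using assms by (auto simp: bounded_class_def)
qed

lemma step_translate:
  assumes "V \<in> E"
  shows "step V (map (\<lambda>(c, y). (c, L b y)) cs) (L b x) = step V cs x"
  by (induction cs) (auto simp: step_def indicator_def invariant[OF assms])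

lemma weight_translate: "weight (map (\<lambda>(c, y). (c, h y)) cs) = weight cs"
  by (induction cs) (auto simp: weight_def)

text \<open>
A translation carries a cover by neighbourhoods \<open>V y\<close> to a cover by neighbourhoods of the same
\<open>V\<close>, so covering numbers are invariant for each single \<open>V\<close>, before any limit is taken.
\<close>

lemma cov_translate:
  assumes f: "f \<in> bounded_class" and V: "V \<in> E"
  shows "cov V (\<lambda>x. f (L b x)) = cov V f"
proof (rule antisym)
  show "cov V f \<le> cov V (\<lambda>x. f (L b x))"
  proof (rule cov_greatest[OF bounded_class_translate[OF f] V])
    fix cs assume cs: "cs \<in> covers V (\<lambda>x. f (L b x))"
    have "f x \<le> step V (map (\<lambda>(c, y). (c, L b y)) cs) x" for x
    proof -
      obtain x' where "x = L b x'" using surj_L by (metis surjD)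
      then show ?thesis using cs step_translate[OF V] by (auto simp: covers_def)
    qed
    then have "map (\<lambda>(c, y). (c, L b y)) cs \<in> covers V f"
      using cs by (auto simp: covers_def)
    then show "cov V f \<le> weight cs" by (metis cov_le weight_translate)
  qed
  show "cov V (\<lambda>x. f (L b x)) \<le> cov V f"
  proof (rule cov_greatest[OF f V])
    fix cs assume cs: "cs \<in> covers V f"
    let ?ds = "map (\<lambda>(c, y). (c, inv_into UNIV (L b) y)) cs"
    have "map (\<lambda>(c, y). (c, L b y)) ?ds = cs"
      by (rule nth_equalityI) (auto simp: surj_f_inv_f surj_L split: prod.splits)
    then have "step V ?ds x = step V cs (L b x)" for x
      using step_translate[OF V, of b ?ds x] by simp
    then have "?ds \<in> covers V (\<lambda>x. f (L b x))"
      using cs by (auto simp: covers_def)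
    then show "cov V (\<lambda>x. f (L b x)) \<le> weight cs" by (metis cov_le weight_translate)
  qed
qed

text \<open>
By transitivity all neighbourhoods \<open>W x\<close> have the same covering number; the centre is immaterial.
\<close>

definition ball_cov :: "('a \<Rightarrow> 'a set) \<Rightarrow> ('a \<Rightarrow> 'a set) \<Rightarrow> real" where
  "ball_cov W V = cov V (indicator (W undefined))"

lemma cov_ball:
  assumes "V \<in> E" "W \<in> E" shows "cov V (indicator (W x)) = ball_cov W V"
proof -
  obtain b where b: "L b undefined = x" using transitive by blast
  have "(\<lambda>y. indicator (W x) (L b y)) = (indicator (W undefined) :: 'a \<Rightarrow> real)"
    unfolding b[symmetric] by (auto simp: indicator_def fun_eq_iff invariant[OF assms(2)])
  then show ?thesis
    using cov_translate[OF indicator_ball_bounded_class[OF assms(2), of x] assms(1), of b]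
    by (simp add: ball_cov_def)
qed

lemma cov_step:
  assumes "V \<in> E" "W \<in> E" "\<forall>(c, y)\<in>set cs. 0 \<le> c"
  shows "step W cs \<in> bounded_class \<and> cov V (step W cs) \<le> weight cs * ball_cov W V"
  using assms(3)
proof (induction cs)
  case Nil
  have z: "step W [] = (\<lambda>x. 0)" by (simp add: step_def fun_eq_iff)
  have "totally_bounded {}" by (auto simp: totally_bounded_def)
  then have b: "(\<lambda>x. 0) \<in> bounded_class" by (auto simp: bounded_class_def)
  have "[] \<in> covers V (\<lambda>x. 0)" by (simp add: covers_def step_def)
  then have "cov V (\<lambda>x. 0) \<le> 0" using cov_le by (fastforce simp: weight_def)
  then show ?case using b by (simp add: z weight_def)
next
  case (Cons p cs)
  obtain c y where p: "p = (c, y)" by (cases p)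
  have c: "0 \<le> c" using Cons p by simp
  have IH: "step W cs \<in> bounded_class" "cov V (step W cs) \<le> weight cs * ball_cov W V"
    using Cons by auto
  have s: "step W (p # cs) = (\<lambda>x. c * indicator (W y) x + step W cs x)"
    by (simp add: step_def fun_eq_iff p)
  have b: "(\<lambda>x. c * indicator (W y) x) \<in> bounded_class"
    using bounded_class_scale[OF indicator_ball_bounded_class[OF assms(2)] c] .
  have "cov V (step W (p # cs)) \<le> c * ball_cov W V + weight cs * ball_cov W V"
    unfolding s
    using cov_add[OF b IH(1) assms(1)] IH(2)
      cov_scale_le[OF indicator_ball_bounded_class[OF assms(2)] assms(1) c, of y]
    unfolding cov_ball[OF assms(1,2)] by (auto intro: order_trans)
  also have "\<dots> = weight (p # cs) * ball_cov W V"
    by (simp add: weight_def p algebra_simps)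
  finally show ?case
    using bounded_class_add[OF b IH(1)] by (simp add: s)
qed

lemma ball_cov_ge_1:
  assumes "V \<in> E" "W \<in> E" shows "1 \<le> ball_cov W V"
  unfolding ball_cov_def
proof (rule cov_greatest[OF indicator_ball_bounded_class[OF assms(2)] assms(1)])
  fix cs assume cs: "cs \<in> covers V (indicator (W undefined))"
  have "(1::real) = indicator (W undefined) undefined" using centre[OF assms(2)] by simp
  also have "\<dots> \<le> step V cs undefined" using cs unfolding covers_def by blast
  also have "\<dots> \<le> weight cs" using cs by (intro step_le_weight) (auto simp: covers_def)
  finally show "1 \<le> weight cs" .
qed

text \<open>
This is \<open>(f : V) \<le> (f : W) (W : V)\<close>: each neighbourhood \<open>W y\<close> of a cover of \<open>f\<close> is
covered in turn. It bounds the normalised covering numbers from above and, with \<open>f\<close> the indicator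
of a fixed neighbourhood, from below.
\<close>

lemma cov_chain:
  assumes "f \<in> bounded_class" "V \<in> E" "W \<in> E"
  shows "cov V f \<le> cov W f * ball_cov W V"
proof -
  have pos: "0 < ball_cov W V" using ball_cov_ge_1[OF assms(2,3)] by linarith
  have "cov V f / ball_cov W V \<le> cov W f"
  proof (rule cov_greatest[OF assms(1,3)])
    fix cs assume cs: "cs \<in> covers W f"
    then have nn: "\<forall>(c, y)\<in>set cs. 0 \<le> c" and le: "\<And>x. f x \<le> step W cs x"
      by (auto simp: covers_def)
    have "cov V f \<le> cov V (step W cs)"
      using cov_step[OF assms(2,3) nn] cov_mono[OF assms(1) _ assms(2) le] by blast
    also have "\<dots> \<le> weight cs * ball_cov W V" using cov_step[OF assms(2,3) nn] by blast
    finally show "cov V f / ball_cov W V \<le> weight cs" using pos by (simp add: field_simps)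
  qed
  then show ?thesis using pos by (simp add: field_simps)
qed

lemma ucont_add: 
  assumes "ucont f" "ucont g" shows "ucont (\<lambda>x. f x + g x)"
  unfolding ucont_def
proof (intro allI impI)
  fix \<epsilon> :: real assume "0 < \<epsilon>"
  then have "0 < \<epsilon> / 2" by simp
  then obtain V W where V: "V \<in> E" "\<forall>x. \<forall>y\<in>V x. \<bar>f y - f x\<bar> \<le> \<epsilon> / 2"
    and W: "W \<in> E" "\<forall>x. \<forall>y\<in>W x. \<bar>g y - g x\<bar> \<le> \<epsilon> / 2"
    using assms unfolding ucont_def by meson
  obtain U where U: "U \<in> E" "\<forall>x. U x \<subseteq> V x \<inter> W x" using directed V W by blast
  have "\<bar>f y + g y - (f x + g x)\<bar> \<le> \<epsilon>" if "y \<in> U x" for x y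
  proof -
    have "\<bar>f y - f x\<bar> \<le> \<epsilon> / 2" "\<bar>g y - g x\<bar> \<le> \<epsilon> / 2" using that U V W by blast+
    then show ?thesis by linarith
  qed
  then show "\<exists>V\<in>E. \<forall>x. \<forall>y\<in>V x. \<bar>f y + g y - (f x + g x)\<bar> \<le> \<epsilon>" using U by blast
qed

lemma uc_class_add: "f \<in> uc_class \<Longrightarrow> g \<in> uc_class \<Longrightarrow> (\<lambda>x. f x + g x) \<in> uc_class"
  by (simp add: uc_class_def ucont_add bounded_class_add)

text \<open>
The denominator is cut off below by \<open>\<delta>\<close> because \<open>f / g\<close> itself need not be uniformly continuous
where \<open>g\<close> is small.
\<close>

lemma ucont_truncated_quotient:
  assumes f: "ucont f" "\<And>x. \<bar>f x\<bar> \<le> g x" and g: "ucont g" and d: "0 < \<delta>"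
  shows "ucont (\<lambda>x. f x / max (g x) \<delta>)"
  unfolding ucont_def
proof (intro allI impI)
  fix \<epsilon> :: real assume e: "0 < \<epsilon>"
  then have "0 < \<epsilon> * \<delta> / 2" using d by simp
  then obtain V W where V: "V \<in> E" "\<forall>x. \<forall>y\<in>V x. \<bar>f y - f x\<bar> \<le> \<epsilon> * \<delta> / 2"
    and W: "W \<in> E" "\<forall>x. \<forall>y\<in>W x. \<bar>g y - g x\<bar> \<le> \<epsilon> * \<delta> / 2"
    using f(1) g unfolding ucont_def by meson
  obtain U where U: "U \<in> E" "\<forall>x. U x \<subseteq> V x \<inter> W x" using directed V W by blast
  have "\<bar>f y / max (g y) \<delta> - f x / max (g x) \<delta>\<bar> \<le> \<epsilon>" if "y \<in> U x" for x y
  proof -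
    define p q where "p = max (g y) \<delta>" and "q = max (g x) \<delta>"
    have pq: "\<delta> \<le> p" "\<delta> \<le> q" "0 < p" "0 < q" using d by (auto simp: p_def q_def)
    have fxq: "\<bar>f x\<bar> \<le> q" using f(2)[of x] by (simp add: q_def)
    have a: "\<bar>f y - f x\<bar> \<le> \<epsilon> * \<delta> / 2" and "\<bar>g y - g x\<bar> \<le> \<epsilon> * \<delta> / 2"
      using that U V W by blast+
    then have b: "\<bar>q - p\<bar> \<le> \<epsilon> * \<delta> / 2" unfolding p_def q_def by linarith
    have "f y / p - f x / q = (f y - f x) / p + (f x / q) * ((q - p) / p)"
      using pq by (simp add: field_simps)
    then have "\<bar>f y / p - f x / q\<bar> \<le> \<bar>f y - f x\<bar> / p + \<bar>f x / q\<bar> * (\<bar>q - p\<bar> / p)"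
      using abs_triangle_ineq[of "(f y - f x) / p" "(f x / q) * ((q - p) / p)"] pq
      by (simp add: abs_mult)
    also have "\<dots> \<le> (\<epsilon> * \<delta> / 2) / \<delta> + 1 * ((\<epsilon> * \<delta> / 2) / \<delta>)"
      using a b pq fxq d e
      by (intro add_mono mult_mono frac_le) auto
    also have "\<dots> = \<epsilon>" using d by simp
    finally show ?thesis by (simp add: p_def q_def)
  qed
  then show "\<exists>V\<in>E. \<forall>x. \<forall>y\<in>V x. \<bar>f y / max (g y) \<delta> - f x / max (g x) \<delta>\<bar> \<le> \<epsilon>" using U by blast
qed

lemma step_weighted_le:
  assumes V: "V \<in> E" and nn: "\<forall>(c, y)\<in>set cs. 0 \<le> c" 
    and h: "\<And>x y. y \<in> V x \<Longrightarrow> h y \<le> k x"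
  shows "h x * step V cs x \<le> step V (map (\<lambda>(c, y). (c * k y, y)) cs) x"
  using nn
proof (induction cs)
  case (Cons p cs)
  obtain c y where p: "p = (c, y)" by (cases p)
  have c: "0 \<le> c" using Cons p by simp
  have IH: "h x * step V cs x \<le> step V (map (\<lambda>(c, y). (c * k y, y)) cs) x"
    using Cons by auto
  have "h x * (c * indicator (V y) x) \<le> c * k y * indicator (V y) x"
    using h[of x y] c by (auto simp: indicator_def mult.commute intro: mult_left_mono)
  then show ?case using IH by (simp add: step_def p distrib_left)
qed (simp add: step_def)

lemma weight_weighted_le:
  assumes nn: "\<forall>(c, y)\<in>set cs. 0 \<le> c" and k: "\<And>y. k y + l y \<le> (s::real)"
  shows "weight (map (\<lambda>(c, y). (c * k y, y)) cs) + weight (map (\<lambda>(c, y). (c * l y, y)) cs)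
    \<le> s * weight cs"
  using nn
proof (induction cs)
  case (Cons p cs)
  obtain c y where p: "p = (c, y)" by (cases p)
  have c: "0 \<le> c" using Cons p by simp
  have "c * k y + c * l y \<le> s * c"
    using mult_left_mono[OF k[of y] c] by (simp add: algebra_simps)
  then show ?case using Cons by (simp add: weight_def p distrib_left)
qed (simp add: weight_def)

text \<open>
Covering numbers are subadditive, and they become additive in the limit. Put \<open>F = f + g\<close> and let
\<open>h\<close> be one of \<open>f / F\<close>, \<open>g / F\<close>, which add up to \<open>1\<close>. If \<open>F\<close> is below a combination of
neighbourhoods \<open>V y\<close> so small that \<open>h\<close> varies by at most \<open>\<epsilon>\<close> on each, then multiplying
the coefficient at \<open>y\<close> by \<open>h y + \<epsilon>\<close> yields a cover of \<open>h F\<close>, and the weights of the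
two covers obtained in this way add up to at most \<open>1 + 2 \<epsilon>\<close> times the original weight. Where
\<open>F < \<delta>\<close> the quotients are replaced by \<open>f / \<delta>\<close> and \<open>g / \<delta>\<close>; this costs the last term.
\<close>

lemma cov_almost_additive:
  assumes f: "f \<in> uc_class" and g: "g \<in> uc_class" and e: "0 < \<epsilon>" and d: "0 < \<delta>"
  shows "\<exists>W\<in>E. \<forall>V\<in>E. (\<forall>x. V x \<subseteq> W x) \<longrightarrow>
     cov V f + cov V g \<le> (1 + 2 * \<epsilon>) * cov V (\<lambda>x. f x + g x)
        + 2 * \<delta> * cov V (indicator {x. f x + g x \<noteq> 0})"
proof -
  define F where "F = (\<lambda>x. f x + g x)"
  have FB: "F \<in> bounded_class" and FU: "ucont F"
    using uc_class_add[OF f g] by (auto simp: F_def uc_class_def)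
  have fB: "f \<in> bounded_class" "g \<in> bounded_class" using f g by (auto simp: uc_class_def)
  have nn: "\<And>x. 0 \<le> f x" "\<And>x. 0 \<le> g x" using fB by (auto simp: bounded_class_def)
  have SB: "(indicator {x. F x \<noteq> 0} :: 'a \<Rightarrow> real) \<in> bounded_class"
  proof -
    have "totally_bounded {x. F x \<noteq> 0}" using FB by (simp add: bounded_class_def)
    then show ?thesis by (rule indicator_bounded_class)
  qed
  define hf hg where "hf = (\<lambda>x. f x / max (F x) \<delta>)" and "hg = (\<lambda>x. g x / max (F x) \<delta>)"
  have hfu: "ucont hf" and hgu: "ucont hg"
    using f g FU d nn unfolding hf_def hg_def
    by (auto intro!: ucont_truncated_quotient simp: uc_class_def F_def)
  have hnn: "\<And>x. 0 \<le> hf x" "\<And>x. 0 \<le> hg x"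
    using nn d unfolding hf_def hg_def by auto
  have hsum: "hf x + hg x \<le> 1" for x
    using d unfolding hf_def hg_def F_def by (simp add: field_simps max_def)
  have split: "u x \<le> (u x / max (F x) \<delta>) * F x + \<delta> * indicator {x. F x \<noteq> 0} x"
    if "\<And>x. 0 \<le> u x" "\<And>x. u x \<le> F x" for u x
  proof (cases "F x \<ge> \<delta>")
    case True then show ?thesis using d by (auto simp: max_def)
  next
    case False
    have "u x \<le> \<delta> * indicator {x. F x \<noteq> 0} x"
      using that[of x] False by (auto simp: indicator_def)
    moreover have "0 \<le> (u x / max (F x) \<delta>) * F x" using that(1)[of x] that(2)[of x] d by simp
    ultimately show ?thesis by linarith
  qed
  obtain W1 where W1: "W1 \<in> E" "\<forall>x. \<forall>y\<in>W1 x. \<bar>hf y - hf x\<bar> \<le> \<epsilon>"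
    using hfu e unfolding ucont_def by blast
  obtain W2 where W2: "W2 \<in> E" "\<forall>x. \<forall>y\<in>W2 x. \<bar>hg y - hg x\<bar> \<le> \<epsilon>"
    using hgu e unfolding ucont_def by blast
  obtain W where W: "W \<in> E" "\<forall>x. W x \<subseteq> W1 x \<inter> W2 x" using directed W1 W2 by blast
  have "cov V f + cov V g \<le> (1 + 2 * \<epsilon>) * cov V F + 2 * \<delta> * cov V (indicator {x. F x \<noteq> 0})"
    if V: "V \<in> E" and VW: "\<forall>x. V x \<subseteq> W x" for V
  proof -
    have near: "hf y \<le> hf x + \<epsilon>" "hg y \<le> hg x + \<epsilon>" if "y \<in> V x" for x y
    proof -
      have "y \<in> W1 x" "y \<in> W2 x" using that VW W by blast+
      then have "\<bar>hf y - hf x\<bar> \<le> \<epsilon>" "\<bar>hg y - hg x\<bar> \<le> \<epsilon>" using W1 W2 by blast+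
      then show "hf y \<le> hf x + \<epsilon>" "hg y \<le> hg x + \<epsilon>" by linarith+
    qed
    have part: "cov V u \<le> cov V (\<lambda>x. h x * F x) + \<delta> * cov V (indicator {x. F x \<noteq> 0})
        \<and> (\<lambda>x. h x * F x) \<in> bounded_class"
      if u: "u \<in> bounded_class" "\<And>x. u x \<le> F x" and h: "h = (\<lambda>x. u x / max (F x) \<delta>)" for u h
    proof -
      have unn: "\<And>x. 0 \<le> u x" using u by (auto simp: bounded_class_def)
      have Fnn: "\<And>x. 0 \<le> F x" using unn u(2) order_trans by blast
      have h1: "h x \<le> 1" "0 \<le> h x" for x
        using unn[of x] u(2)[of x] d unfolding h by (auto simp: field_simps max_def)
      have hB: "(\<lambda>x. h x * F x) \<in> bounded_class"
        using h1 Fnn by (intro bounded_class_le[OF FB]) (auto simp: mult_left_le_one_le)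
      have sB: "(\<lambda>x. \<delta> * indicator {x. F x \<noteq> 0} x) \<in> bounded_class"
        using bounded_class_scale[OF SB] d by simp
      have "cov V u \<le> cov V (\<lambda>x. h x * F x + \<delta> * indicator {x. F x \<noteq> 0} x)"
        using split[OF unn u(2)] unfolding h
        by (intro cov_mono[OF u(1) _ V] bounded_class_add) (use hB sB in \<open>auto simp: h\<close>)
      also have "\<dots> \<le> cov V (\<lambda>x. h x * F x) + cov V (\<lambda>x. \<delta> * indicator {x. F x \<noteq> 0} x)"
        by (rule cov_add[OF hB sB V])
      also have "cov V (\<lambda>x. \<delta> * indicator {x. F x \<noteq> 0} x) \<le> \<delta> * cov V (indicator {x. F x \<noteq> 0})"
        using cov_scale_le[OF SB V] d by simp
      finally show ?thesis using hB by simp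
    qed
    have pf: "cov V f \<le> cov V (\<lambda>x. hf x * F x) + \<delta> * cov V (indicator {x. F x \<noteq> 0})"
      and bf: "(\<lambda>x. hf x * F x) \<in> bounded_class"
      using part[OF fB(1) _ hf_def] nn by (auto simp: F_def)
    have pg: "cov V g \<le> cov V (\<lambda>x. hg x * F x) + \<delta> * cov V (indicator {x. F x \<noteq> 0})"
      and bg: "(\<lambda>x. hg x * F x) \<in> bounded_class"
      using part[OF fB(2) _ hg_def] nn by (auto simp: F_def)
    have "(cov V (\<lambda>x. hf x * F x) + cov V (\<lambda>x. hg x * F x)) / (1 + 2 * \<epsilon>) \<le> cov V F"
    proof (rule cov_greatest[OF FB V])
      fix cs assume cs: "cs \<in> covers V F"
      then have cnn: "\<forall>(c, y)\<in>set cs. 0 \<le> c" and le: "\<And>x. F x \<le> step V cs x"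
        by (auto simp: covers_def)
      have cov1: "map (\<lambda>(c, y). (c * (h y + \<epsilon>), y)) cs \<in> covers V (\<lambda>x. h x * F x)"
        if "\<And>x. 0 \<le> h x" "\<And>x y. y \<in> V x \<Longrightarrow> h y \<le> h x + \<epsilon>" for h
      proof -
        have "h x * F x \<le> step V (map (\<lambda>(c, y). (c * (h y + \<epsilon>), y)) cs) x" for x
          using mult_left_mono[OF le[of x] that(1)[of x]]
            step_weighted_le[OF V cnn, of h "\<lambda>y. h y + \<epsilon>" x] that(2) by fastforce
        then show ?thesis using cnn that(1) e by (fastforce simp: covers_def)
      qed
      have "cov V (\<lambda>x. hf x * F x) + cov V (\<lambda>x. hg x * F x)
         \<le> weight (map (\<lambda>(c, y). (c * (hf y + \<epsilon>), y)) cs) + weight (map (\<lambda>(c, y). (c * (hg y + \<epsilon>), y)) cs)"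
        using cov1[of hf] cov1[of hg] hnn near by (intro add_mono cov_le) auto
      also have "\<dots> \<le> (1 + 2 * \<epsilon>) * weight cs"
        using hsum by (intro weight_weighted_le[OF cnn]) (simp add: algebra_simps)
      finally show "(cov V (\<lambda>x. hf x * F x) + cov V (\<lambda>x. hg x * F x)) / (1 + 2 * \<epsilon>) \<le> weight cs"
        using e by (simp add: field_simps)
    qed
    then have "cov V (\<lambda>x. hf x * F x) + cov V (\<lambda>x. hg x * F x) \<le> (1 + 2 * \<epsilon>) * cov V F"
      using e by (simp add: field_simps)
    then show ?thesis using pf pg by (simp add: algebra_simps)
  qed
  then show ?thesis using W(1) unfolding F_def by blast
qed

section \<open>The invariant functional as a limit of covering numbers\<close>

lemma uc_class_scale:
  assumes "f \<in> uc_class" "0 \<le> k" shows "(\<lambda>x. k * f x) \<in> uc_class"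
proof -
  have "ucont (\<lambda>x. k * f x)"
    unfolding ucont_def
  proof (intro allI impI)
    fix \<epsilon> :: real assume "0 < \<epsilon>"
    then have "0 < \<epsilon> / (k + 1)" using assms(2) by simp
    then obtain V where V: "V \<in> E" "\<forall>x. \<forall>y\<in>V x. \<bar>f y - f x\<bar> \<le> \<epsilon> / (k + 1)"
      using assms(1) unfolding uc_class_def ucont_def by blast
    have "\<bar>k * f y - k * f x\<bar> \<le> \<epsilon>" if "y \<in> V x" for x y
    proof -
      have "\<bar>k * f y - k * f x\<bar> = k * \<bar>f y - f x\<bar>"
        using assms(2) by (simp add: abs_mult flip: right_diff_distrib)
      also have "\<dots> \<le> k * (\<epsilon> / (k + 1))" using V that assms(2) by (intro mult_left_mono) auto
      also have "\<dots> \<le> \<epsilon>" using \<open>0 < \<epsilon>\<close> assms(2) by (simp add: field_simps)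
      finally show ?thesis .
    qed
    then show "\<exists>V\<in>E. \<forall>x. \<forall>y\<in>V x. \<bar>k * f y - k * f x\<bar> \<le> \<epsilon>" using V by blast
  qed
  then show ?thesis using assms bounded_class_scale by (simp add: uc_class_def)
qed

lemma uc_class_translate:
  assumes "f \<in> uc_class" shows "(\<lambda>x. f (L b x)) \<in> uc_class"
proof -
  have "ucont (\<lambda>x. f (L b x))"
    using assms unfolding uc_class_def ucont_def mem_Collect_eq by (meson invariant)
  then show ?thesis using assms bounded_class_translate by (simp add: uc_class_def)
qed

text \<open>
The filter along which neighbourhoods shrink; eventually means for all members of \<open>E\<close> inside some \<open>W \<in> E\<close>.
\<close>

definition finer :: "('a \<Rightarrow> 'a set) filter" where
  "finer = (INF W\<in>E. principal {V \<in> E. \<forall>x. V x \<subseteq> W x})"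

lemma eventually_finer: "eventually P finer \<longleftrightarrow> (\<exists>W\<in>E. \<forall>V\<in>E. (\<forall>x. V x \<subseteq> W x) \<longrightarrow> P V)"
  unfolding finer_def
proof (subst eventually_INF_base)
  fix V W assume "V \<in> E" "W \<in> E"
  then obtain U where "U \<in> E" "\<forall>x. U x \<subseteq> V x \<inter> W x" using directed by blast
  then show "\<exists>U\<in>E. principal {V \<in> E. \<forall>x. V x \<subseteq> U x}
      \<le> inf (principal {U \<in> E. \<forall>x. U x \<subseteq> V x}) (principal {V \<in> E. \<forall>x. V x \<subseteq> W x})"
    by (intro bexI[of _ U]) (auto, blast+)
qed (use E_nonempty in \<open>auto simp: eventually_principal\<close>)

lemma finer_not_bot: "finer \<noteq> bot"
  unfolding trivial_limit_def eventually_finer by blast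

text \<open>
Tychonoff's theorem gives a cluster point of the functionals \<open>T V\<close>. A cluster point is enough, as
each property that is wanted of the limit says that it lies in some closed set of functionals.
\<close>

lemma cluster_functional:
  fixes T :: "('a \<Rightarrow> 'a set) \<Rightarrow> ('a \<Rightarrow> real) \<Rightarrow> real"
  assumes "\<And>V f. V \<in> E \<Longrightarrow> T V f \<in> {0..b f}"
  obtains I where "\<And>C. closed C \<Longrightarrow> eventually (\<lambda>V. T V \<in> C) finer \<Longrightarrow> I \<in> C"
proof -
  have "compactin (product_topology (\<lambda>f. euclidean) UNIV) (\<Pi>\<^sub>E f\<in>UNIV. {0..b f})"
    by (simp add: compactin_PiE)
  then have K: "compact (\<Pi>\<^sub>E f\<in>UNIV. {0..b f})"
    by (simp add: euclidean_product_topology)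
  have "eventually (\<lambda>I. I \<in> (\<Pi>\<^sub>E f\<in>UNIV. {0..b f})) (filtermap T finer)"
    using assms E_nonempty unfolding eventually_filtermap eventually_finer by (auto simp: PiE_def)
  moreover have "filtermap T finer \<noteq> bot" by (simp add: filtermap_bot_iff finer_not_bot)
  ultimately obtain I where I: "inf (nhds I) (filtermap T finer) \<noteq> bot"
    using K unfolding compact_filter by blast
  have "I \<in> C" if C: "closed C" and ev: "eventually (\<lambda>V. T V \<in> C) finer" for C
  proof (rule ccontr)
    assume "I \<notin> C"
    then have "eventually (\<lambda>J. J \<in> - C) (nhds I)"
      using C by (intro eventually_nhds_in_open) auto
    moreover have "eventually (\<lambda>J. J \<in> C) (filtermap T finer)"
      using ev by (simp add: eventually_filtermap)
    ultimately have "eventually (\<lambda>_. False) (inf (nhds I) (filtermap T finer))"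
      unfolding eventually_inf by blast
    then show False using I by (simp add: trivial_limit_def)
  qed
  then show ?thesis using that by blast
qed

lemma continuous_on_eval [continuous_intros]:
  "continuous_on UNIV (\<lambda>I :: ('a \<Rightarrow> real) \<Rightarrow> real. I f)"
  by (rule continuous_on_product_coordinates)

text \<open>
The limit is taken of \<open>(f : V) / (V0 : V)\<close> for a fixed \<open>V0\<close>. These quotients lie in the compact
interval from \<open>0\<close> to \<open>(f : V0)\<close>. They stay away from \<open>0\<close> when \<open>f\<close> does not vanish,
since uniform continuity puts a positive multiple of the indicator of some \<open>W x\<close> below \<open>f\<close>, and
\<open>(V0 : V) \<le> (V0 : W) (W : V)\<close>.
\<close>

theorem exists_invariant_functional:
  obtains I :: "('a \<Rightarrow> real) \<Rightarrow> real" where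
    "\<And>f. f \<in> uc_class \<Longrightarrow> 0 \<le> I f"
    "\<And>f x. f \<in> uc_class \<Longrightarrow> f x \<noteq> 0 \<Longrightarrow> 0 < I f"
    "\<And>f g. f \<in> uc_class \<Longrightarrow> g \<in> uc_class \<Longrightarrow> I (\<lambda>x. f x + g x) = I f + I g"
    "\<And>f k. f \<in> uc_class \<Longrightarrow> 0 < k \<Longrightarrow> I (\<lambda>x. k * f x) = k * I f"
    "\<And>f b. f \<in> uc_class \<Longrightarrow> I (\<lambda>x. f (L b x)) = I f"
proof -
  obtain V0 where V0: "V0 \<in> E" using E_nonempty by blast
  define T where "T = (\<lambda>V f. if f \<in> uc_class then cov V f / ball_cov V0 V else 0)"
  have pos: "0 < ball_cov V0 V" if "V \<in> E" for V using ball_cov_ge_1[OF that V0] by linarith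
  have B: "f \<in> bounded_class" if "f \<in> uc_class" for f using that by (simp add: uc_class_def)
  have ratio: "cov V f / ball_cov V0 V \<le> cov V0 f" if "V \<in> E" "f \<in> bounded_class" for V f
    using cov_chain[OF that(2,1) V0] pos[OF that(1)] by (simp add: field_simps)
  have bound: "T V f \<in> {0..if f \<in> uc_class then cov V0 f else 0}" if "V \<in> E" for V f
    using that ratio B pos[OF that] by (auto simp: T_def cov_nonneg)
  obtain I where I: "\<And>C. closed C \<Longrightarrow> eventually (\<lambda>V. T V \<in> C) finer \<Longrightarrow> I \<in> C"
    using cluster_functional[of T, OF bound] by blast
  have always: "I \<in> C" if "closed C" "\<And>V. V \<in> E \<Longrightarrow> T V \<in> C" for C
    using that V0 by (intro I) (auto simp: eventually_finer)
  show ?thesis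
  proof
    fix f assume f: "f \<in> uc_class"
    have "I \<in> {I. 0 \<le> I f}"
      using bound[of _ f] by (intro always closed_Collect_le continuous_intros) auto
    then show "0 \<le> I f" by simp
  next
    fix f x assume f: "f \<in> uc_class" and x: "f x \<noteq> 0"
    have fx: "0 < f x" and fnn: "\<And>y. 0 \<le> f y"
      using f x unfolding uc_class_def bounded_class_def by (auto simp: less_le)
    then have "0 < f x / 2" by simp
    then obtain W where W: "W \<in> E" "\<forall>z. \<forall>y\<in>W z. \<bar>f y - f z\<bar> \<le> f x / 2"
      using f unfolding uc_class_def ucont_def by blast
    have le: "f x / 2 * indicator (W x) y \<le> f y" for y
    proof (cases "y \<in> W x")
      case True
      then have "\<bar>f y - f x\<bar> \<le> f x / 2" using W by blast
      then have "f x / 2 \<le> f y" by linarith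
      then show ?thesis using True by simp
    qed (simp add: fnn)
    have WB: "(indicator (W x) :: 'a \<Rightarrow> real) \<in> bounded_class"
      by (rule indicator_ball_bounded_class[OF W(1)])
    have low: "f x / 2 / ball_cov V0 W \<le> T V f" if V: "V \<in> E" for V
    proof -
      have "ball_cov V0 V \<le> ball_cov V0 W * ball_cov W V"
        using cov_chain[OF indicator_ball_bounded_class[OF V0] V W(1)]
        unfolding ball_cov_def[of V0] .
      moreover have "f x / 2 * ball_cov W V \<le> cov V f"
        using cov_mono[OF bounded_class_scale[OF WB] B[OF f] V le] cov_scale[OF WB V, of "f x / 2"]
          fx cov_ball[OF V W(1)] by simp
      ultimately have chain: "ball_cov V0 V \<le> ball_cov V0 W * ball_cov W V"
        "f x / 2 * ball_cov W V \<le> cov V f" .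
      have "f x / 2 * ball_cov V0 V \<le> f x / 2 * (ball_cov V0 W * ball_cov W V)"
        using chain(1) fx by (intro mult_left_mono) auto
      also have "\<dots> = ball_cov V0 W * (f x / 2 * ball_cov W V)" by simp
      also have "\<dots> \<le> ball_cov V0 W * cov V f"
        using chain(2) pos[OF W(1)] by (intro mult_left_mono) auto
      finally have "f x / 2 * ball_cov V0 V \<le> ball_cov V0 W * cov V f" .
      then show ?thesis using f pos[OF W(1)] pos[OF V] by (simp add: T_def field_simps)
    qed
    have "I \<in> {I. f x / 2 / ball_cov V0 W \<le> I f}"
      using low by (intro always closed_Collect_le continuous_intros) auto
    moreover have "0 < f x / 2 / ball_cov V0 W" using fx pos[OF W(1)] by simp
    ultimately show "0 < I f" by simp
  next
    fix f g assume f: "f \<in> uc_class" and g: "g \<in> uc_class"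
    define F where "F = (\<lambda>x. f x + g x)"
    have F: "F \<in> uc_class" using uc_class_add[OF f g] by (simp add: F_def)
    have "I \<in> {I. I F \<le> I f + I g}"
    proof (intro always closed_Collect_le continuous_intros)
      fix V assume V: "V \<in> E"
      show "T V \<in> {I. I F \<le> I f + I g}"
        using cov_add[OF B[OF f] B[OF g] V] pos[OF V] f g F
        by (simp add: T_def F_def divide_right_mono flip: add_divide_distrib)
    qed
    then have up: "I F \<le> I f + I g" by simp
    have "I f + I g \<le> I F + \<eta>" if eta: "0 < \<eta>" for \<eta>
    proof -
      define S where "S = (indicator {x. f x + g x \<noteq> 0} :: 'a \<Rightarrow> real)"
      have "totally_bounded {x. f x + g x \<noteq> 0}" using B[OF F] by (simp add: bounded_class_def F_def)
      then have S: "S \<in> bounded_class" unfolding S_def by (rule indicator_bounded_class)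
      \<comment> \<open>Chosen so that both error terms of almost additivity contribute at most \<open>\<eta> / 2\<close>.\<close>
      define \<epsilon> \<delta> where "\<epsilon> = \<eta> / (4 * (cov V0 F + 1))" and "\<delta> = \<eta> / (4 * (cov V0 S + 1))"
      have cnn: "0 \<le> cov V0 F" "0 \<le> cov V0 S" using cov_nonneg B[OF F] S V0 by blast+
      then have ed: "0 < \<epsilon>" "0 < \<delta>" using eta by (simp_all add: \<epsilon>_def \<delta>_def)
      have eb: "2 * \<epsilon> * cov V0 F \<le> \<eta> / 2" "2 * \<delta> * cov V0 S \<le> \<eta> / 2"
        using cnn eta by (auto simp: \<epsilon>_def \<delta>_def field_simps)
      obtain W where W1: "W \<in> E" and W2: "\<forall>V\<in>E. (\<forall>x. V x \<subseteq> W x) \<longrightarrow>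
          cov V f + cov V g \<le> (1 + 2 * \<epsilon>) * cov V F + 2 * \<delta> * cov V S"
        using cov_almost_additive[OF f g ed] unfolding F_def[symmetric] S_def[symmetric] by (elim bexE) (rule that)
      have "T V f + T V g \<le> T V F + \<eta>" if V: "V \<in> E" and VW: "\<forall>x. V x \<subseteq> W x" for V
      proof -
        have "T V f + T V g = (cov V f + cov V g) / ball_cov V0 V"
          using f g by (simp add: T_def add_divide_distrib)
        also have "\<dots> \<le> ((1 + 2 * \<epsilon>) * cov V F + 2 * \<delta> * cov V S) / ball_cov V0 V"
          using W2[rule_format, OF V] VW pos[OF V] by (intro divide_right_mono) auto
        also have "\<dots> = T V F + 2 * \<epsilon> * (cov V F / ball_cov V0 V) + 2 * \<delta> * (cov V S / ball_cov V0 V)"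
          using F by (simp add: T_def add_divide_distrib algebra_simps)
        also have "\<dots> \<le> T V F + 2 * \<epsilon> * cov V0 F + 2 * \<delta> * cov V0 S"
          using ratio[OF V B[OF F]] ratio[OF V S] ed by (intro add_mono mult_left_mono) auto
        also have "\<dots> \<le> T V F + \<eta>" using eb by linarith
        finally show ?thesis .
      qed
      then have "eventually (\<lambda>V. T V \<in> {I. I f + I g \<le> I F + \<eta>}) finer"
        using W1 by (auto simp: eventually_finer)
      then have "I \<in> {I. I f + I g \<le> I F + \<eta>}"
        by (intro I closed_Collect_le continuous_intros)
      then show ?thesis by simp
    qed
    then have "I f + I g \<le> I F" by (rule field_le_epsilon)
    with up show "I (\<lambda>x. f x + g x) = I f + I g" by (simp add: F_def)
  next
    fix f and k :: real assume f: "f \<in> uc_class" and k: "0 < k"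
    have kf: "(\<lambda>x. k * f x) \<in> uc_class" using uc_class_scale f k by simp
    have "I \<in> {I. I (\<lambda>x. k * f x) = k * I f}"
      using cov_scale[OF B[OF f] _ k] f kf
      by (intro always closed_Collect_eq continuous_intros) (auto simp: T_def)
    then show "I (\<lambda>x. k * f x) = k * I f" by simp
  next
    fix f b assume f: "f \<in> uc_class"
    have "I \<in> {I. I (\<lambda>x. f (L b x)) = I f}"
      using cov_translate[OF B[OF f]] f uc_class_translate[OF f]
      by (intro always closed_Collect_eq continuous_intros) (auto simp: T_def)
    then show "I (\<lambda>x. f (L b x)) = I f" by simp
  qed
qed

end

section \<open>Continuous functions with compact support\<close>

text \<open>
Separation is a hypothesis on the topology throughout, and not a type class, because the loop is only known to be
\<open>T\<^sub>1\<close> and its Hausdorff property is a consequence of the loop structure.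
\<close>

lemma hausdorff_compact_closed:
  assumes "Hausdorff_space (euclidean :: 'a::topological_space topology)" "compact (K :: 'a set)"
  shows "closed K"
  using compactin_imp_closedin[OF assms(1), of K] assms(2) by simp

lemma C00_I:
  fixes f :: "'a::topological_space \<Rightarrow> real"
  assumes "Hausdorff_space (euclidean :: 'a topology)" "continuous_on UNIV f" "\<And>x. 0 \<le> f x"
    "compact K" "\<And>x. f x \<noteq> 0 \<Longrightarrow> x \<in> K"
  shows "f \<in> C00_plus"
proof -
  have "closed K" by (rule hausdorff_compact_closed) fact+
  then have "closure {x. f x \<noteq> 0} \<subseteq> K" using assms(5) by (intro closure_minimal) auto
  then have "compact (closure {x. f x \<noteq> 0})"
    using assms(4) by (metis closed_Int_compact closed_closure inf.absorb1)
  then show ?thesis using assms by (auto simp: C00_plus_def)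
qed

lemma C00_support:
  assumes "f \<in> C00_plus"
  obtains K where "compact K" "\<And>x. f x \<noteq> 0 \<Longrightarrow> x \<in> K"
  using assms closure_subset[of "{x. f x \<noteq> 0}"] unfolding C00_plus_def by blast

lemma C00_cont: "f \<in> C00_plus \<Longrightarrow> continuous_on UNIV f"
  and C00_nonneg: "f \<in> C00_plus \<Longrightarrow> 0 \<le> f x"
  by (auto simp: C00_plus_def)

lemma C00_dominated:
  fixes f :: "'a::topological_space \<Rightarrow> real"
  assumes "g \<in> C00_plus" "continuous_on UNIV f" "\<And>x. 0 \<le> f x" "\<And>x. g x = 0 \<Longrightarrow> f x = 0"
  shows "f \<in> C00_plus"
proof -
  have "closure {x. f x \<noteq> 0} \<subseteq> closure {x. g x \<noteq> 0}"
    using assms(4) by (intro closure_mono) auto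
  then have "compact (closure {x. f x \<noteq> 0})"
    using assms(1) by (metis (mono_tags, lifting) C00_plus_def closed_Int_compact closed_closure inf.absorb1 mem_Collect_eq)
  then show ?thesis using assms by (auto simp: C00_plus_def)
qed

lemma C00_add: 
  assumes "f \<in> C00_plus" "g \<in> C00_plus" shows "(\<lambda>x. f x + g x) \<in> C00_plus"
proof -
  have "closure {x. f x + g x \<noteq> 0} \<subseteq> closure ({x. f x \<noteq> 0} \<union> {x. g x \<noteq> 0})"
    by (intro closure_mono) auto
  then have "compact (closure {x. f x + g x \<noteq> 0})"
    using assms unfolding C00_plus_def closure_Un
    by (metis (no_types, lifting) closed_Int_compact closed_closure compact_Un inf.absorb1 mem_Collect_eq)
  then show ?thesis using assms by (auto simp: C00_plus_def intro!: continuous_intros)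
qed

lemma C00_zero: "(\<lambda>x. 0) \<in> C00_plus"
  by (simp add: C00_plus_def)

lemma C00_sum: "(\<And>i. i \<in> A \<Longrightarrow> f i \<in> C00_plus) \<Longrightarrow> (\<lambda>x. \<Sum>i\<in>A. f i x) \<in> C00_plus"
  by (induction A rule: infinite_finite_induct) (auto intro: C00_add C00_zero)

lemma C00_scale: "f \<in> C00_plus \<Longrightarrow> 0 \<le> k \<Longrightarrow> (\<lambda>x. k * f x) \<in> C00_plus"
  by (rule C00_dominated[of f]) (auto intro!: continuous_intros simp: C00_plus_def)

lemma C00_bounded:
  assumes "f \<in> C00_plus" obtains B where "0 < B" "\<And>x. f x \<le> B"
proof -
  obtain K where K: "compact K" "\<And>x. f x \<noteq> 0 \<Longrightarrow> x \<in> K" using C00_support[OF assms] by blast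
  have "compact (f ` K)"
    using K(1) C00_cont[OF assms] by (meson compact_continuous_image continuous_on_subset subset_UNIV)
  then obtain B where B: "\<forall>y\<in>f ` K. \<bar>y\<bar> \<le> B" by (auto dest!: compact_imp_bounded simp: bounded_real)
  have "f x \<le> max B 1" for x
    using B K(2)[of x] by (cases "f x = 0") (auto simp: le_max_iff_disj)
  then show ?thesis using that[of "max B 1"] by auto
qed

lemma compact_superlevel:
  fixes f :: "'a::topological_space \<Rightarrow> real"
  assumes "f \<in> C00_plus" "0 < \<epsilon>" shows "compact {x. \<epsilon> \<le> f x}"
proof -
  have "closed {x. \<epsilon> \<le> f x}"
    using C00_cont[OF assms(1)] by (intro closed_Collect_le continuous_intros)
  moreover have "{x. \<epsilon> \<le> f x} \<subseteq> closure {x. f x \<noteq> 0}"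
    using assms(2) by (intro order_trans[OF _ closure_subset]) auto
  ultimately show ?thesis using assms(1) unfolding C00_plus_def
    by (metis (no_types, lifting) closed_Int_compact inf.absorb1 mem_Collect_eq)
qed

lemma C00_bump:
  fixes x :: "'a::topological_space"
  assumes H: "Hausdorff_space (euclidean :: 'a topology)"
    and lc: "locally_compact_space (euclidean :: 'a topology)"
    and U: "open U" "x \<in> U"
  obtains g where "g \<in> C00_plus" "0 < g x" "\<And>y. g y \<le> 1" "\<And>y. g y \<noteq> 0 \<Longrightarrow> y \<in> U"
proof -
  have "\<exists>V K. open V \<and> compact K \<and> x \<in> V \<and> V \<subseteq> K"
    using lc unfolding locally_compact_space_def by auto
  then obtain V K where V: "open V" "compact K" "x \<in> V" "V \<subseteq> K" by blast
  have "completely_regular_space (euclidean :: 'a topology)"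
    using locally_compact_regular_imp_completely_regular_space lc H by blast
  then obtain f :: "'a \<Rightarrow> real" where f: "continuous_map euclidean (top_of_set {0..1}) f" "f x = 0"
      "f ` (- (U \<inter> V)) \<subseteq> {1}"
    unfolding completely_regular_space_def
    using U V by (metis ComplD DiffI IntI UNIV_I closed_Compl closed_closedin open_Int topspace_euclidean double_complement Diff_iff Compl_iff)
  have fc: "continuous_on UNIV f" and fr: "\<And>y. f y \<in> {0..1}"
    using f(1) by (auto simp: continuous_map_in_subtopology)
  have out: "y \<in> U \<inter> V" if "1 - f y \<noteq> 0" for y using f(3) that by auto
  show ?thesis
  proof (rule that[of "\<lambda>y. 1 - f y"])
    show "(\<lambda>y. 1 - f y) \<in> C00_plus"
      using out V fr fc by (intro C00_I[OF H _ _ V(2)] continuous_intros) auto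
  qed (use fr f out in auto)
qed

lemma continuous_positive_on_compact:
  fixes s :: "'a::topological_space \<Rightarrow> real"
  assumes "compact K" "continuous_on UNIV s" "\<And>x. x \<in> K \<Longrightarrow> 0 < s x"
  obtains c where "0 < c" "\<And>x. x \<in> K \<Longrightarrow> c \<le> s x"
proof (cases "K = {}")
  case True then show ?thesis using that[of 1] by simp
next
  case False
  then obtain x where "x \<in> K" "\<forall>y\<in>K. s x \<le> s y"
    using continuous_attains_inf[OF assms(1) False, of s] assms(2) continuous_on_subset by blast
  then show ?thesis using that[of "s x"] assms(3) by auto
qed

text \<open>
A partition of unity before normalisation. Bump functions around the points of \<open>K\<close> are grouped by the
member of the cover in which they are supported. The bound \<open>c\<close> allows division by
\<open>max (\<Sum>i\<in>A. h i x) c\<close>, which is continuous everywhere and agrees with the sum on \<open>K\<close>.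
\<close>

lemma C00_subordinate:
  fixes U :: "'i \<Rightarrow> 'a::topological_space set"
  assumes H: "Hausdorff_space (euclidean :: 'a topology)"
    and lc: "locally_compact_space (euclidean :: 'a topology)"
    and K: "compact K" and U: "\<And>i. i \<in> I \<Longrightarrow> open (U i)" and cover: "K \<subseteq> (\<Union>i\<in>I. U i)"
  obtains A h c where "finite A" "A \<subseteq> I" "\<And>i. i \<in> A \<Longrightarrow> h i \<in> C00_plus"
    "\<And>i x. i \<in> A \<Longrightarrow> h i x \<noteq> 0 \<Longrightarrow> x \<in> U i" "(0::real) < c" "\<And>x. x \<in> K \<Longrightarrow> c \<le> (\<Sum>i\<in>A. h i x)"
proof -
  obtain i where i: "\<And>x. x \<in> K \<Longrightarrow> i x \<in> I \<and> x \<in> U (i x)"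
    using cover by (metis UN_E subsetD)
  have "\<exists>g. g \<in> C00_plus \<and> 0 < g x \<and> (\<forall>y. g y \<noteq> 0 \<longrightarrow> y \<in> U (i x))" if "x \<in> K" for x
    using C00_bump[OF H lc U, of "i x" x] i[OF that] by metis
  then obtain g where g: "\<And>x. x \<in> K \<Longrightarrow> g x \<in> C00_plus \<and> 0 < g x x \<and> (\<forall>y. g x y \<noteq> 0 \<longrightarrow> y \<in> U (i x))"
    by metis
  note ig = i g
  have op: "open {y. 0 < g x y}" if "x \<in> K" for x
    using C00_cont g[OF that] by (intro open_Collect_less continuous_intros) auto
  have "K \<subseteq> (\<Union>x\<in>K. {y. 0 < g x y})" using g by blast
  from compactE_image[OF K op this] obtain X where
    X: "X \<subseteq> K" "finite X" "K \<subseteq> (\<Union>x\<in>X. {y. 0 < g x y})" .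
  define h where "h = (\<lambda>j y. \<Sum>x\<in>{x\<in>X. i x = j}. g x y)"
  have h: "h j \<in> C00_plus" for j
    unfolding h_def using ig X by (intro C00_sum) auto
  have hU: "y \<in> U j" if nz: "h j y \<noteq> 0" for j y
  proof -
    obtain x where "x \<in> X" "i x = j" "g x y \<noteq> 0"
      using nz unfolding h_def by (metis (mono_tags, lifting) mem_Collect_eq sum.neutral)
    then show ?thesis using ig X by blast
  qed
  have sum: "(\<Sum>j\<in>i ` X. h j y) = (\<Sum>x\<in>X. g x y)" for y
    unfolding h_def using X(2) by (intro sum.group) auto
  have pos: "0 < (\<Sum>j\<in>i ` X. h j y)" if yK: "y \<in> K" for y
  proof -
    obtain x where "x \<in> X" "0 < g x y" using X yK by blast
    moreover have "0 \<le> g z y" if "z \<in> X" for z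
      using C00_nonneg[of "g z"] g X(1) that by blast
    ultimately show ?thesis
      unfolding sum using X(2) by (intro sum_pos2[of X x]) auto
  qed
  have "continuous_on UNIV (\<lambda>y. \<Sum>j\<in>i ` X. h j y)" using h by (intro C00_cont C00_sum)
  from continuous_positive_on_compact[OF K this pos] obtain c where
    c: "0 < c" "\<And>y. y \<in> K \<Longrightarrow> c \<le> (\<Sum>j\<in>i ` X. h j y)" by blast
  have "i ` X \<subseteq> I" using X(1) i by blast
  then show ?thesis using X(2) h hU c by (intro that[of "i ` X" h c]) auto
qed

lemma C00_above_compact:
  assumes H: "Hausdorff_space (euclidean :: 'a::topological_space topology)"
    and lc: "locally_compact_space (euclidean :: 'a topology)" and K: "compact (K :: 'a set)"
  obtains g where "g \<in> C00_plus" "\<And>x. x \<in> K \<Longrightarrow> (1::real) \<le> g x"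
proof -
  obtain A h c where h: "finite A" "A \<subseteq> {()}" "\<And>i. i \<in> A \<Longrightarrow> h i \<in> C00_plus"
    "(0::real) < c" "\<And>x. x \<in> K \<Longrightarrow> c \<le> (\<Sum>i\<in>A. h i x)"
    by (rule C00_subordinate[OF H lc K, of "{()}" "\<lambda>_. UNIV"]) auto
  show ?thesis
  proof (rule that[of "\<lambda>x. 1 / c * (\<Sum>i\<in>A. h i x)"])
    show "(\<lambda>x. 1 / c * (\<Sum>i\<in>A. h i x)) \<in> C00_plus"
      using h by (intro C00_scale C00_sum) auto
    show "1 \<le> 1 / c * (\<Sum>i\<in>A. h i x)" if "x \<in> K" for x
      using h that by (simp add: field_simps)
  qed
qed

section \<open>The Radon measure of a positive functional\<close>

locale radon_functional =
  fixes J :: "('a::topological_space \<Rightarrow> real) \<Rightarrow> real"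
  assumes hausdorff: "Hausdorff_space (euclidean :: 'a topology)"
    and locally_compact: "locally_compact_space (euclidean :: 'a topology)"
    and J_nonneg: "\<And>f. f \<in> C00_plus \<Longrightarrow> 0 \<le> J f"
    and J_add: "\<And>f g. f \<in> C00_plus \<Longrightarrow> g \<in> C00_plus \<Longrightarrow> J (\<lambda>x. f x + g x) = J f + J g"
    and J_scale: "\<And>f k. f \<in> C00_plus \<Longrightarrow> 0 < k \<Longrightarrow> J (\<lambda>x. k * f x) = k * J f"
begin

lemma J_zero: "J (\<lambda>x. 0) = 0"
  using J_add[OF C00_zero C00_zero] by simp

lemma J_mono:
  assumes "f \<in> C00_plus" "g \<in> C00_plus" "\<And>x. f x \<le> g x" shows "J f \<le> J g"
proof -
  have d: "(\<lambda>x. g x - f x) \<in> C00_plus"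
  proof (rule C00_dominated[of g])
    show "g x - f x = 0" if "g x = 0" for x
      using that assms(3)[of x] C00_nonneg[OF assms(1), of x] by simp
  qed (use assms C00_cont in \<open>auto intro!: continuous_intros\<close>)
  have "J (\<lambda>x. f x + (g x - f x)) = J f + J (\<lambda>x. g x - f x)" by (rule J_add[OF assms(1) d])
  then show ?thesis using J_nonneg[OF d] by simp
qed

lemma J_sum: "(\<And>i. i \<in> A \<Longrightarrow> f i \<in> C00_plus) \<Longrightarrow> J (\<lambda>x. \<Sum>i\<in>A. f i x) = (\<Sum>i\<in>A. J (f i))"
  by (induction A rule: infinite_finite_induct) (auto simp: J_zero J_add C00_sum)

lemma C00_truncate: "f \<in> C00_plus \<Longrightarrow> 0 \<le> \<epsilon> \<Longrightarrow> (\<lambda>x. max (f x - \<epsilon>) 0) \<in> C00_plus"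
  by (rule C00_dominated[of f]) (auto intro!: continuous_intros simp: C00_plus_def)

text \<open>
Continuity of \<open>J\<close> along the truncations of \<open>f\<close>. From
\<open>f \<le> max (f - r\<^sup>2) 0 + r sqrt f\<close> the error is at most \<open>r J (sqrt f)\<close>; the function
\<open>sqrt f\<close> belongs to \<open>C00_plus\<close> because it has the support of \<open>f\<close>.
\<close>

lemma J_truncate:
  assumes f: "f \<in> C00_plus" and le: "\<And>\<epsilon>. 0 < \<epsilon> \<Longrightarrow> ennreal (J (\<lambda>x. max (f x - \<epsilon>) 0)) \<le> S"
  shows "ennreal (J f) \<le> S"
proof (rule ennreal_le_epsilon)
  fix \<eta> :: real assume eta: "0 < \<eta>"
  have sq: "(\<lambda>x. sqrt (f x)) \<in> C00_plus"
    using C00_cont[OF f] C00_nonneg[OF f] by (intro C00_dominated[OF f] continuous_intros) auto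
  define r where "r = \<eta> / (J (\<lambda>x. sqrt (f x)) + 1)"
  have r: "0 < r" "r * J (\<lambda>x. sqrt (f x)) \<le> \<eta>"
    using eta J_nonneg[OF sq] by (auto simp: r_def field_simps)
  have t: "(\<lambda>x. max (f x - r\<^sup>2) 0) \<in> C00_plus" by (rule C00_truncate[OF f]) simp
  have s: "(\<lambda>x. r * sqrt (f x)) \<in> C00_plus" using C00_scale[OF sq] r by simp
  have "f x \<le> max (f x - r\<^sup>2) 0 + r * sqrt (f x)" for x
  proof (cases "f x \<le> r\<^sup>2")
    case True
    then have "sqrt (f x) \<le> r" using r by (simp add: real_le_lsqrt C00_nonneg[OF f])
    then have "sqrt (f x) * sqrt (f x) \<le> r * sqrt (f x)"
      by (intro mult_right_mono) (auto simp: C00_nonneg[OF f])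
    then show ?thesis using C00_nonneg[OF f, of x] by simp
  next
    case False
    then have "r * r \<le> r * sqrt (f x)"
      using r by (intro mult_left_mono real_le_rsqrt) (auto simp: power2_eq_square)
    then show ?thesis by (simp add: power2_eq_square)
  qed
  then have "J f \<le> J (\<lambda>x. max (f x - r\<^sup>2) 0 + r * sqrt (f x))"
    by (intro J_mono f C00_add t s)
  also have "\<dots> \<le> J (\<lambda>x. max (f x - r\<^sup>2) 0) + \<eta>"
    using r J_add[OF t s] J_scale[OF sq r(1)] by simp
  finally have "ennreal (J f) \<le> ennreal (J (\<lambda>x. max (f x - r\<^sup>2) 0)) + ennreal \<eta>"
    using J_nonneg[OF t] eta by (simp flip: ennreal_plus)
  also have "\<dots> \<le> S + ennreal \<eta>" using le[of "r\<^sup>2"] r by (intro add_mono) auto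
  finally show "ennreal (J f) \<le> S + ennreal \<eta>" .
qed

text \<open>
Functions whose support stays inside a compact subset of \<open>U\<close>. By truncation, the supremum of \<open>J\<close>
over them is the same as over all functions of \<open>C00_plus\<close> below the indicator of \<open>U\<close>. Both
descriptions are used: the first for compactness arguments, the second because level sets
\<open>{x. t < f x}\<close> fit it exactly.
\<close>

definition inner :: "'a set \<Rightarrow> ('a \<Rightarrow> real) set" where
  "inner U = {f \<in> C00_plus. (\<forall>x. f x \<le> 1) \<and> (\<exists>K. compact K \<and> K \<subseteq> U \<and> (\<forall>x. f x \<noteq> 0 \<longrightarrow> x \<in> K))}"

definition open_content :: "'a set \<Rightarrow> ennreal" where
  "open_content U = (SUP f\<in>inner U. ennreal (J f))"

definition outer :: "'a set \<Rightarrow> ennreal" where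
  "outer A = (INF U\<in>{U. open U \<and> A \<subseteq> U}. open_content U)"

lemma inner_zero: "(\<lambda>x. 0) \<in> inner U"
  by (auto simp: inner_def C00_zero intro!: exI[of _ "{}"])

lemma inner_mono: "U \<subseteq> V \<Longrightarrow> inner U \<subseteq> inner V"
  unfolding inner_def by blast

lemma open_content_mono: "U \<subseteq> V \<Longrightarrow> open_content U \<le> open_content V"
  unfolding open_content_def by (intro SUP_subset_mono inner_mono) auto

lemma truncate_inner:
  assumes f: "f \<in> C00_plus" and le: "\<And>x. f x \<le> indicator U x" and e: "0 < \<epsilon>"
  shows "(\<lambda>x. max (f x - \<epsilon>) 0) \<in> inner U"
  unfolding inner_def
proof (intro CollectI conjI exI[of _ "{x. \<epsilon> \<le> f x}"])
  show "\<forall>x. max (f x - \<epsilon>) 0 \<le> 1"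
  proof
    fix x have "f x \<le> 1" by (rule order_trans[OF le indicator_le_1])
    then show "max (f x - \<epsilon>) 0 \<le> 1" using e by simp
  qed
  show "{x. \<epsilon> \<le> f x} \<subseteq> U"
  proof
    fix x assume "x \<in> {x. \<epsilon> \<le> f x}"
    then show "x \<in> U" using le[of x] e by (cases "x \<in> U") auto
  qed
  show "(\<lambda>x. max (f x - \<epsilon>) 0) \<in> C00_plus" using e by (intro C00_truncate f) simp
qed (use compact_superlevel[OF f e] in auto)

lemma J_le_open_content:
  assumes f: "f \<in> C00_plus" and le: "\<And>x. f x \<le> indicator U x"
  shows "ennreal (J f) \<le> open_content U"
proof (rule J_truncate[OF f])
  fix \<epsilon> :: real assume "0 < \<epsilon>"
  then have "(\<lambda>x. max (f x - \<epsilon>) 0) \<in> inner U" by (rule truncate_inner[OF f le])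
  then show "ennreal (J (\<lambda>x. max (f x - \<epsilon>) 0)) \<le> open_content U"
    unfolding open_content_def by (rule SUP_upper)
qed

lemma inner_le_indicator:
  assumes "f \<in> inner U" shows "f x \<le> indicator U x"
proof (cases "x \<in> U")
  case True then show ?thesis using assms by (auto simp: inner_def)
next
  case False then have "f x = 0" using assms by (auto simp: inner_def)
  then show ?thesis by simp
qed

lemma open_content_le:
  assumes "\<And>f. f \<in> C00_plus \<Longrightarrow> (\<And>x. f x \<le> indicator U x) \<Longrightarrow> ennreal (J f) \<le> S"
  shows "open_content U \<le> S"
  unfolding open_content_def
proof (rule SUP_least)
  fix f assume f: "f \<in> inner U"
  show "ennreal (J f) \<le> S"
    by (rule assms) (use f inner_le_indicator in \<open>auto simp: inner_def\<close>)
qed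

lemma open_content_UN:
  assumes U: "\<And>i::nat. open (U i)"
  shows "open_content (\<Union>i. U i) \<le> (\<Sum>i. open_content (U i))"
  unfolding open_content_def[of "\<Union>i. U i"]
proof (rule SUP_least)
  fix f assume "f \<in> inner (\<Union>i. U i)"
  then obtain K where f: "f \<in> C00_plus" "\<And>x. f x \<le> 1"
    and K: "compact K" "K \<subseteq> (\<Union>i\<in>UNIV. U i)" "\<And>x. f x \<noteq> 0 \<Longrightarrow> x \<in> K"
    by (auto simp: inner_def)
  obtain A h c where A: "finite A" "\<And>i. i \<in> A \<Longrightarrow> h i \<in> C00_plus"
    "\<And>i x. i \<in> A \<Longrightarrow> h i x \<noteq> 0 \<Longrightarrow> x \<in> U i"
    and c: "(0::real) < c" "\<And>x. x \<in> K \<Longrightarrow> c \<le> (\<Sum>i\<in>A. h i x)"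
    by (rule C00_subordinate[OF hausdorff locally_compact K(1) U K(2)]) blast
  define s where "s = (\<lambda>x. \<Sum>i\<in>A. h i x)"
  have hs: "h i x \<le> s x" if "i \<in> A" for i x
    unfolding s_def using A(1) that C00_nonneg[OF A(2)] by (intro member_le_sum) auto
  have sc: "continuous_on UNIV s" using C00_cont C00_sum A unfolding s_def by blast
  define q where "q = (\<lambda>i x. f x * (h i x / max (s x) c))"
  have q1: "h i x / max (s x) c \<le> 1" "0 \<le> h i x / max (s x) c" if "i \<in> A" for i x
    using hs[OF that, of x] c(1) C00_nonneg[OF A(2)[OF that], of x] by (auto simp: field_simps max_def)
  have qC: "q i \<in> C00_plus" if "i \<in> A" for i
    unfolding q_def
  proof (rule C00_dominated[OF f(1)])
    show "continuous_on UNIV (\<lambda>x. f x * (h i x / max (s x) c))"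
      using C00_cont[OF f(1)] C00_cont[OF A(2)[OF that]] sc c(1)
      by (intro continuous_intros) (auto simp: max_def)
  qed (use q1[OF that] C00_nonneg[OF f(1)] in \<open>auto simp del: times_divide_eq_right\<close>)
  have qU: "q i x \<le> indicator (U i) x" if "i \<in> A" for i x
  proof (cases "x \<in> U i")
    case True
    then show ?thesis
      using mult_mono[OF f(2)[of x] q1(1)[OF that, of x]] q1(2)[OF that, of x] by (simp add: q_def)
  next
    case False
    then have "h i x = 0" using A(3) that by blast
    then show ?thesis by (simp add: q_def)
  qed
  have "f x = (\<Sum>i\<in>A. q i x)" for x
  proof (cases "f x = 0")
    case False
    then have "c \<le> s x" using c(2) K(3) unfolding s_def by blast
    then have "(\<Sum>i\<in>A. h i x / max (s x) c) = 1"
      using c(1) by (simp add: max_def s_def flip: sum_divide_distrib)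
    then show ?thesis unfolding q_def sum_distrib_left[symmetric] by simp
  qed (simp add: q_def)
  then have "J f = (\<Sum>i\<in>A. J (q i))"
    using J_sum[of A q] qC by (metis (no_types, lifting) ext)
  then have "ennreal (J f) = (\<Sum>i\<in>A. ennreal (J (q i)))"
    using J_nonneg qC by (simp add: sum_ennreal)
  also have "\<dots> \<le> (\<Sum>i\<in>A. open_content (U i))"
    using J_le_open_content qC qU by (intro sum_mono) auto
  also have "\<dots> \<le> (\<Sum>i. open_content (U i))"
    using A(1) by (intro sum_le_suminf) auto
  finally show "ennreal (J f) \<le> (\<Sum>i. open_content (U i))" .
qed

lemma outer_open: "open U \<Longrightarrow> outer U = open_content U"
  unfolding outer_def by (intro antisym INF_lower INF_greatest open_content_mono) auto

lemma outer_mono: "A \<subseteq> B \<Longrightarrow> outer A \<le> outer B"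
  unfolding outer_def by (intro INF_superset_mono) auto

lemma outer_empty: "outer {} = 0"
proof -
  have "open_content {} \<le> 0"
  proof (rule open_content_le)
    fix f :: "'a \<Rightarrow> real" assume "f \<in> C00_plus" "\<And>x. f x \<le> indicator {} x"
    then have "f = (\<lambda>x. 0)" using C00_nonneg by (intro ext antisym) auto
    then show "ennreal (J f) \<le> 0" by (simp add: J_zero)
  qed
  then show ?thesis by (simp add: outer_open)
qed

lemma outer_measure_space_outer: "outer_measure_space UNIV outer"
  unfolding outer_measure_space_def
proof (intro conjI)
  show "positive UNIV outer" by (simp add: positive_def outer_empty)
  show "increasing UNIV outer" by (simp add: increasing_def outer_mono)
  show "countably_subadditive UNIV outer"
    unfolding countably_subadditive_def
  proof (intro allI impI)
    fix A :: "nat \<Rightarrow> 'a set"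
    show "outer (\<Union>i. A i) \<le> (\<Sum>i. outer (A i))"
    proof (rule ennreal_le_epsilon)
      fix e :: real assume "0 < e" "(\<Sum>n. outer (A n)) < Orderings.top"
      then have "outer (A n) < outer (A n) + e * (1/2)^Suc n" for n
        by (auto simp add: less_top dest!: ennreal_suminf_lessD)
      then have "\<exists>U. open U \<and> A n \<subseteq> U \<and> open_content U < outer (A n) + e * (1/2)^Suc n" for n
        unfolding outer_def INF_less_iff by blast
      then obtain U where U: "\<And>n. open (U n)" "\<And>n. A n \<subseteq> U n"
        "\<And>n. open_content (U n) < outer (A n) + e * (1/2)^Suc n" by metis
      have "outer (\<Union>i. A i) \<le> open_content (\<Union>i. U i)"
        using U unfolding outer_def by (intro INF_lower) auto
      also have "\<dots> \<le> (\<Sum>n. open_content (U n))" by (rule open_content_UN[OF U(1)])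
      also have "\<dots> \<le> (\<Sum>n. outer (A n) + e * (1/2) ^ Suc n)"
        using U(3) by (intro suminf_le less_imp_le) auto
      also have "... = (\<Sum>n. outer (A n)) + (\<Sum>n. ennreal e * ennreal ((1/2) ^ Suc n))"
        using \<open>0 < e\<close> by (subst suminf_add[symmetric])
                         (auto simp del: ennreal_suminf_cmult simp add: ennreal_mult[symmetric])
      also have "\<dots> = (\<Sum>n. outer (A n)) + e"
        unfolding ennreal_suminf_cmult
        by (subst suminf_ennreal_eq[OF zero_le_power power_half_series]) auto
      finally show "outer (\<Union>i. A i) \<le> (\<Sum>n. outer (A n)) + e" .
    qed
  qed
qed

text \<open>
Caratheodory's condition for open sets. If \<open>f\<close> is supported in a compact \<open>K \<subseteq> V \<inter> U\<close> and
\<open>g\<close> in \<open>V - K\<close>, which is open and contains \<open>V - U\<close>, then \<open>f + g\<close> is still below the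
indicator of \<open>V\<close>.
\<close>

lemma outer_split:
  assumes U: "open U" shows "outer (A \<inter> U) + outer (A - U) \<le> outer A"
proof -
  have "outer (A \<inter> U) + outer (A - U) \<le> open_content V" if V: "open V" "A \<subseteq> V" for V
  proof -
    have "outer (A \<inter> U) + outer (A - U) \<le> open_content (V \<inter> U) + outer (V - U)"
      unfolding outer_open[OF open_Int[OF V(1) U], symmetric]
      using V by (intro add_mono outer_mono) auto
    also have "\<dots> = (SUP f\<in>inner (V \<inter> U). ennreal (J f) + outer (V - U))"
      unfolding open_content_def using inner_zero by (intro ennreal_SUP_add_left[symmetric]) auto
    also have "\<dots> \<le> open_content V"
    proof (rule SUP_least)
      fix f assume "f \<in> inner (V \<inter> U)"
      then obtain K where f: "f \<in> C00_plus" "\<And>x. f x \<le> 1"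
        and K: "compact K" "K \<subseteq> V \<inter> U" "\<And>x. f x \<noteq> 0 \<Longrightarrow> x \<in> K"
        by (auto simp: inner_def)
      have "open (V - K)" using V hausdorff_compact_closed[OF hausdorff K(1)] by blast
      then have "ennreal (J f) + outer (V - U) \<le> ennreal (J f) + open_content (V - K)"
        using K by (intro add_mono) (auto simp: outer_def intro!: INF_lower)
      also have "\<dots> = (SUP g\<in>inner (V - K). ennreal (J f) + ennreal (J g))"
        unfolding open_content_def using inner_zero by (intro ennreal_SUP_add_right) auto
      also have "\<dots> \<le> open_content V"
      proof (rule SUP_least)
        fix g assume g: "g \<in> inner (V - K)"
        then have gC: "g \<in> C00_plus" by (simp add: inner_def)
        have "f x + g x \<le> indicator V x" for x
        proof (cases "x \<in> K")
          case True
          then have "g x = 0" using g by (auto simp: inner_def)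
          then show ?thesis using True K f by auto
        next
          case False
          then have "f x = 0" using K by blast
          then show ?thesis using inner_le_indicator[OF g, of x] False
            by (cases "x \<in> V") auto
        qed
        then have "ennreal (J (\<lambda>x. f x + g x)) \<le> open_content V"
          by (intro J_le_open_content C00_add f gC)
        then show "ennreal (J f) + ennreal (J g) \<le> open_content V"
          using J_add[OF f(1) gC] J_nonneg[OF f(1)] J_nonneg[OF gC] by simp
      qed
      finally show "ennreal (J f) + outer (V - U) \<le> open_content V" .
    qed
    finally show ?thesis .
  qed
  then show ?thesis unfolding outer_def[of A] by (intro INF_greatest) auto
qed

definition radon :: "'a measure" where
  "radon = measure_of UNIV (sets borel) outer"

lemma sets_radon: "sets radon = sets borel"
  unfolding radon_def by (simp add: sets.sigma_sets_eq[of borel, simplified])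

lemma borel_lambda_system: "sets borel \<subseteq> lambda_system UNIV UNIV outer"
  and measure_space_lambda_system: "measure_space UNIV (lambda_system UNIV UNIV outer) outer"
proof -
  have P: "sigma_algebra UNIV (UNIV :: 'a set set)" using sigma_algebra_Pow[of UNIV] by simp
  show ms: "measure_space UNIV (lambda_system UNIV UNIV outer) outer"
    using sigma_algebra.caratheodory_lemma[OF P outer_measure_space_outer] .
  have "U \<in> lambda_system UNIV UNIV outer" if "open U" for U
    unfolding lambda_system_def
  proof (intro CollectI conjI ballI UNIV_I antisym)
    fix A :: "'a set"
    show "outer (U \<inter> A) + outer ((UNIV - U) \<inter> A) \<le> outer A"
      using outer_split[OF that, of A] by (simp add: Int_commute Diff_eq)
    have "subadditive UNIV outer"
      using outer_measure_space_outer sigma_algebra.axioms(1)[OF P]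
      by (metis algebra.axioms(1) outer_measure_space_def ring_of_sets.countably_subadditive_subadditive)
    then have "outer ((U \<inter> A) \<union> ((UNIV - U) \<inter> A)) \<le> outer (U \<inter> A) + outer ((UNIV - U) \<inter> A)"
      by (intro subadditiveD) auto
    moreover have "(U \<inter> A) \<union> ((UNIV - U) \<inter> A) = A" by blast
    ultimately show "outer A \<le> outer (U \<inter> A) + outer ((UNIV - U) \<inter> A)" by simp
  qed
  then show "sets borel \<subseteq> lambda_system UNIV UNIV outer"
    using ms unfolding sets_borel measure_space_def
    by (intro sigma_algebra.sigma_sets_subset) auto
qed

lemma emeasure_radon: "B \<in> sets borel \<Longrightarrow> emeasure radon B = outer B"
  unfolding radon_def
proof (rule emeasure_measure_of_sigma)
  show "sigma_algebra UNIV (sets (borel :: 'a measure))"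
    using sets.sigma_algebra_axioms[of "borel :: 'a measure"] by simp
  show "positive (sets borel) outer" by (simp add: positive_def outer_empty)
  show "countably_additive (sets borel) outer"
    using measure_space_lambda_system borel_lambda_system
    unfolding measure_space_def countably_additive_def by (meson order_trans subsetD)
qed

lemma emeasure_radon_open: "open U \<Longrightarrow> emeasure radon U = open_content U"
  by (simp add: emeasure_radon outer_open)

lemma compact_borel: "compact (K :: 'a set) \<Longrightarrow> K \<in> sets borel"
  using hausdorff_compact_closed[OF hausdorff] by (simp add: borel_closed)

lemma radon_compact_finite:
  assumes K: "compact K" shows "emeasure radon K < \<infinity>"
proof -
  obtain g where g: "g \<in> C00_plus" "\<And>x. x \<in> K \<Longrightarrow> 1 \<le> g x"
    using C00_above_compact[OF hausdorff locally_compact K] by blast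
  have op: "open {x. 1 / 2 < g x}"
    using C00_cont[OF g(1)] by (intro open_Collect_less continuous_intros)
  have "open_content {x. 1 / 2 < g x} \<le> ennreal (2 * J g)"
  proof (rule open_content_le)
    fix f assume f: "f \<in> C00_plus" "\<And>x. f x \<le> indicator {x. 1 / 2 < g x} x"
    have "f x \<le> 2 * g x" for x
      using f(2)[of x] C00_nonneg[OF g(1), of x] by (cases "1 / 2 < g x") auto
    then have "J f \<le> 2 * J g"
      using J_mono[OF f(1) C00_scale[OF g(1)], of 2] J_scale[OF g(1)] by simp
    then show "ennreal (J f) \<le> ennreal (2 * J g)" by (rule ennreal_leI)
  qed
  moreover have "outer K \<le> open_content {x. 1 / 2 < g x}"
    using op g unfolding outer_def by (intro INF_lower) force
  ultimately show ?thesis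
    using emeasure_radon[OF compact_borel[OF K]] by (metis order_trans ennreal_less_top infinity_ennreal_def order_le_less_trans)
qed

lemma radon_inner_regular:
  assumes U: "open U" shows "emeasure radon U = (SUP X\<in>{X. compact X \<and> X \<subseteq> U}. emeasure radon X)"
proof (rule antisym)
  show "(SUP X\<in>{X. compact X \<and> X \<subseteq> U}. emeasure radon X) \<le> emeasure radon U"
    using U by (intro SUP_least emeasure_mono) (auto simp: sets_radon)
  have "ennreal (J f) \<le> (SUP X\<in>{X. compact X \<and> X \<subseteq> U}. emeasure radon X)" if fU: "f \<in> inner U" for f
  proof -
    obtain K where f: "f \<in> C00_plus" "\<And>x. f x \<le> 1"
      and K: "compact K" "K \<subseteq> U" "\<And>x. f x \<noteq> 0 \<Longrightarrow> x \<in> K"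
      using fU by (auto simp: inner_def)
    have "ennreal (J f) \<le> outer K"
      unfolding outer_def
    proof (rule INF_greatest, rule J_le_open_content[OF f(1)])
      fix V x assume "V \<in> {V. open V \<and> K \<subseteq> V}"
      then show "f x \<le> indicator V x" using f K(3)[of x] by (cases "f x = 0") auto
    qed
    also have "outer K = emeasure radon K" using emeasure_radon[OF compact_borel[OF K(1)]] ..
    also have "\<dots> \<le> (SUP X\<in>{X. compact X \<and> X \<subseteq> U}. emeasure radon X)"
      using K by (intro SUP_upper) auto
    finally show ?thesis .
  qed
  then show "emeasure radon U \<le> (SUP X\<in>{X. compact X \<and> X \<subseteq> U}. emeasure radon X)"
    unfolding emeasure_radon_open[OF U] open_content_def by (intro SUP_least)
qed

lemma regular_radon: "regular_borel_measure radon"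
  unfolding regular_borel_measure_def
proof (intro conjI allI impI ballI)
  fix A :: "'a set" assume "A \<in> sets borel"
  then show "emeasure radon A = (INF V\<in>{V. open V \<and> A \<subseteq> V}. emeasure radon V)"
    using emeasure_radon_open by (simp add: emeasure_radon outer_def cong: INF_cong_simp)
qed (use sets_radon radon_inner_regular in auto)

lemma radon_positive:
  assumes pos: "\<And>f x. f \<in> C00_plus \<Longrightarrow> f x \<noteq> 0 \<Longrightarrow> 0 < J f" and U: "open U" "U \<noteq> {}"
  shows "0 < emeasure radon U"
proof -
  obtain x where x: "x \<in> U" using U by blast
  obtain g where g: "g \<in> C00_plus" "0 < g x" "\<And>y. g y \<le> 1" "\<And>y. g y \<noteq> 0 \<Longrightarrow> y \<in> U"
    using C00_bump[OF hausdorff locally_compact U(1) x] by blast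
  have "0 < J g" using pos[OF g(1), of x] g(2) by simp
  then have "0 < ennreal (J g)" by simp
  also have "\<dots> \<le> open_content U"
  proof (rule J_le_open_content[OF g(1)])
    show "g y \<le> indicator U y" for y using g(3,4)[of y] by (cases "g y = 0") auto
  qed
  finally show ?thesis by (simp add: emeasure_radon_open U)
qed

lemma radon_homeomorphism:
  assumes ST: "\<And>x. S (T x) = x" "\<And>x. T (S x) = x"
    and cont: "continuous_on UNIV S" "continuous_on UNIV T"
    and inv: "\<And>f. f \<in> C00_plus \<Longrightarrow> J (\<lambda>x. f (T x)) = J f"
    and B: "B \<in> sets borel"
  shows "emeasure radon (T ` B) = emeasure radon B"
proof -
  have img: "T ` A = S -` A" "S ` A = T -` A" for A
    using ST by (auto simp: image_iff) metis+
  have C00: "(\<lambda>x. f (T x)) \<in> C00_plus" "(\<lambda>x. f (S x)) \<in> C00_plus" if fC: "f \<in> C00_plus" for f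
  proof -
    obtain K where K: "compact K" "\<And>x. f x \<noteq> 0 \<Longrightarrow> x \<in> K" using C00_support[OF fC] by blast
    have f: "continuous_on UNIV f" "\<And>x. 0 \<le> f x" using C00_cont C00_nonneg fC by blast+
    have "compact (S ` K)" "compact (T ` K)"
      using K cont by (auto intro!: compact_continuous_image intro: continuous_on_subset)
    moreover have "continuous_on UNIV (\<lambda>x. f (T x))" "continuous_on UNIV (\<lambda>x. f (S x))"
      using continuous_on_compose2[OF f(1)] cont by auto
    ultimately show "(\<lambda>x. f (T x)) \<in> C00_plus" "(\<lambda>x. f (S x)) \<in> C00_plus"
      using f K by (auto intro: C00_I[OF hausdorff, where K = "S ` K"]
        C00_I[OF hausdorff, where K = "T ` K"] simp: img)
  qed
  have opn: "open (T ` U)" "open (S ` U)" if "open U" for U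
    using open_vimage[OF that] cont by (auto simp: img)
  have oc: "open_content (T ` U) = open_content U" for U
  proof (rule antisym)
    show "open_content (T ` U) \<le> open_content U"
    proof (rule open_content_le)
      fix f :: "'a \<Rightarrow> real" assume f: "f \<in> C00_plus" "\<And>x. f x \<le> indicator (T ` U) x"
      have "f (T x) \<le> indicator U x" for x using f(2)[of "T x"] ST by (simp add: indicator_def img)
      then show "ennreal (J f) \<le> open_content U"
        using J_le_open_content[OF C00(1)[OF f(1)]] inv[OF f(1)] by simp
    qed
    show "open_content U \<le> open_content (T ` U)"
    proof (rule open_content_le)
      fix f :: "'a \<Rightarrow> real" assume f: "f \<in> C00_plus" "\<And>x. f x \<le> indicator U x"
      have "f (S x) \<le> indicator (T ` U) x" for x using f(2)[of "S x"] by (simp add: indicator_def img)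
      then show "ennreal (J f) \<le> open_content (T ` U)"
        using J_le_open_content[OF C00(2)[OF f(1)]] inv[OF C00(2)[OF f(1)]] by (simp add: ST)
    qed
  qed
  have "outer (T ` B) = outer B"
  proof (rule antisym)
    show "outer (T ` B) \<le> outer B"
      unfolding outer_def[of B]
    proof (rule INF_greatest)
      fix V assume "V \<in> {V. open V \<and> B \<subseteq> V}"
      then have "outer (T ` B) \<le> open_content (T ` V)"
        unfolding outer_def using opn by (intro INF_lower) auto
      then show "outer (T ` B) \<le> open_content V" by (simp add: oc)
    qed
    show "outer B \<le> outer (T ` B)"
      unfolding outer_def[of "T ` B"]
    proof (rule INF_greatest)
      fix V assume "V \<in> {V. open V \<and> T ` B \<subseteq> V}"
      then have "T ` B \<subseteq> V" "open (S ` V)" using opn by auto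
      then have "open (S ` V)" "B \<subseteq> S ` V" unfolding img(2) by blast+
      then have "outer B \<le> open_content (S ` V)"
        unfolding outer_def by (intro INF_lower) auto
      also have "\<dots> = open_content V" using oc[of "S ` V"] ST by (simp add: image_image)
      finally show "outer B \<le> open_content V" .
    qed
  qed
  moreover have "T ` B \<in> sets borel"
    using measurable_sets_borel[OF borel_measurable_continuous_onI[OF cont(1)] B] by (simp add: img)
  ultimately show ?thesis using B by (simp add: emeasure_radon)
qed


text \<open>
Cut \<open>f\<close> into horizontal layers \<open>g k\<close> of height \<open>d\<close>. Each layer lies between \<open>d\<close> times
the indicators of two consecutive level sets, so its integral and its \<open>J\<close>-value both lie between \<open>d\<close>
times the measures of these sets. The differences telescope, and the total error is at most \<open>d\<close> times the measure of
\<open>{x. 0 < f x}\<close>.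
\<close>

lemma radon_integral:
  assumes f: "f \<in> C00_plus" shows "has_bochner_integral radon f (J f)"
proof -
  define lev where "lev = (\<lambda>t::real. {x. t < f x})"
  have open_lev: "open (lev t)" for t
    unfolding lev_def using C00_cont[OF f] by (intro open_Collect_less continuous_intros)
  have lev_sets [measurable]: "lev t \<in> sets radon" for t using open_lev by (simp add: sets_radon)
  obtain K where K: "compact K" "\<And>x. f x \<noteq> 0 \<Longrightarrow> x \<in> K" using C00_support[OF f] by blast
  have lev_K: "lev t \<subseteq> K" if "0 \<le> t" for t using that K(2) by (force simp: lev_def)
  have lev_fin: "emeasure radon (lev t) < \<infinity>" if t: "0 \<le> t" for t
    using emeasure_mono[OF lev_K[OF t], of radon] radon_compact_finite[OF K(1)] compact_borel[OF K(1)]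
    by (auto simp: sets_radon intro: order_le_less_trans)
  define \<nu> where "\<nu> = (\<lambda>t. measure radon (lev t))"
  have \<nu>: "ennreal (\<nu> t) = open_content (lev t)" if t: "0 \<le> t" for t
    using lev_fin[OF t] emeasure_radon_open[OF open_lev, of t]
    by (metis \<nu>_def emeasure_eq_ennreal_measure infinity_ennreal_def less_irrefl)
  obtain B where B: "0 < B" "\<And>x. f x \<le> B" using C00_bounded[OF f] by blast
  have meas: "g \<in> borel_measurable radon" if "continuous_on UNIV g" for g :: "'a \<Rightarrow> real"
    using borel_measurable_continuous_onI[OF that] measurable_cong_sets[OF sets_radon refl] by blast
  have close: "\<bar>integral\<^sup>L radon f - J f\<bar> \<le> d * \<nu> 0 \<and> integrable radon f" if d: "0 < d" for d
  proof -
    define g where "g = (\<lambda>k x. min (max (f x - real k * d) 0) d)"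
    have gC: "g k \<in> C00_plus" for k
    proof (rule C00_dominated[OF f])
      show "continuous_on UNIV (g k)"
        unfolding g_def using C00_cont[OF f] by (intro continuous_intros)
      show "0 \<le> g k x" for x using d by (simp add: g_def)
      show "g k x = 0" if "f x = 0" for x using d that by (simp add: g_def)
    qed
    have kd: "0 \<le> real k * d" for k using d by simp
    have g_up: "g k x \<le> d * indicator (lev (real k * d)) x" for k x
      using d by (auto simp: g_def lev_def indicator_def)
    have g_low: "d * indicator (lev (real (Suc k) * d)) x \<le> g k x" for k x
      using d by (auto simp: g_def lev_def indicator_def algebra_simps)
    have J_sc: "J (\<lambda>x. 1 / d * g k x) = 1 / d * J (g k)" for k
      using d by (intro J_scale gC) simp
    have J_up: "J (g k) \<le> d * \<nu> (real k * d)" for k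
    proof -
      have "ennreal (J (\<lambda>x. 1 / d * g k x)) \<le> open_content (lev (real k * d))"
        using d g_up by (intro J_le_open_content C00_scale gC) (auto simp: field_simps)
      then have "ennreal (1 / d * J (g k)) \<le> ennreal (\<nu> (real k * d))"
        by (simp only: J_sc \<nu>[OF kd])
      then have "1 / d * J (g k) \<le> \<nu> (real k * d)" by (simp add: \<nu>_def)
      then show ?thesis using d by (simp add: field_simps)
    qed
    have J_low: "d * \<nu> (real (Suc k) * d) \<le> J (g k)" for k
    proof -
      have "open_content (lev (real (Suc k) * d)) \<le> ennreal (1 / d * J (g k))"
      proof (rule open_content_le)
        fix h :: "'a \<Rightarrow> real"
        assume h: "h \<in> C00_plus" "\<And>x. h x \<le> indicator (lev (real (Suc k) * d)) x"
        have "h x \<le> 1 / d * g k x" for x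
          using order_trans[OF mult_left_mono[OF h(2)[of x], of d] g_low[where k = k and x = x]] d
          by (simp add: field_simps)
        then have "J h \<le> J (\<lambda>x. 1 / d * g k x)"
          using d by (intro J_mono h C00_scale gC) auto
        then show "ennreal (J h) \<le> ennreal (1 / d * J (g k))"
          by (simp only: J_sc ennreal_leI)
      qed
      then have "ennreal (\<nu> (real (Suc k) * d)) \<le> ennreal (1 / d * J (g k))"
        by (simp only: \<nu>[OF kd])
      then have "\<nu> (real (Suc k) * d) \<le> 1 / d * J (g k)"
        using d J_nonneg[OF gC, of k] by (simp del: of_nat_Suc)
      then show ?thesis using d by (simp add: field_simps del: of_nat_Suc)
    qed
    have int_ind: "integrable radon (\<lambda>x. d * indicator (lev t) x)"
      "integral\<^sup>L radon (\<lambda>x. d * indicator (lev t) x) = d * \<nu> t" if t: "0 \<le> t" for t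
      using lev_fin[OF t] by (auto simp: \<nu>_def)
    have g_int: "integrable radon (g k)" for k
    proof (rule Bochner_Integration.integrable_bound[OF int_ind(1)[OF kd[of k]]])
      show "g k \<in> borel_measurable radon" by (rule meas[OF C00_cont[OF gC]])
      show "AE x in radon. norm (g k x) \<le> norm (d * indicator (lev (real k * d)) x)"
        using g_up d C00_nonneg[OF gC] by (intro AE_I2) (metis abs_of_nonneg order_trans real_norm_def)
    qed
    have I_up: "integral\<^sup>L radon (g k) \<le> d * \<nu> (real k * d)" for k
      using integral_mono[OF g_int int_ind(1)[OF kd] g_up] unfolding int_ind(2)[OF kd] .
    have I_low: "d * \<nu> (real (Suc k) * d) \<le> integral\<^sup>L radon (g k)" for k
      using integral_mono[OF int_ind(1)[OF kd] g_int g_low] unfolding int_ind(2)[OF kd] .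
    obtain m :: nat where m: "B \<le> real m * d"
      using reals_Archimedean3[OF d] by (meson less_imp_le)
    have part: "(\<Sum>k<n. g k x) = min (f x) (real n * d)" for n x
    proof (induction n)
      case 0 then show ?case using C00_nonneg[OF f, of x] by simp
    next
      case (Suc n) then show ?case using d by (auto simp: g_def algebra_simps)
    qed
    have f_sum: "f = (\<lambda>x. \<Sum>k<m. g k x)"
      using B(2) m by (auto simp: part fun_eq_iff min_def intro: order_trans)
    have Jf: "J f = (\<Sum>k<m. J (g k))" using J_sum[of "{..<m}" g] gC f_sum by simp
    have If: "integral\<^sup>L radon f = (\<Sum>k<m. integral\<^sup>L radon (g k))"
      unfolding f_sum using g_int by (intro Bochner_Integration.integral_sum)
    have f_int: "integrable radon f"
      unfolding f_sum using g_int by (intro Bochner_Integration.integrable_sum)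
    have "\<bar>integral\<^sup>L radon f - J f\<bar> \<le> (\<Sum>k<m. \<bar>integral\<^sup>L radon (g k) - J (g k)\<bar>)"
      unfolding Jf If sum_subtractf[symmetric] by (rule sum_abs)
    also have "\<dots> \<le> (\<Sum>k<m. d * \<nu> (real k * d) - d * \<nu> (real (Suc k) * d))"
    proof (rule sum_mono)
      fix k
      show "\<bar>integral\<^sup>L radon (g k) - J (g k)\<bar> \<le> d * \<nu> (real k * d) - d * \<nu> (real (Suc k) * d)"
        using I_up[of k] I_low[of k] J_up[of k] J_low[of k] by linarith
    qed
    also have "\<dots> = d * \<nu> 0 - d * \<nu> (real m * d)"
      using sum_lessThan_telescope'[of "\<lambda>k. d * \<nu> (real k * d)" m] by simp
    also have "\<dots> \<le> d * \<nu> 0" using d by (simp add: \<nu>_def)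
    finally show ?thesis using f_int by blast
  qed
  have "integral\<^sup>L radon f = J f"
  proof (rule ccontr)
    assume neq: "integral\<^sup>L radon f \<noteq> J f"
    define d where "d = \<bar>integral\<^sup>L radon f - J f\<bar> / (2 * (\<nu> 0 + 1))"
    have \<nu>0: "0 \<le> \<nu> 0" by (simp add: \<nu>_def)
    then have "0 < d" using neq by (simp add: d_def)
    from close[OF this] have "\<bar>integral\<^sup>L radon f - J f\<bar> \<le> d * \<nu> 0" by blast
    also have "\<dots> \<le> \<bar>integral\<^sup>L radon f - J f\<bar> / 2"
      using \<nu>0 neq by (simp add: d_def field_simps)
    finally show False using neq by simp
  qed
  then show ?thesis using close[of 1] by (simp add: has_bochner_integral_iff)
qed

end

section \<open>The fan as a compact normal subgroup\<close>

locale compact_fan_loop = topological_fan_loop m e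
  for m :: "'a::t1_space \<Rightarrow> 'a \<Rightarrow> 'a" (infixl \<open>\<cdot>\<close> 70) and e :: 'a +
  fixes N :: "'a set"
  assumes locally_compact: "locally_compact_space (euclidean :: 'a topology)"
    and N_fan: "N = fan"
    and compact_N: "compact N"
    and subgroup_N: "is_subgroup N"
    and N_nucleus: "N \<subseteq> nucleus"
    and t_in_N: "\<And>a b c. t a b c \<in> N" and p_in_N: "\<And>a b c. p a b c \<in> N"
begin

lemma mult_ldiv [simp]: "a \<cdot> ldiv a b = b"
  unfolding ldiv_def by (rule theI') (rule ldiv_ex1)

lemma rdiv_mult [simp]: "rdiv b a \<cdot> a = b"
  unfolding rdiv_def by (rule theI') (rule rdiv_ex1)

lemma left_cancel: "a \<cdot> x = a \<cdot> y \<longleftrightarrow> x = y"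
  using ldiv_ex1 by metis

lemma right_cancel: "x \<cdot> a = y \<cdot> a \<longleftrightarrow> x = y"
  using rdiv_ex1 by metis

lemma ldiv_mult [simp]: "ldiv a (a \<cdot> b) = b"
  using mult_ldiv left_cancel by metis

lemma mult_rdiv [simp]: "rdiv (b \<cdot> a) a = b"
  using rdiv_mult right_cancel by metis

lemmas units [simp] = left_unit right_unit

lemma nucleus_assoc:
  assumes "n \<in> nucleus"
  shows "(n \<cdot> b) \<cdot> c = n \<cdot> (b \<cdot> c)" "(b \<cdot> n) \<cdot> c = b \<cdot> (n \<cdot> c)" "(b \<cdot> c) \<cdot> n = b \<cdot> (c \<cdot> n)"
  using assms by (auto simp: nucleus_def)

lemma N_assoc:
  assumes "n \<in> N"
  shows "(n \<cdot> b) \<cdot> c = n \<cdot> (b \<cdot> c)" "(b \<cdot> n) \<cdot> c = b \<cdot> (n \<cdot> c)" "(b \<cdot> c) \<cdot> n = b \<cdot> (c \<cdot> n)"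
  using assms N_nucleus nucleus_assoc by auto

lemma N_group: "group \<lparr>carrier = N, mult = (\<cdot>), one = e\<rparr>"
  using subgroup_N by (simp add: is_subgroup_def)

lemma e_in_N: "e \<in> N"
  using monoid.one_closed[OF group.is_monoid[OF N_group]] by simp

lemma N_mult: "a \<in> N \<Longrightarrow> b \<in> N \<Longrightarrow> a \<cdot> b \<in> N"
  using monoid.m_closed[OF group.is_monoid[OF N_group], of a b] by simp

lemma N_inverse:
  assumes "n \<in> N" shows "ldiv n e \<in> N" "ldiv n e \<cdot> n = e"
proof -
  obtain k where k: "k \<in> N" "n \<cdot> k = e" "k \<cdot> n = e"
    using group.r_inv_ex[OF N_group, of n] group.l_inv_ex[OF N_group, of n] assms
      N_assoc(1) by simp (metis right_unit left_unit)
  then have "ldiv n e = k" using ldiv_mult[of n k] by simp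
  then show "ldiv n e \<in> N" "ldiv n e \<cdot> n = e" using k by auto
qed

lemma t_eq: "(a \<cdot> b) \<cdot> c = t a b c \<cdot> (a \<cdot> (b \<cdot> c))"
proof -
  have "\<exists>!n. n \<in> nucleus \<and> (a \<cdot> b) \<cdot> c = n \<cdot> (a \<cdot> (b \<cdot> c))"
    using ex_t[of a b c] right_cancel by metis
  from theI'[OF this] show ?thesis unfolding t_def by blast
qed

lemma p_eq: "(a \<cdot> b) \<cdot> c = (a \<cdot> (b \<cdot> c)) \<cdot> p a b c"
proof -
  have "\<exists>!n. n \<in> nucleus \<and> (a \<cdot> b) \<cdot> c = (a \<cdot> (b \<cdot> c)) \<cdot> n"
    using ex_p[of a b c] left_cancel by metis
  from theI'[OF this] show ?thesis unfolding p_def by blast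
qed

lemma continuous_on_mult' [continuous_intros]:
  "continuous_on S f \<Longrightarrow> continuous_on S g \<Longrightarrow> continuous_on S (\<lambda>x. f x \<cdot> g x)"
  using continuous_on_compose2[OF continuous_mult continuous_on_Pair] by fastforce

lemma continuous_on_ldiv' [continuous_intros]:
  "continuous_on S f \<Longrightarrow> continuous_on S g \<Longrightarrow> continuous_on S (\<lambda>x. ldiv (f x) (g x))"
  using continuous_on_compose2[OF continuous_ldiv continuous_on_Pair] by fastforce

lemma continuous_on_rdiv' [continuous_intros]:
  "continuous_on S f \<Longrightarrow> continuous_on S g \<Longrightarrow> continuous_on S (\<lambda>x. rdiv (g x) (f x))"
  using continuous_on_compose2[OF continuous_rdiv continuous_on_Pair] by fastforce

lemma hausdorff: "Hausdorff_space (euclidean :: 'a topology)"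
  unfolding Hausdorff_space_def
proof (intro allI impI)
  fix x y :: 'a assume "x \<in> topspace euclidean \<and> y \<in> topspace euclidean \<and> x \<noteq> y"
  then have "ldiv x y \<noteq> e" using mult_ldiv[of x y] right_unit[of x] by metis
  moreover have "open ((\<lambda>(a, b). ldiv a b) -` (- {e}))"
    using continuous_ldiv by (intro open_vimage) auto
  ultimately have "(x, y) \<in> (\<lambda>(a, b). ldiv a b) -` (- {e})"
    and op: "open ((\<lambda>(a, b). ldiv a b) -` (- {e}))" by auto
  from open_prod_elim[OF op this(1)] obtain A B where AB: "open A" "open B" "(x, y) \<in> A \<times> B"
    "A \<times> B \<subseteq> (\<lambda>(a, b). ldiv a b) -` (- {e})" .
  have "ldiv z z = e" for z using ldiv_mult[of z e] by simp
  moreover have "ldiv z z \<noteq> e" if "z \<in> A" "z \<in> B" for z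
    using subsetD[OF AB(4), of "(z, z)"] that by simp
  ultimately have "disjnt A B" unfolding disjnt_iff by metis
  then show "\<exists>U V. openin euclidean U \<and> openin euclidean V \<and> x \<in> U \<and> y \<in> V \<and> disjnt U V"
    using AB by auto
qed

text \<open>
Reassociating \<open>((x a) b) c\<close> in two ways, by way of \<open>(x (a b)) c\<close> and of \<open>(x a) (b c)\<close>, shows that
\<open>x ((a b) c)\<close> and \<open>x (a (b c))\<close> differ by a left factor in \<open>N\<close>. As the former is
\<open>(x t(a, b, c)) (a (b c))\<close>, cancelling \<open>a (b c)\<close> gives the claim.
\<close>

lemma conj_t: "\<exists>k\<in>N. x \<cdot> t a b c = k \<cdot> x"
proof -
  define Z where "Z = x \<cdot> ((a \<cdot> b) \<cdot> c)"
  define y where "y = a \<cdot> (b \<cdot> c)"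
  let ?r = "t x a b \<cdot> t x (a \<cdot> b) c" and ?s = "t (x \<cdot> a) b c \<cdot> t x a (b \<cdot> c)"
  have "((x \<cdot> a) \<cdot> b) \<cdot> c = ?r \<cdot> Z"
    unfolding Z_def by (simp add: t_eq[of x a b] t_eq[of x "a \<cdot> b" c] N_assoc t_in_N)
  moreover have "((x \<cdot> a) \<cdot> b) \<cdot> c = ?s \<cdot> (x \<cdot> y)"
    unfolding y_def by (simp add: t_eq[of "x \<cdot> a" b c] t_eq[of x a "b \<cdot> c"] N_assoc t_in_N)
  ultimately have eq: "?r \<cdot> Z = ?s \<cdot> (x \<cdot> y)" by simp
  have r: "?r \<in> N" and s: "?s \<in> N" by (simp_all add: N_mult t_in_N)
  define k where "k = ldiv ?r e \<cdot> ?s"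
  have k: "k \<in> N" unfolding k_def by (intro N_mult N_inverse r s)
  have "Z = (ldiv ?r e \<cdot> ?r) \<cdot> Z" by (simp only: N_inverse(2)[OF r] left_unit)
  also have "\<dots> = ldiv ?r e \<cdot> (?r \<cdot> Z)" by (rule N_assoc(1)[OF N_inverse(1)[OF r]])
  also have "\<dots> = k \<cdot> (x \<cdot> y)" unfolding eq k_def by (rule N_assoc(1)[OF N_inverse(1)[OF r], symmetric])
  finally have "Z = (k \<cdot> x) \<cdot> y" by (simp add: N_assoc k)
  moreover have "Z = (x \<cdot> t a b c) \<cdot> y"
    unfolding Z_def y_def by (simp add: t_eq[of a b c] N_assoc t_in_N)
  ultimately show ?thesis using right_cancel k by metis
qed

text \<open>
On \<open>y = a (b c)\<close> right multiplication by \<open>p(a, b, c)\<close> is left multiplication by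
\<open>t(a, b, c)\<close>; every \<open>x\<close> is of the form \<open>z y\<close>.
\<close>

lemma conj_p: "\<exists>k\<in>N. x \<cdot> p a b c = k \<cdot> x"
proof -
  define y where "y = a \<cdot> (b \<cdot> c)"
  define z where "z = rdiv x y"
  have x: "x = z \<cdot> y" by (simp add: z_def)
  have yp: "y \<cdot> p a b c = t a b c \<cdot> y" unfolding y_def using t_eq p_eq by metis
  obtain k where k: "k \<in> N" "z \<cdot> t a b c = k \<cdot> z" using conj_t by blast
  have "x \<cdot> p a b c = z \<cdot> (t a b c \<cdot> y)" by (simp add: x N_assoc(3) p_in_N yp)
  also have "\<dots> = (z \<cdot> t a b c) \<cdot> y" by (simp add: N_assoc(2) t_in_N)
  also have "\<dots> = k \<cdot> x" by (simp add: k x N_assoc(1))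
  finally show ?thesis using k(1) by blast
qed

text \<open>
The elements \<open>n\<close> of \<open>N\<close> with \<open>x n \<in> N x\<close> for all \<open>x\<close> form a closed subgroup
containing all \<open>t(a, b, c)\<close> and \<open>p(a, b, c)\<close>. Since \<open>N\<close> is the smallest such subgroup, it
consists of these elements.
\<close>

lemma conj_left:
  assumes "n \<in> N" shows "\<exists>k\<in>N. x \<cdot> n = k \<cdot> x"
proof -
  define H where "H = {n \<in> N. \<forall>x. \<exists>k\<in>N. x \<cdot> n = k \<cdot> x}"
  have HN: "H \<subseteq> N" by (auto simp: H_def)
  have iff: "(\<exists>k\<in>N. x \<cdot> n = k \<cdot> x) \<longleftrightarrow> rdiv (x \<cdot> n) x \<in> N" for x n
    by (metis mult_rdiv rdiv_mult)
  have "H = N \<inter> (\<Inter>x. (\<lambda>n. rdiv (x \<cdot> n) x) -` N)"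
    unfolding H_def iff by auto
  moreover have "closed N" by (rule hausdorff_compact_closed[OF hausdorff compact_N])
  ultimately have cl: "closed H"
    by (auto intro!: closed_Int closed_INT closed_vimage continuous_intros)
  have "group \<lparr>carrier = H, mult = (\<cdot>), one = e\<rparr>"
  proof (rule groupI; simp)
    show "e \<in> H" unfolding H_def using e_in_N by (auto intro: bexI[of _ e])
    show "a \<cdot> b \<in> H" if "a \<in> H" "b \<in> H" for a b
    proof -
      have ab: "a \<in> N" "b \<in> N" using that HN by auto
      have "\<exists>k\<in>N. x \<cdot> (a \<cdot> b) = k \<cdot> x" for x
      proof -
        obtain k l where "k \<in> N" "x \<cdot> a = k \<cdot> x" "l \<in> N" "x \<cdot> b = l \<cdot> x"
          using \<open>a \<in> H\<close> \<open>b \<in> H\<close> unfolding H_def by blast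
        then have "x \<cdot> (a \<cdot> b) = (k \<cdot> l) \<cdot> x"
          using N_assoc(2)[OF ab(1), of x b] N_assoc(1)[of k] by metis
        then show ?thesis using N_mult \<open>k \<in> N\<close> \<open>l \<in> N\<close> by blast
      qed
      then show ?thesis using N_mult[OF ab] by (simp add: H_def)
    qed
    show "(a \<cdot> b) \<cdot> c = a \<cdot> (b \<cdot> c)" if "a \<in> H" "b \<in> H" "c \<in> H" for a b c
      using that HN N_assoc by blast
    show "\<exists>k\<in>H. k \<cdot> n = e" if nH: "n \<in> H" for n
    proof (rule bexI[of _ "ldiv n e"])
      have n: "n \<in> N" using nH HN by auto
      let ?i = "ldiv n e"
      show "?i \<cdot> n = e" using N_inverse(2)[OF n] .
      have "\<exists>k\<in>N. x \<cdot> ?i = k \<cdot> x" for x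
      proof -
        obtain k where k: "k \<in> N" "(x \<cdot> ?i) \<cdot> n = k \<cdot> (x \<cdot> ?i)"
          using nH unfolding H_def by blast
        have "(x \<cdot> ?i) \<cdot> n = x" using N_assoc(3)[OF n, of x ?i] N_inverse(2)[OF n] by simp
        then have "ldiv k e \<cdot> x = ldiv k e \<cdot> (k \<cdot> (x \<cdot> ?i))" using k by simp
        also have "\<dots> = x \<cdot> ?i"
          using N_assoc(1)[OF N_inverse(1)[OF k(1)]] N_inverse(2)[OF k(1)] left_unit by metis
        finally show ?thesis using N_inverse(1)[OF k(1)] by metis
      qed
      then show "?i \<in> H" using N_inverse(1)[OF n] by (simp add: H_def)
    qed
  qed
  then have "is_subgroup H" by (simp add: is_subgroup_def)
  moreover have "\<forall>a b c. t a b c \<in> H \<and> p a b c \<in> H"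
    using conj_t conj_p t_in_N p_in_N by (simp add: H_def)
  ultimately have "fan \<subseteq> H" using cl unfolding fan_def by blast
  then show ?thesis using assms N_fan unfolding H_def by blast
qed

definition conjugate :: "'a \<Rightarrow> 'a \<Rightarrow> 'a" where
  "conjugate x n = rdiv (x \<cdot> n) x"

lemma conjugate_eq: "x \<cdot> n = conjugate x n \<cdot> x"
  by (simp add: conjugate_def)

lemma conjugate_in_N: "n \<in> N \<Longrightarrow> conjugate x n \<in> N"
  using conj_left[of n x] by (auto simp: conjugate_def)

lemma conjugate_mult:
  assumes "n \<in> N" "k \<in> N"
  shows "conjugate x (n \<cdot> k) = conjugate x n \<cdot> conjugate x k"
proof -
  have "x \<cdot> (n \<cdot> k) = (x \<cdot> n) \<cdot> k" using N_assoc(2)[OF assms(1)] by simp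
  also have "\<dots> = conjugate x n \<cdot> (x \<cdot> k)"
    unfolding conjugate_eq[of x n] by (rule N_assoc(1)[OF conjugate_in_N[OF assms(1)]])
  also have "\<dots> = (conjugate x n \<cdot> conjugate x k) \<cdot> x"
    unfolding conjugate_eq[of x k] by (rule N_assoc(1)[OF conjugate_in_N[OF assms(1)], symmetric])
  finally show ?thesis by (metis conjugate_eq right_cancel)
qed

text \<open>
If \<open>x r = e\<close>, conjugation by \<open>r\<close> followed by conjugation by \<open>x\<close> is the identity on
\<open>N\<close>. So the inclusion \<open>x N \<subseteq> N x\<close> for all \<open>x\<close> entails the reverse one.
\<close>

lemma conjugate_surj:
  assumes n: "n \<in> N" obtains k where "k \<in> N" "conjugate x k = n"
proof -
  define r where "r = ldiv x e"
  have xr: "x \<cdot> r = e" by (simp add: r_def)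
  define k where "k = conjugate r n"
  have k: "k \<in> N" using conjugate_in_N[OF n] by (simp add: k_def)
  have "n = x \<cdot> (r \<cdot> n)" using N_assoc(3)[OF n, of x r] xr by simp
  also have "\<dots> = (x \<cdot> k) \<cdot> r" unfolding conjugate_eq[of r n] k_def[symmetric] using N_assoc(2)[OF k] by simp
  also have "\<dots> = conjugate x k" unfolding conjugate_eq[of x k]
    using N_assoc(1)[OF conjugate_in_N[OF k], of x x r] xr by simp
  finally show ?thesis using that k by metis
qed

lemma conj_right:
  assumes "n \<in> N" shows "\<exists>k\<in>N. n \<cdot> x = x \<cdot> k"
  using conjugate_surj[OF assms, of x] conjugate_eq by metis

lemma ball_twist:
  assumes "n \<in> N" shows "\<exists>k\<in>N. \<forall>u. n \<cdot> (x \<cdot> u) = x \<cdot> (k \<cdot> u)"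
  using conj_right[OF assms, of x] N_assoc assms by metis

end

section \<open>Finite averages\<close>

definition avg :: "'b list \<Rightarrow> ('b \<Rightarrow> real) \<Rightarrow> real" where
  "avg as h = (\<Sum>a\<leftarrow>as. h a) / real (length as)"

lemma avg_add: "avg as (\<lambda>a. f a + g a) = avg as f + avg as g"
  by (simp add: avg_def sum_list_addf add_divide_distrib)

lemma avg_cmult: "avg as (\<lambda>a. k * f a) = k * avg as f"
  by (simp add: avg_def sum_list_const_mult)

lemma avg_map: "avg (map g as) h = avg as (\<lambda>a. h (g a))"
  by (simp add: avg_def comp_def)

lemma avg_cong: "(\<And>a. a \<in> set as \<Longrightarrow> f a = g a) \<Longrightarrow> avg as f = avg as g"
  unfolding avg_def by (metis (mono_tags, lifting) map_eq_conv)

lemma avg_const: "as \<noteq> [] \<Longrightarrow> avg as (\<lambda>a. c) = c"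
  by (simp add: avg_def sum_list_triv)

lemma avg_mono: "(\<And>a. a \<in> set as \<Longrightarrow> f a \<le> g a) \<Longrightarrow> avg as f \<le> avg as g"
  unfolding avg_def by (intro divide_right_mono sum_list_mono) auto

lemma avg_near:
  assumes "as \<noteq> []" "\<And>a. a \<in> set as \<Longrightarrow> \<bar>h a - c\<bar> \<le> \<epsilon>" shows "\<bar>avg as h - c\<bar> \<le> \<epsilon>"
proof -
  have "avg as (\<lambda>a. c - \<epsilon>) \<le> avg as h" "avg as h \<le> avg as (\<lambda>a. c + \<epsilon>)"
    using assms(2) by (auto intro!: avg_mono simp: abs_le_iff diff_le_eq add.commute)
  then show ?thesis using avg_const[OF assms(1)] by (simp add: abs_le_iff)
qed

lemma avg_swap: "avg as (\<lambda>a. avg bs (\<lambda>b. h a b)) = avg bs (\<lambda>b. avg as (\<lambda>a. h a b))"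
proof -
  have "(\<Sum>a\<leftarrow>as. \<Sum>b\<leftarrow>bs. h a b) = (\<Sum>b\<leftarrow>bs. \<Sum>a\<leftarrow>as. h a b)"
    by (induction as) (simp_all add: sum_list_addf)
  then show ?thesis
    unfolding avg_def divide_inverse sum_list_mult_const by simp
qed

lemma avg_product: "avg (List.product as bs) (\<lambda>(a, b). h a b) = avg as (\<lambda>a. avg bs (h a))"
proof -
  have "(\<Sum>(a, b)\<leftarrow>List.product as bs. h a b) = (\<Sum>a\<leftarrow>as. \<Sum>b\<leftarrow>bs. h a b)"
    by (induction as) (simp_all add: comp_def)
  then show ?thesis
    unfolding avg_def by (simp add: divide_inverse sum_list_mult_const)
qed

text \<open>
A single small value lowers the average by an amount that depends only on the number of entries.
\<close>

lemma avg_gap: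
  assumes M: "\<And>b. b \<in> set bs \<Longrightarrow> h b \<le> M" and b0: "b0 \<in> set bs" "h b0 \<le> M - \<delta>"
  shows "avg bs h \<le> M - \<delta> / length bs"
proof -
  have le: "(\<Sum>b\<leftarrow>cs. h b) \<le> length cs * M" if "set cs \<subseteq> set bs" for cs
    using that by (induction cs) (auto simp: algebra_simps intro!: add_mono M)
  obtain xs ys where bs: "bs = xs @ b0 # ys" using b0(1) by (meson split_list)
  have "(\<Sum>b\<leftarrow>bs. h b) \<le> length bs * M - \<delta>"
  proof -
    have "(\<Sum>b\<leftarrow>xs. h b) \<le> length xs * M" "(\<Sum>b\<leftarrow>ys. h b) \<le> length ys * M"
      by (auto intro!: le simp: bs)
    then show ?thesis using b0(2) by (simp add: bs algebra_simps)
  qed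
  moreover have "0 < length bs" using b0(1) by (cases bs) auto
  ultimately show ?thesis by (simp add: avg_def field_simps)
qed

lemma continuous_on_avg [continuous_intros]:
  "(\<And>a. a \<in> set as \<Longrightarrow> continuous_on S (h a)) \<Longrightarrow> continuous_on S (\<lambda>x. avg as (\<lambda>a. h a x))"
  unfolding avg_def divide_inverse
  by (intro continuous_intros, induction as) (auto intro: continuous_intros)

lemma open_uniformly:
  assumes "open D" "compact K" shows "open {u. \<forall>x\<in>K. (u, x) \<in> D}"
proof (subst open_subopen, intro ballI)
  fix u assume "u \<in> {u. \<forall>x\<in>K. (u, x) \<in> D}"
  then have "{u} \<times> K \<subseteq> D" by auto
  from Elementary_Topology.tube_lemma[OF assms(2,1) this] obtain X where "u \<in> X" "open X" "X \<times> K \<subseteq> D" by blast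
  then show "\<exists>T. open T \<and> u \<in> T \<and> T \<subseteq> {u. \<forall>x\<in>K. (u, x) \<in> D}" by blast
qed

section \<open>The invariant mean over the compact subgroup\<close>

context compact_fan_loop
begin

lemma finite_translate_cover:
  assumes "open W" "e \<in> W"
  obtains as where "as \<noteq> []" "set as \<subseteq> N" "\<And>n. n \<in> N \<Longrightarrow> \<exists>a\<in>set as. a \<cdot> n \<in> W"
proof -
  have op: "open {n. a \<cdot> n \<in> W}" for a
  proof -
    have "continuous_on UNIV (\<lambda>n. a \<cdot> n)" by (intro continuous_intros)
    from open_vimage[OF assms(1) this] show ?thesis by (simp add: vimage_def)
  qed
  have "N \<subseteq> (\<Union>a\<in>N. {n. a \<cdot> n \<in> W})"
  proof
    fix n assume "n \<in> N"
    then show "n \<in> (\<Union>a\<in>N. {n. a \<cdot> n \<in> W})"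
      using N_inverse[of n] assms(2) by (auto intro!: bexI[of _ "ldiv n e"])
  qed
  from compactE_image[OF compact_N op this] obtain A where
    A: "A \<subseteq> N" "finite A" "N \<subseteq> (\<Union>a\<in>A. {n. a \<cdot> n \<in> W})" .
  obtain as where as: "set as = A" using A(2) finite_list by blast
  show ?thesis
  proof (rule that[of as])
    show "as \<noteq> []" using A(3) e_in_N as by auto
  qed (use A as in auto)
qed

text \<open>
Von Neumann's description of the Haar integral of a compact group: the constant that is a uniform limit of
averages of translates. Being intrinsic, it comes with uniqueness and with invariance under automorphisms.
\<close>

definition left_mean :: "('a \<Rightarrow> real) \<Rightarrow> real \<Rightarrow> bool" where
  "left_mean f c \<longleftrightarrow> (\<forall>\<epsilon>>0. \<exists>as. as \<noteq> [] \<and> set as \<subseteq> N \<and> (\<forall>n\<in>N. \<bar>avg as (\<lambda>a. f (a \<cdot> n)) - c\<bar> \<le> \<epsilon>))"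

definition right_mean :: "('a \<Rightarrow> real) \<Rightarrow> real \<Rightarrow> bool" where
  "right_mean f c \<longleftrightarrow> (\<forall>\<epsilon>>0. \<exists>as. as \<noteq> [] \<and> set as \<subseteq> N \<and> (\<forall>n\<in>N. \<bar>avg as (\<lambda>a. f (n \<cdot> a)) - c\<bar> \<le> \<epsilon>))"

text \<open>
Left and right translations commute, so the average over both kinds of translates is close to both constants.
\<close>

lemma left_right_mean_eq:
  assumes "left_mean f c" "right_mean f d" shows "c = d"
proof (rule ccontr)
  assume "c \<noteq> d"
  then have e: "0 < \<bar>c - d\<bar> / 3" by simp
  obtain as where as: "as \<noteq> []" "set as \<subseteq> N" "\<forall>n\<in>N. \<bar>avg as (\<lambda>a. f (a \<cdot> n)) - c\<bar> \<le> \<bar>c - d\<bar> / 3"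
    using assms(1) e unfolding left_mean_def by meson
  obtain bs where bs: "bs \<noteq> []" "set bs \<subseteq> N" "\<forall>n\<in>N. \<bar>avg bs (\<lambda>a. f (n \<cdot> a)) - d\<bar> \<le> \<bar>c - d\<bar> / 3"
    using assms(2) e unfolding right_mean_def by meson
  have "\<bar>avg bs (\<lambda>b. avg as (\<lambda>a. f (a \<cdot> b))) - c\<bar> \<le> \<bar>c - d\<bar> / 3"
    using as bs by (intro avg_near[OF bs(1)]) auto
  moreover have "\<bar>avg as (\<lambda>a. avg bs (\<lambda>b. f (a \<cdot> b))) - d\<bar> \<le> \<bar>c - d\<bar> / 3"
    using as bs by (intro avg_near[OF as(1)]) auto
  moreover have "\<bar>c - d\<bar> \<le> \<bar>X - c\<bar> + \<bar>X - d\<bar>" for X by linarith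
  ultimately have "\<bar>c - d\<bar> \<le> \<bar>c - d\<bar> / 3 + \<bar>c - d\<bar> / 3"
    unfolding avg_swap[of as bs] by (meson add_mono order_trans)
  then have "\<bar>c - d\<bar> / 3 \<le> 0" by simp
  then show False using e by simp
qed

lemma bounded_on_N:
  assumes "continuous_on UNIV (f :: 'a \<Rightarrow> real)" obtains B where "\<And>n. n \<in> N \<Longrightarrow> \<bar>f n\<bar> \<le> B"
proof -
  have "compact (f ` N)"
    using assms compact_N by (meson compact_continuous_image continuous_on_subset subset_UNIV)
  then obtain B where "\<forall>y\<in>f ` N. \<bar>y\<bar> \<le> B" by (auto dest!: compact_imp_bounded simp: bounded_real)
  then show ?thesis using that by blast
qed

lemma translates_equicontinuous:
  assumes f: "continuous_on UNIV (f :: 'a \<Rightarrow> real)" and e: "0 < \<epsilon>"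
  obtains bs where "bs \<noteq> []" "set bs \<subseteq> N"
    "\<And>n. n \<in> N \<Longrightarrow> \<exists>b\<in>set bs. \<forall>c\<in>N. \<bar>f (c \<cdot> (b \<cdot> n)) - f c\<bar> \<le> \<epsilon>"
proof -
  define D where "D = {z. \<bar>f (snd z \<cdot> fst z) - f (snd z)\<bar> < \<epsilon>}"
  have "open D"
  proof -
    have "continuous_on UNIV (\<lambda>z. f (snd z \<cdot> fst z))" "continuous_on UNIV (\<lambda>z :: 'a \<times> 'a. f (snd z))"
      by (auto intro!: continuous_on_compose2[OF f] continuous_intros)
    then show ?thesis unfolding D_def by (intro open_Collect_less continuous_intros)
  qed
  then have op: "open {u. \<forall>c\<in>N. (u, c) \<in> D}" using compact_N by (rule open_uniformly)
  have "e \<in> {u. \<forall>c\<in>N. (u, c) \<in> D}" using e by (simp add: D_def)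
  from finite_translate_cover[OF op this] obtain bs where bs: "bs \<noteq> []" "set bs \<subseteq> N"
    "\<And>n. n \<in> N \<Longrightarrow> \<exists>a\<in>set bs. a \<cdot> n \<in> {u. \<forall>c\<in>N. (u, c) \<in> D}" by blast
  show ?thesis
  proof (rule that[OF bs(1,2)])
    fix n assume "n \<in> N"
    then obtain b where "b \<in> set bs" "\<forall>c\<in>N. (b \<cdot> n, c) \<in> D" using bs(3) by blast
    then show "\<exists>b\<in>set bs. \<forall>c\<in>N. \<bar>f (c \<cdot> (b \<cdot> n)) - f c\<bar> \<le> \<epsilon>"
      unfolding D_def by (auto intro!: bexI[of _ b] less_imp_le)
  qed
qed

text \<open>
Let \<open>q\<close> be the infimum of the upper bounds that averages of left translates can have. An average
\<open>g\<close> with upper bound close to \<open>q\<close> cannot be much smaller than \<open>q\<close> at any point \<open>x\<close>: by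
equicontinuity, for each \<open>n\<close> one among a fixed finite number \<open>k\<close> of translates of \<open>g\<close> is small
at \<open>n\<close>, so that the average of these \<open>k\<close> translates would have an upper bound below \<open>q\<close>.
\<close>

lemma left_mean_exists:
  assumes f: "continuous_on UNIV (f :: 'a \<Rightarrow> real)" shows "\<exists>c. left_mean f c"
proof -
  define S where "S = {s. \<exists>as. as \<noteq> [] \<and> set as \<subseteq> N \<and> (\<forall>n\<in>N. avg as (\<lambda>a. f (a \<cdot> n)) \<le> s)}"
  obtain B where B: "\<And>n. n \<in> N \<Longrightarrow> \<bar>f n\<bar> \<le> B" using bounded_on_N[OF f] by blast
  have "B \<in> S"
    unfolding S_def using B e_in_N by (auto intro!: exI[of _ "[e]"] simp: avg_def abs_le_iff)
  then have ne: "S \<noteq> {}" by blast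
  have lb: "- B \<le> s" if "s \<in> S" for s
  proof -
    obtain as where as: "as \<noteq> []" "set as \<subseteq> N" "\<forall>n\<in>N. avg as (\<lambda>a. f (a \<cdot> n)) \<le> s"
      using \<open>s \<in> S\<close> unfolding S_def by blast
    have "avg as (\<lambda>a. - B) \<le> avg as (\<lambda>a. f (a \<cdot> e))"
    proof (rule avg_mono)
      fix a assume "a \<in> set as"
      then have "\<bar>f a\<bar> \<le> B" using B as by blast
      then show "- B \<le> f (a \<cdot> e)" by simp
    qed
    then have "- B \<le> avg as (\<lambda>a. f (a \<cdot> e))" unfolding avg_const[OF as(1)] .
    also have "\<dots> \<le> s" using as(3) e_in_N by blast
    finally show ?thesis .
  qed
  then have bdd: "bdd_below S" by (meson bdd_belowI)
  define q where "q = Inf S"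
  have "\<exists>as. as \<noteq> [] \<and> set as \<subseteq> N \<and> (\<forall>n\<in>N. \<bar>avg as (\<lambda>a. f (a \<cdot> n)) - q\<bar> \<le> \<epsilon>)" if e: "0 < \<epsilon>" for \<epsilon>
  proof -
    have "0 < \<epsilon> / 2" using e by simp
    from translates_equicontinuous[OF f this] obtain bs where bs: "bs \<noteq> []" "set bs \<subseteq> N"
      "\<And>n. n \<in> N \<Longrightarrow> \<exists>b\<in>set bs. \<forall>c\<in>N. \<bar>f (c \<cdot> (b \<cdot> n)) - f c\<bar> \<le> \<epsilon> / 2" by blast
    define k where "k = real (length bs)"
    have k: "1 \<le> k" using bs(1) by (cases bs) (auto simp: k_def)
    \<comment> \<open>The gap \<open>\<epsilon> / (2 k)\<close> produced by one small value among \<open>k\<close> has to exceed the excess \<open>\<eta>\<close>; here it is \<open>2 \<eta>\<close>.\<close>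
    define \<eta> where "\<eta> = \<epsilon> / (4 * k)"
    have eta: "0 < \<eta>" "\<eta> \<le> \<epsilon>" using e k by (auto simp: \<eta>_def field_simps)
    obtain s where "s \<in> S" "s < q + \<eta>"
      using cInf_lessD[OF ne, of "q + \<eta>"] eta unfolding q_def by auto
    then obtain as where as: "as \<noteq> []" "set as \<subseteq> N" and up: "\<And>n. n \<in> N \<Longrightarrow> avg as (\<lambda>a. f (a \<cdot> n)) \<le> q + \<eta>"
      unfolding S_def by fastforce
    define g where "g = (\<lambda>n. avg as (\<lambda>a. f (a \<cdot> n)))"
    have low: "q - \<epsilon> \<le> g x" if x: "x \<in> N" for x
    proof (rule ccontr)
      assume "\<not> q - \<epsilon> \<le> g x"
      then have gx: "g x < q - \<epsilon>" by simp
      define cs where "cs = map (\<lambda>(b, a). a \<cdot> (x \<cdot> b)) (List.product bs as)"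
      have cs: "cs \<noteq> []" "set cs \<subseteq> N"
      proof -
        show "cs \<noteq> []" using as(1) bs(1) unfolding cs_def
          by (metis length_0_conv length_map length_product mult_is_0)
        show "set cs \<subseteq> N" using as(2) bs(2) x N_mult by (auto simp: cs_def subset_iff)
      qed
      have "avg cs (\<lambda>c. f (c \<cdot> n)) \<le> q - \<eta> / k" if n: "n \<in> N" for n
      proof -
        have "avg cs (\<lambda>c. f (c \<cdot> n)) = avg bs (\<lambda>b. avg as (\<lambda>a. f ((a \<cdot> (x \<cdot> b)) \<cdot> n)))"
          unfolding cs_def avg_map avg_product[symmetric] by (simp add: case_prod_unfold)
        also have "\<dots> = avg bs (\<lambda>b. g ((x \<cdot> b) \<cdot> n))"
        proof (intro avg_cong)
          fix b assume "b \<in> set bs"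
          show "avg as (\<lambda>a. f ((a \<cdot> (x \<cdot> b)) \<cdot> n)) = g ((x \<cdot> b) \<cdot> n)"
            unfolding g_def using as N_assoc(1) by (intro avg_cong) (metis subsetD)
        qed
        also have "\<dots> \<le> (q + \<eta>) - (\<epsilon> / 2) / length bs"
        proof -
          obtain b0 where b0: "b0 \<in> set bs" "\<forall>c\<in>N. \<bar>f (c \<cdot> (b0 \<cdot> n)) - f c\<bar> \<le> \<epsilon> / 2"
            using bs(3)[OF n] by blast
          have "\<bar>g ((x \<cdot> b0) \<cdot> n) - g x\<bar> \<le> \<epsilon> / 2"
          proof -
            have "g ((x \<cdot> b0) \<cdot> n) - g x = avg as (\<lambda>a. f (a \<cdot> ((x \<cdot> b0) \<cdot> n)) - f (a \<cdot> x))"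
              unfolding g_def avg_def by (simp add: sum_list_subtractf diff_divide_distrib)
            also have "\<bar>\<dots> - 0\<bar> \<le> \<epsilon> / 2"
            proof (rule avg_near[OF as(1)])
              fix a assume "a \<in> set as"
              then have a: "a \<in> N" using as by blast
              have "a \<cdot> ((x \<cdot> b0) \<cdot> n) = (a \<cdot> x) \<cdot> (b0 \<cdot> n)"
                using N_assoc(1)[OF a] N_assoc(1)[OF x] by simp
              then show "\<bar>f (a \<cdot> ((x \<cdot> b0) \<cdot> n)) - f (a \<cdot> x) - 0\<bar> \<le> \<epsilon> / 2"
                using b0(2) N_mult[OF a x] by simp
            qed
            finally show ?thesis by simp
          qed
          then have "g ((x \<cdot> b0) \<cdot> n) \<le> (q + \<eta>) - \<epsilon> / 2" using gx eta by linarith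
          then show ?thesis
            using up bs(2) x n N_mult unfolding g_def[symmetric]
            by (intro avg_gap[OF _ b0(1)]) (auto simp: g_def)
        qed
        also have "\<dots> = q - \<eta>" using k by (simp add: \<eta>_def k_def[symmetric] field_simps)
        also have "\<dots> \<le> q - \<eta> / k" using k eta by (simp add: field_simps)
        finally show ?thesis .
      qed
      then have "q - \<eta> / k \<in> S" using cs unfolding S_def by blast
      then have "q \<le> q - \<eta> / k" unfolding q_def using bdd by (intro cInf_lower)
      moreover have "0 < \<eta> / k" using eta k by simp
      ultimately show False by simp
    qed
    have "\<bar>avg as (\<lambda>a. f (a \<cdot> n)) - q\<bar> \<le> \<epsilon>" if "n \<in> N" for n
      using up[OF that] low[OF that] eta unfolding g_def by linarith
    then show ?thesis using as by blast
  qed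
  then show ?thesis unfolding left_mean_def by blast
qed

lemma N_inverse_mult:
  assumes "a \<in> N" "n \<in> N" shows "ldiv (a \<cdot> n) e = ldiv n e \<cdot> ldiv a e"
proof -
  have "n \<cdot> (ldiv n e \<cdot> ldiv a e) = (n \<cdot> ldiv n e) \<cdot> ldiv a e"
    by (rule N_assoc(1)[OF assms(2), symmetric])
  then have "n \<cdot> (ldiv n e \<cdot> ldiv a e) = ldiv a e" by simp
  then have "(a \<cdot> n) \<cdot> (ldiv n e \<cdot> ldiv a e) = e"
    using N_assoc(1)[OF assms(1)] by simp
  then show ?thesis by (metis ldiv_mult)
qed

lemma N_inverse_inverse: "n \<in> N \<Longrightarrow> ldiv (ldiv n e) e = n"
  using N_inverse(2)[of n] by (metis ldiv_mult)

text \<open>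
Inversion exchanges left and right translations.
\<close>

lemma right_mean_exists:
  assumes f: "continuous_on UNIV (f :: 'a \<Rightarrow> real)" shows "\<exists>c. right_mean f c"
proof -
  have "continuous_on UNIV (\<lambda>n. f (ldiv n e))"
    by (auto intro!: continuous_on_compose2[OF f] continuous_intros)
  then obtain c where c: "left_mean (\<lambda>n. f (ldiv n e)) c" using left_mean_exists by blast
  have "right_mean f c"
    unfolding right_mean_def
  proof (intro allI impI)
    fix \<epsilon> :: real assume "0 < \<epsilon>"
    then obtain as where as: "as \<noteq> []" "set as \<subseteq> N"
      "\<forall>n\<in>N. \<bar>avg as (\<lambda>a. f (ldiv (a \<cdot> n) e)) - c\<bar> \<le> \<epsilon>" using c unfolding left_mean_def by meson
    have "\<bar>avg (map (\<lambda>a. ldiv a e) as) (\<lambda>a. f (n \<cdot> a)) - c\<bar> \<le> \<epsilon>" if n: "n \<in> N" for n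
    proof -
      have "avg (map (\<lambda>a. ldiv a e) as) (\<lambda>a. f (n \<cdot> a)) = avg as (\<lambda>a. f (ldiv (a \<cdot> ldiv n e) e))"
        unfolding avg_map
      proof (rule avg_cong)
        fix a assume "a \<in> set as"
        then have "a \<in> N" using as by blast
        then show "f (n \<cdot> ldiv a e) = f (ldiv (a \<cdot> ldiv n e) e)"
          using N_inverse_mult[of a "ldiv n e"] N_inverse(1)[OF n] N_inverse_inverse[OF n] by simp
      qed
      then show ?thesis using as(3) N_inverse(1)[OF n] by simp
    qed
    then show "\<exists>as. as \<noteq> [] \<and> set as \<subseteq> N \<and> (\<forall>n\<in>N. \<bar>avg as (\<lambda>a. f (n \<cdot> a)) - c\<bar> \<le> \<epsilon>)"
      using as N_inverse(1) by (intro exI[of _ "map (\<lambda>a. ldiv a e) as"]) auto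
  qed
  then show ?thesis by blast
qed

definition mean :: "('a \<Rightarrow> real) \<Rightarrow> real" where
  "mean f = (THE c. left_mean f c)"

lemma left_mean_iff:
  assumes f: "continuous_on UNIV f" shows "left_mean f c \<longleftrightarrow> c = mean f"
proof -
  obtain d where d: "right_mean f d" using right_mean_exists[OF f] by blast
  obtain c' where "left_mean f c'" using left_mean_exists[OF f] by blast
  then have "\<exists>!c. left_mean f c" using left_right_mean_eq d by metis
  then show ?thesis unfolding mean_def by (metis the1_equality theI')
qed

lemma right_mean_iff:
  assumes f: "continuous_on UNIV f" shows "right_mean f c \<longleftrightarrow> c = mean f"
  using right_mean_exists[OF f] left_mean_iff[OF f] left_right_mean_eq by metis

lemma left_average:
  assumes "continuous_on UNIV f" "0 < \<epsilon>"
  obtains as where "as \<noteq> []" "set as \<subseteq> N" "\<And>n. n \<in> N \<Longrightarrow> \<bar>avg as (\<lambda>a. f (a \<cdot> n)) - mean f\<bar> \<le> \<epsilon>"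
proof -
  have "left_mean f (mean f)" using left_mean_iff[OF assms(1)] by simp
  then have "\<exists>as. as \<noteq> [] \<and> set as \<subseteq> N \<and> (\<forall>n\<in>N. \<bar>avg as (\<lambda>a. f (a \<cdot> n)) - mean f\<bar> \<le> \<epsilon>)"
    using assms(2) unfolding left_mean_def by simp
  then show ?thesis using that by auto
qed

lemma right_average:
  assumes "continuous_on UNIV f" "0 < \<epsilon>"
  obtains as where "as \<noteq> []" "set as \<subseteq> N" "\<And>n. n \<in> N \<Longrightarrow> \<bar>avg as (\<lambda>a. f (n \<cdot> a)) - mean f\<bar> \<le> \<epsilon>"
proof -
  have "right_mean f (mean f)" using right_mean_iff[OF assms(1)] by simp
  then have "\<exists>as. as \<noteq> [] \<and> set as \<subseteq> N \<and> (\<forall>n\<in>N. \<bar>avg as (\<lambda>a. f (n \<cdot> a)) - mean f\<bar> \<le> \<epsilon>)"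
    using assms(2) unfolding right_mean_def by simp
  then show ?thesis using that by auto
qed

lemma mean_ge:
  assumes f: "continuous_on UNIV f" and c: "\<And>n. n \<in> N \<Longrightarrow> c \<le> f n" shows "c \<le> mean f"
proof (rule field_le_epsilon)
  fix \<epsilon> :: real assume "0 < \<epsilon>"
  from left_average[OF f this] obtain as where as: "as \<noteq> []" "set as \<subseteq> N"
    "\<And>n. n \<in> N \<Longrightarrow> \<bar>avg as (\<lambda>a. f (a \<cdot> n)) - mean f\<bar> \<le> \<epsilon>" by blast
  have "avg as (\<lambda>a. c) \<le> avg as (\<lambda>a. f (a \<cdot> e))" using c as by (intro avg_mono) auto
  then have "c \<le> avg as (\<lambda>a. f (a \<cdot> e))" using avg_const[OF as(1), of c] by simp
  then show "c \<le> mean f + \<epsilon>" using as(3)[OF e_in_N] by linarith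
qed

lemma mean_near:
  assumes f: "continuous_on UNIV f" and c: "\<And>n. n \<in> N \<Longrightarrow> \<bar>f n - c\<bar> \<le> \<delta>"
  shows "\<bar>mean f - c\<bar> \<le> \<delta>"
proof (rule field_le_epsilon)
  fix \<epsilon> :: real assume "0 < \<epsilon>"
  from left_average[OF f this] obtain as where as: "as \<noteq> []" "set as \<subseteq> N"
    "\<And>n. n \<in> N \<Longrightarrow> \<bar>avg as (\<lambda>a. f (a \<cdot> n)) - mean f\<bar> \<le> \<epsilon>" by blast
  have "\<bar>avg as (\<lambda>a. f (a \<cdot> e)) - c\<bar> \<le> \<delta>" using c as by (intro avg_near) auto
  then show "\<bar>mean f - c\<bar> \<le> \<delta> + \<epsilon>" using as(3)[OF e_in_N] by linarith
qed

lemma continuous_translates: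
  assumes "continuous_on UNIV (f :: 'a \<Rightarrow> real)"
  shows "continuous_on UNIV (\<lambda>n. f (a \<cdot> n))" "continuous_on UNIV (\<lambda>n. f (n \<cdot> a))"
  by (auto intro!: continuous_on_compose2[OF assms] continuous_intros)

text \<open>
Averaging left translates does not disturb averages of right translates, and the latter determine the mean as well.
\<close>

lemma mean_left_average:
  assumes f: "continuous_on UNIV f" and as: "as \<noteq> []" "set as \<subseteq> N"
  shows "mean (\<lambda>n. avg as (\<lambda>a. f (a \<cdot> n))) = mean f"
proof -
  have "continuous_on UNIV (\<lambda>n. avg as (\<lambda>a. f (a \<cdot> n)))"
    by (intro continuous_on_avg continuous_translates f)
  moreover have "right_mean (\<lambda>n. avg as (\<lambda>a. f (a \<cdot> n))) (mean f)"
    unfolding right_mean_def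
  proof (intro allI impI)
    fix \<epsilon> :: real assume "0 < \<epsilon>"
    from right_average[OF f this] obtain bs where bs: "bs \<noteq> []" "set bs \<subseteq> N"
      "\<And>n. n \<in> N \<Longrightarrow> \<bar>avg bs (\<lambda>b. f (n \<cdot> b)) - mean f\<bar> \<le> \<epsilon>" by blast
    have "\<bar>avg bs (\<lambda>b. avg as (\<lambda>a. f (a \<cdot> (n \<cdot> b)))) - mean f\<bar> \<le> \<epsilon>" if n: "n \<in> N" for n
      unfolding avg_swap[of bs as]
    proof (rule avg_near[OF as(1)])
      fix a assume "a \<in> set as"
      then have a: "a \<in> N" using as by blast
      show "\<bar>avg bs (\<lambda>b. f (a \<cdot> (n \<cdot> b))) - mean f\<bar> \<le> \<epsilon>"
        using bs(3)[OF N_mult[OF a n]] by (simp add: N_assoc(1)[OF a])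
    qed
    then show "\<exists>bs. bs \<noteq> [] \<and> set bs \<subseteq> N \<and> (\<forall>n\<in>N. \<bar>avg bs (\<lambda>b. avg as (\<lambda>a. f (a \<cdot> (n \<cdot> b)))) - mean f\<bar> \<le> \<epsilon>)"
      using bs by blast
  qed
  ultimately show ?thesis using right_mean_iff by metis
qed

lemma mean_right_average:
  assumes f: "continuous_on UNIV f" and bs: "bs \<noteq> []" "set bs \<subseteq> N"
  shows "mean (\<lambda>n. avg bs (\<lambda>b. f (n \<cdot> b))) = mean f"
proof -
  have "continuous_on UNIV (\<lambda>n. avg bs (\<lambda>b. f (n \<cdot> b)))"
    by (intro continuous_on_avg continuous_translates f)
  moreover have "left_mean (\<lambda>n. avg bs (\<lambda>b. f (n \<cdot> b))) (mean f)"
    unfolding left_mean_def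
  proof (intro allI impI)
    fix \<epsilon> :: real assume "0 < \<epsilon>"
    from left_average[OF f this] obtain as where as: "as \<noteq> []" "set as \<subseteq> N"
      "\<And>n. n \<in> N \<Longrightarrow> \<bar>avg as (\<lambda>a. f (a \<cdot> n)) - mean f\<bar> \<le> \<epsilon>" by blast
    have "\<bar>avg as (\<lambda>a. avg bs (\<lambda>b. f ((a \<cdot> n) \<cdot> b))) - mean f\<bar> \<le> \<epsilon>" if n: "n \<in> N" for n
      unfolding avg_swap[of as bs]
    proof (rule avg_near[OF bs(1)])
      fix b assume "b \<in> set bs"
      then have b: "b \<in> N" using bs by blast
      show "\<bar>avg as (\<lambda>a. f ((a \<cdot> n) \<cdot> b)) - mean f\<bar> \<le> \<epsilon>"
        using as(3)[OF N_mult[OF n b]] by (simp add: N_assoc(3)[OF b])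
    qed
    then show "\<exists>as. as \<noteq> [] \<and> set as \<subseteq> N \<and> (\<forall>n\<in>N. \<bar>avg as (\<lambda>a. avg bs (\<lambda>b. f ((a \<cdot> n) \<cdot> b))) - mean f\<bar> \<le> \<epsilon>)"
      using as by blast
  qed
  ultimately show ?thesis using left_mean_iff by metis
qed

lemma mean_right_translate:
  assumes "continuous_on UNIV f" "k \<in> N" shows "mean (\<lambda>n. f (n \<cdot> k)) = mean f"
  using mean_right_average[OF assms(1), of "[k]"] assms(2) by (simp add: avg_def)

lemma mean_diff:
  assumes f: "continuous_on UNIV f" and g: "continuous_on UNIV g"
    and d: "\<And>n. n \<in> N \<Longrightarrow> \<bar>f n - g n\<bar> \<le> \<delta>"
  shows "\<bar>mean f - mean g\<bar> \<le> \<delta>"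
proof (rule field_le_epsilon)
  fix \<epsilon> :: real assume "0 < \<epsilon>"
  from left_average[OF f this] obtain as where as: "as \<noteq> []" "set as \<subseteq> N"
    "\<And>n. n \<in> N \<Longrightarrow> \<bar>avg as (\<lambda>a. f (a \<cdot> n)) - mean f\<bar> \<le> \<epsilon>" by blast
  have "\<bar>mean (\<lambda>n. avg as (\<lambda>a. g (a \<cdot> n))) - mean f\<bar> \<le> \<delta> + \<epsilon>"
  proof (rule mean_near)
    show "continuous_on UNIV (\<lambda>n. avg as (\<lambda>a. g (a \<cdot> n)))"
      by (intro continuous_on_avg continuous_translates g)
    fix n assume n: "n \<in> N"
    have "\<bar>avg as (\<lambda>a. f (a \<cdot> n) + - 1 * g (a \<cdot> n)) - 0\<bar> \<le> \<delta>"
      using d as n N_mult by (intro avg_near) auto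
    then show "\<bar>avg as (\<lambda>a. g (a \<cdot> n)) - mean f\<bar> \<le> \<delta> + \<epsilon>"
      using as(3)[OF n] unfolding avg_add avg_cmult by linarith
  qed
  then show "\<bar>mean f - mean g\<bar> \<le> \<delta> + \<epsilon>"
    unfolding mean_left_average[OF g as(1,2)] by linarith
qed

text \<open>
Left averages flatten \<open>f\<close> and right averages flatten \<open>g\<close>. The two operations commute, hence applied
together they flatten both summands at once, and neither changes the mean of the sum.
\<close>

lemma mean_add:
  assumes f: "continuous_on UNIV f" and g: "continuous_on UNIV g"
  shows "mean (\<lambda>n. f n + g n) = mean f + mean g"
proof (rule ccontr)
  assume neq: "mean (\<lambda>n. f n + g n) \<noteq> mean f + mean g"
  define h where "h = (\<lambda>n. f n + g n)"
  define \<epsilon> where "\<epsilon> = \<bar>mean h - (mean f + mean g)\<bar> / 3"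
  have e: "0 < \<epsilon>" using neq by (simp add: \<epsilon>_def h_def)
  have h: "continuous_on UNIV h" unfolding h_def by (intro continuous_intros f g)
  from left_average[OF f e] obtain as where as: "as \<noteq> []" "set as \<subseteq> N"
    "\<And>n. n \<in> N \<Longrightarrow> \<bar>avg as (\<lambda>a. f (a \<cdot> n)) - mean f\<bar> \<le> \<epsilon>" by blast
  from right_average[OF g e] obtain bs where bs: "bs \<noteq> []" "set bs \<subseteq> N"
    "\<And>n. n \<in> N \<Longrightarrow> \<bar>avg bs (\<lambda>b. g (n \<cdot> b)) - mean g\<bar> \<le> \<epsilon>" by blast
  define h1 where "h1 = (\<lambda>n. avg as (\<lambda>a. h (a \<cdot> n)))"
  have h1: "continuous_on UNIV h1" unfolding h1_def by (intro continuous_on_avg continuous_translates h)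
  have "\<bar>mean (\<lambda>n. avg bs (\<lambda>b. h1 (n \<cdot> b))) - (mean f + mean g)\<bar> \<le> 2 * \<epsilon>"
  proof (rule mean_near)
    show "continuous_on UNIV (\<lambda>n. avg bs (\<lambda>b. h1 (n \<cdot> b)))"
      by (intro continuous_on_avg continuous_translates h1)
    fix n assume n: "n \<in> N"
    have split: "avg bs (\<lambda>b. h1 (n \<cdot> b)) =
      avg bs (\<lambda>b. avg as (\<lambda>a. f (a \<cdot> (n \<cdot> b)))) + avg as (\<lambda>a. avg bs (\<lambda>b. g ((a \<cdot> n) \<cdot> b)))"
    proof -
      have "avg bs (\<lambda>b. avg as (\<lambda>a. g (a \<cdot> (n \<cdot> b)))) = avg as (\<lambda>a. avg bs (\<lambda>b. g ((a \<cdot> n) \<cdot> b)))"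
        unfolding avg_swap[of bs as] using as N_assoc(1) by (intro avg_cong) (metis subsetD)
      then show ?thesis unfolding h1_def h_def avg_add by simp
    qed
    have "\<bar>avg bs (\<lambda>b. avg as (\<lambda>a. f (a \<cdot> (n \<cdot> b)))) - mean f\<bar> \<le> \<epsilon>"
      using as bs n N_mult by (intro avg_near[OF bs(1)]) auto
    moreover have "\<bar>avg as (\<lambda>a. avg bs (\<lambda>b. g ((a \<cdot> n) \<cdot> b))) - mean g\<bar> \<le> \<epsilon>"
      using as bs n N_mult by (intro avg_near[OF as(1)]) auto
    ultimately show "\<bar>avg bs (\<lambda>b. h1 (n \<cdot> b)) - (mean f + mean g)\<bar> \<le> 2 * \<epsilon>"
      unfolding split by linarith
  qed
  then have "\<bar>mean h - (mean f + mean g)\<bar> \<le> 2 * \<epsilon>"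
    unfolding mean_right_average[OF h1 bs(1,2)] unfolding h1_def mean_left_average[OF h as(1,2)] .
  moreover have "\<bar>mean h - (mean f + mean g)\<bar> = 3 * \<epsilon>" by (simp add: \<epsilon>_def)
  ultimately show False using e by linarith
qed

lemma mean_cmult:
  assumes f: "continuous_on UNIV f" shows "mean (\<lambda>n. k * f n) = k * mean f"
proof -
  have "left_mean (\<lambda>n. k * f n) (k * mean f)"
    unfolding left_mean_def
  proof (intro allI impI)
    fix \<epsilon> :: real assume e: "0 < \<epsilon>"
    then have "0 < \<epsilon> / (\<bar>k\<bar> + 1)" by simp
    from left_average[OF f this] obtain as where as: "as \<noteq> []" "set as \<subseteq> N"
      "\<And>n. n \<in> N \<Longrightarrow> \<bar>avg as (\<lambda>a. f (a \<cdot> n)) - mean f\<bar> \<le> \<epsilon> / (\<bar>k\<bar> + 1)" by blast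
    have "\<bar>avg as (\<lambda>a. k * f (a \<cdot> n)) - k * mean f\<bar> \<le> \<epsilon>" if n: "n \<in> N" for n
    proof -
      have "\<bar>avg as (\<lambda>a. k * f (a \<cdot> n)) - k * mean f\<bar> = \<bar>k\<bar> * \<bar>avg as (\<lambda>a. f (a \<cdot> n)) - mean f\<bar>"
        unfolding avg_cmult by (simp add: abs_mult flip: right_diff_distrib)
      also have "\<dots> \<le> \<bar>k\<bar> * (\<epsilon> / (\<bar>k\<bar> + 1))" using as(3)[OF n] by (intro mult_left_mono) auto
      also have "\<dots> \<le> \<epsilon>" using e by (simp add: field_simps)
      finally show ?thesis .
    qed
    then show "\<exists>as. as \<noteq> [] \<and> set as \<subseteq> N \<and> (\<forall>n\<in>N. \<bar>avg as (\<lambda>a. k * f (a \<cdot> n)) - k * mean f\<bar> \<le> \<epsilon>)"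
      using as by blast
  qed
  moreover have "continuous_on UNIV (\<lambda>n. k * f n)" by (intro continuous_intros f)
  ultimately show ?thesis using left_mean_iff by metis
qed

text \<open>
Finitely many translates of the set where \<open>f\<close> exceeds \<open>f e / 2\<close> cover \<open>N\<close>, so the average of the
corresponding translates of \<open>f\<close> is bounded below by a positive constant.
\<close>

lemma mean_pos:
  assumes f: "continuous_on UNIV f" and nn: "\<And>n. n \<in> N \<Longrightarrow> 0 \<le> f n" and pos: "0 < f e"
  shows "0 < mean f"
proof -
  have op: "open {n. f e / 2 < f n}" by (intro open_Collect_less continuous_intros f)
  have "e \<in> {n. f e / 2 < f n}" using pos by simp
  from finite_translate_cover[OF op this] obtain as where as: "as \<noteq> []" "set as \<subseteq> N"
    "\<And>n. n \<in> N \<Longrightarrow> \<exists>a\<in>set as. a \<cdot> n \<in> {n. f e / 2 < f n}" by blast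
  have "(f e / 2) / length as \<le> mean (\<lambda>n. avg as (\<lambda>a. f (a \<cdot> n)))"
  proof (rule mean_ge)
    show "continuous_on UNIV (\<lambda>n. avg as (\<lambda>a. f (a \<cdot> n)))"
      by (intro continuous_on_avg continuous_translates f)
    fix n assume n: "n \<in> N"
    obtain a where a: "a \<in> set as" "f e / 2 < f (a \<cdot> n)" using as(3)[OF n] by auto
    have "avg as (\<lambda>a. - 1 * f (a \<cdot> n)) \<le> 0 - (f e / 2) / length as"
      using nn as n N_mult a(2) by (intro avg_gap[OF _ a(1)]) auto
    then show "(f e / 2) / length as \<le> avg as (\<lambda>a. f (a \<cdot> n))" unfolding avg_cmult by simp
  qed
  moreover have "0 < (f e / 2) / length as" using pos as(1) by simp
  ultimately show ?thesis unfolding mean_left_average[OF f as(1,2)] by linarith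
qed

text \<open>
A surjective endomorphism of \<open>N\<close> turns averages of translates of \<open>f\<close> into averages of translates of the composed
function, with the same limiting constant.
\<close>

lemma mean_conjugate:
  assumes f: "continuous_on UNIV f" shows "mean (\<lambda>n. f (conjugate x n)) = mean f"
proof -
  have "continuous_on UNIV (conjugate x)" unfolding conjugate_def by (intro continuous_intros)
  then have "continuous_on UNIV (\<lambda>n. f (conjugate x n))"
    using continuous_on_compose2[OF f] by auto
  moreover have "left_mean (\<lambda>n. f (conjugate x n)) (mean f)"
    unfolding left_mean_def
  proof (intro allI impI)
    fix \<epsilon> :: real assume "0 < \<epsilon>"
    from left_average[OF f this] obtain as where as: "as \<noteq> []" "set as \<subseteq> N"
      "\<And>n. n \<in> N \<Longrightarrow> \<bar>avg as (\<lambda>a. f (a \<cdot> n)) - mean f\<bar> \<le> \<epsilon>" by blast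
    have "\<exists>c. \<forall>a\<in>set as. c a \<in> N \<and> conjugate x (c a) = a"
      using conjugate_surj as(2) by (intro bchoice ballI) (metis subsetD)
    then obtain c where c: "\<forall>a\<in>set as. c a \<in> N \<and> conjugate x (c a) = a" by blast
    have "\<bar>avg (map c as) (\<lambda>a. f (conjugate x (a \<cdot> n))) - mean f\<bar> \<le> \<epsilon>" if n: "n \<in> N" for n
    proof -
      have "avg (map c as) (\<lambda>a. f (conjugate x (a \<cdot> n))) = avg as (\<lambda>a. f (a \<cdot> conjugate x n))"
        unfolding avg_map using c conjugate_mult n by (intro avg_cong) auto
      then show ?thesis using as(3)[OF conjugate_in_N[OF n]] by simp
    qed
    then show "\<exists>as. as \<noteq> [] \<and> set as \<subseteq> N \<and> (\<forall>n\<in>N. \<bar>avg as (\<lambda>a. f (conjugate x (a \<cdot> n))) - mean f\<bar> \<le> \<epsilon>)"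
      using as(1) c by (intro exI[of _ "map c as"]) auto
  qed
  ultimately show ?thesis using left_mean_iff by metis
qed

section \<open>Averaging over the fibres\<close>

definition fibre_mean :: "('a \<Rightarrow> real) \<Rightarrow> 'a \<Rightarrow> real" where
  "fibre_mean f x = mean (\<lambda>n. f (n \<cdot> x))"

lemma fibre_mean_continuous:
  assumes f: "continuous_on UNIV f" shows "continuous_on UNIV (fibre_mean f)"
proof -
  have "(fibre_mean f \<longlongrightarrow> fibre_mean f x) (at x)" for x
  proof (rule tendstoI)
    fix \<epsilon> :: real assume e: "0 < \<epsilon>"
    define D where "D = {z. \<bar>f (snd z \<cdot> fst z) - f (snd z \<cdot> x)\<bar> < \<epsilon> / 2}"
    have "open D"
    proof -
      have "continuous_on UNIV (\<lambda>z. f (snd z \<cdot> fst z))"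
        "continuous_on UNIV (\<lambda>z :: 'a \<times> 'a. f (snd z \<cdot> x))"
        by (auto intro!: continuous_on_compose2[OF f] continuous_intros)
      then show ?thesis unfolding D_def by (intro open_Collect_less continuous_intros)
    qed
    then have op: "open {u. \<forall>n\<in>N. (u, n) \<in> D}" using compact_N by (rule open_uniformly)
    have x: "x \<in> {u. \<forall>n\<in>N. (u, n) \<in> D}" using e by (simp add: D_def)
    have "dist (fibre_mean f y) (fibre_mean f x) < \<epsilon>" if "y \<in> {u. \<forall>n\<in>N. (u, n) \<in> D}" for y
    proof -
      have "\<bar>fibre_mean f y - fibre_mean f x\<bar> \<le> \<epsilon> / 2"
        unfolding fibre_mean_def using that
        by (intro mean_diff continuous_translates f) (auto simp: D_def intro: less_imp_le)
      then show ?thesis using e by (simp add: dist_real_def)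
    qed
    then show "\<forall>\<^sub>F y in at x. dist (fibre_mean f y) (fibre_mean f x) < \<epsilon>"
      unfolding eventually_at_topological using op x by blast
  qed
  then show ?thesis by (simp add: continuous_on_def)
qed

lemma fibre_mean_invariant:
  assumes f: "continuous_on UNIV f" and k: "k \<in> N" shows "fibre_mean f (k \<cdot> x) = fibre_mean f x"
  using mean_right_translate[OF continuous_translates(2)[OF f, of x] k]
  by (simp add: fibre_mean_def N_assoc(2)[OF k])

lemma fibre_mean_C00:
  assumes f: "f \<in> C00_plus" shows "fibre_mean f \<in> C00_plus"
proof -
  obtain K where K: "compact K" "\<And>x. f x \<noteq> 0 \<Longrightarrow> x \<in> K" using C00_support[OF f] by blast
  have c: "continuous_on UNIV f" using C00_cont[OF f] .
  show ?thesis
  proof (rule C00_I[OF hausdorff])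
    show "continuous_on UNIV (fibre_mean f)" by (rule fibre_mean_continuous[OF c])
    show "0 \<le> fibre_mean f x" for x
      unfolding fibre_mean_def using C00_nonneg[OF f] by (intro mean_ge continuous_translates c)
    show "compact ((\<lambda>(n, x). ldiv n x) ` (N \<times> K))"
      using continuous_ldiv
      by (intro compact_continuous_image compact_Times compact_N K(1)) (auto intro: continuous_on_subset)
    fix x assume nz: "fibre_mean f x \<noteq> 0"
    have "\<exists>n\<in>N. f (n \<cdot> x) \<noteq> 0"
    proof (rule ccontr)
      assume "\<not> (\<exists>n\<in>N. f (n \<cdot> x) \<noteq> 0)"
      then have "\<bar>fibre_mean f x - 0\<bar> \<le> 0"
        unfolding fibre_mean_def by (intro mean_near continuous_translates c) auto
      then show False using nz by simp
    qed
    then obtain n where "n \<in> N" "n \<cdot> x \<in> K" using K(2) by blast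
    then show "x \<in> (\<lambda>(n, x). ldiv n x) ` (N \<times> K)"
      by (intro image_eqI[of _ _ "(n, n \<cdot> x)"]) auto
  qed
qed

text \<open>
Moving \<open>b\<close> past \<open>n\<close> replaces \<open>n\<close> by its conjugate, which does not affect the mean.
\<close>

lemma fibre_mean_translate:
  assumes f: "continuous_on UNIV f" shows "fibre_mean (\<lambda>x. f (b \<cdot> x)) x = fibre_mean f (b \<cdot> x)"
proof -
  have "mean (\<lambda>n. f (b \<cdot> (n \<cdot> x))) = mean (\<lambda>n. f (conjugate b n \<cdot> (b \<cdot> x)))"
  proof -
    have c: "continuous_on UNIV (\<lambda>n. f (b \<cdot> (n \<cdot> x)))"
      "continuous_on UNIV (\<lambda>n. f (conjugate b n \<cdot> (b \<cdot> x)))"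
      unfolding conjugate_def by (auto intro!: continuous_on_compose2[OF f] continuous_intros)
    have "b \<cdot> (n \<cdot> x) = conjugate b n \<cdot> (b \<cdot> x)" if n: "n \<in> N" for n
      using N_assoc(2)[OF n, of b x] N_assoc(1)[OF conjugate_in_N[OF n], of b b x] conjugate_eq[of b n]
      by simp
    then have "\<bar>mean (\<lambda>n. f (b \<cdot> (n \<cdot> x))) - mean (\<lambda>n. f (conjugate b n \<cdot> (b \<cdot> x)))\<bar> \<le> 0"
      using c by (intro mean_diff) auto
    then show ?thesis by simp
  qed
  also have "\<dots> = mean (\<lambda>n. f (n \<cdot> (b \<cdot> x)))"
    by (rule mean_conjugate[OF continuous_translates(2)[OF f]])
  finally show ?thesis by (simp add: fibre_mean_def)
qed

section \<open>Tubes around the cosets\<close>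

text \<open>
Relatively compact open neighbourhoods of the whole subgroup \<open>N\<close> that are unions of cosets. The sets
\<open>x U\<close> with \<open>U\<close> such a tube are the neighbourhoods to which the covering argument is applied.
\<close>

definition tubes :: "'a set set" where
  "tubes = {U. open U \<and> N \<subseteq> U \<and> (\<forall>n\<in>N. \<forall>u\<in>U. n \<cdot> u \<in> U) \<and> (\<exists>K. compact K \<and> U \<subseteq> K)}"

lemma small_tube:
  assumes "open W" "N \<subseteq> W" obtains U where "U \<in> tubes" "U \<subseteq> W"
proof -
  have "\<exists>V K. open V \<and> compact K \<and> N \<subseteq> V \<and> V \<subseteq> K"
    using locally_compact_space_compact_closed_compact[of "euclidean :: 'a topology"]
      hausdorff locally_compact compact_N by auto metis
  then obtain V K where V: "open V" "compact K" "N \<subseteq> V" "V \<subseteq> K" by blast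
  define U where "U = {u. \<forall>n\<in>N. (u, n) \<in> {z. snd z \<cdot> fst z \<in> W \<inter> V}}"
  have "open U"
    unfolding U_def
  proof (rule open_uniformly[OF _ compact_N])
    have "continuous_on UNIV (\<lambda>z :: 'a \<times> 'a. snd z \<cdot> fst z)" by (intro continuous_intros)
    then show "open {z. snd z \<cdot> fst z \<in> W \<inter> V}"
      using open_vimage[of "W \<inter> V" "\<lambda>z :: 'a \<times> 'a. snd z \<cdot> fst z"] assms(1) V(1)
      by (simp add: vimage_def open_Int)
  qed
  moreover have "U \<subseteq> W \<inter> V" using e_in_N by (force simp: U_def)
  moreover have "N \<subseteq> U" using assms(2) V(3) N_mult by (auto simp: U_def)
  moreover have "n \<cdot> u \<in> U" if n: "n \<in> N" and u: "u \<in> U" for n u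
  proof -
    have "k \<cdot> (n \<cdot> u) = (k \<cdot> n) \<cdot> u" for k using N_assoc(2)[OF n] by simp
    then show ?thesis using u n N_mult by (simp add: U_def)
  qed
  moreover have "U \<subseteq> K" using \<open>U \<subseteq> W \<inter> V\<close> V(4) by auto
  ultimately have "U \<in> tubes" unfolding tubes_def using V(2) by auto
  moreover have "U \<subseteq> W" using \<open>U \<subseteq> W \<inter> V\<close> by auto
  ultimately show ?thesis by (rule that)
qed

definition tube_balls :: "('a \<Rightarrow> 'a set) set" where
  "tube_balls = (\<lambda>U x. (\<lambda>u. x \<cdot> u) ` U) ` tubes"

lemma tube_ball_vimage: "(\<lambda>u. x \<cdot> u) ` U = (\<lambda>y. ldiv x y) -` U"
proof
  show "(\<lambda>y. ldiv x y) -` U \<subseteq> (\<lambda>u. x \<cdot> u) ` U"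
    by (auto intro!: image_eqI[of _ _ "ldiv x _"])
qed auto

lemma open_tube_ball: "open U \<Longrightarrow> open ((\<lambda>u. x \<cdot> u) ` U)"
  unfolding tube_ball_vimage by (intro open_vimage continuous_intros)

lemma compact_tube_cover:
  assumes "compact K" "V \<in> tube_balls" shows "\<exists>Y. finite Y \<and> K \<subseteq> (\<Union>y\<in>Y. V y)"
proof -
  obtain U where U: "U \<in> tubes" "V = (\<lambda>x. (\<lambda>u. x \<cdot> u) ` U)"
    using assms(2) by (auto simp: tube_balls_def)
  have op: "open (V y)" for y using U open_tube_ball by (simp add: tubes_def)
  have "e \<in> U" using U(1) e_in_N by (auto simp: tubes_def)
  then have "y \<in> V y" for y unfolding U(2) by (intro image_eqI[of _ _ e]) auto
  then have "K \<subseteq> (\<Union>y\<in>K. V y)" by blast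
  from compactE_image[OF assms(1) op this] show ?thesis by metis
qed

text \<open>
This is \<open>b (y U) = (b y) U\<close>. The two sides differ by factors \<open>t(b, y, u)\<close> depending on
\<open>u\<close>; they lie in \<open>N\<close>, can be moved to the right of \<open>b y\<close> by normality, and are absorbed by
\<open>U\<close>. For a set \<open>U\<close> that is not a union of cosets the statement fails in general, which is why the
covering argument is carried out modulo \<open>N\<close>.
\<close>

lemma tube_ball_translate:
  assumes U: "U \<in> tubes"
  shows "b \<cdot> x \<in> (\<lambda>u. (b \<cdot> y) \<cdot> u) ` U \<longleftrightarrow> x \<in> (\<lambda>u. y \<cdot> u) ` U"
proof -
  have NU: "n \<cdot> u \<in> U" if "n \<in> N" "u \<in> U" for n u using U that by (auto simp: tubes_def)
  show ?thesis
  proof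
    assume "b \<cdot> x \<in> (\<lambda>u. (b \<cdot> y) \<cdot> u) ` U"
    then obtain u where u: "u \<in> U" "b \<cdot> x = (b \<cdot> y) \<cdot> u" by blast
    have t: "t b y u \<in> N" by (rule t_in_N)
    obtain k where k: "k \<in> N" "\<And>z. t b y u \<cdot> (b \<cdot> z) = b \<cdot> (k \<cdot> z)" using ball_twist[OF t, of b] by metis
    obtain l where l: "l \<in> N" "\<And>z. k \<cdot> (y \<cdot> z) = y \<cdot> (l \<cdot> z)" using ball_twist[OF k(1), of y] by metis
    have "b \<cdot> x = b \<cdot> (y \<cdot> (l \<cdot> u))" using u(2) t_eq[of b y u] k(2) l(2) by simp
    then show "x \<in> (\<lambda>u. y \<cdot> u) ` U" using NU[OF l(1) u(1)] left_cancel by blast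
  next
    assume "x \<in> (\<lambda>u. y \<cdot> u) ` U"
    then obtain u where u: "u \<in> U" "x = y \<cdot> u" by blast
    define n where "n = ldiv (t b y u) e"
    have n: "n \<in> N" "n \<cdot> t b y u = e" using N_inverse[OF t_in_N] by (auto simp: n_def)
    have "n \<cdot> ((b \<cdot> y) \<cdot> u) = b \<cdot> (y \<cdot> u)"
      unfolding t_eq[of b y u] N_assoc(1)[OF n(1), symmetric] n(2) by simp
    moreover obtain l where l: "l \<in> N" "\<And>z. n \<cdot> ((b \<cdot> y) \<cdot> z) = (b \<cdot> y) \<cdot> (l \<cdot> z)"
      using ball_twist[OF n(1), of "b \<cdot> y"] by metis
    ultimately have "b \<cdot> x = (b \<cdot> y) \<cdot> (l \<cdot> u)" using u(2) by simp
    then show "b \<cdot> x \<in> (\<lambda>u. (b \<cdot> y) \<cdot> u) ` U" using NU[OF l(1) u(1)] by blast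
  qed
qed

sublocale haar: invariant_entourages tube_balls "(\<cdot>)"
proof
  show "tube_balls \<noteq> {}"
    using small_tube[of UNIV] by (auto simp: tube_balls_def)
next
  fix V W assume "V \<in> tube_balls" "W \<in> tube_balls"
  then obtain A B where AB: "A \<in> tubes" "B \<in> tubes" "V = (\<lambda>x. (\<lambda>u. x \<cdot> u) ` A)" "W = (\<lambda>x. (\<lambda>u. x \<cdot> u) ` B)"
    by (auto simp: tube_balls_def)
  have "A \<inter> B \<in> tubes" using AB(1,2) unfolding tubes_def by (auto simp: open_Int)
  then have "(\<lambda>x. (\<lambda>u. x \<cdot> u) ` (A \<inter> B)) \<in> tube_balls" by (simp add: tube_balls_def)
  then show "\<exists>U\<in>tube_balls. \<forall>x. U x \<subseteq> V x \<inter> W x"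
    unfolding AB by (rule bexI[rotated]) auto
next
  fix V x assume "V \<in> tube_balls"
  then obtain U where U: "U \<in> tubes" "V = (\<lambda>x. (\<lambda>u. x \<cdot> u) ` U)" by (auto simp: tube_balls_def)
  have "e \<in> U" using U(1) e_in_N by (auto simp: tubes_def)
  then show "x \<in> V x" unfolding U(2) by (intro image_eqI[of _ _ e]) auto
next
  fix V W x assume V: "V \<in> tube_balls" and W: "W \<in> tube_balls"
  then obtain U where U: "U \<in> tubes" "V = (\<lambda>x. (\<lambda>u. x \<cdot> u) ` U)" by (auto simp: tube_balls_def)
  obtain K where K: "compact K" "U \<subseteq> K" using U(1) by (auto simp: tubes_def)
  have "compact ((\<lambda>u. x \<cdot> u) ` K)" using K(1) by (intro compact_continuous_image continuous_intros)
  from compact_tube_cover[OF this W] show "\<exists>Y. finite Y \<and> V x \<subseteq> (\<Union>y\<in>Y. W y)"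
    using K(2) unfolding U(2) by (meson image_mono order_trans)
next
  fix V b x y assume "V \<in> tube_balls"
  then obtain U where U: "U \<in> tubes" "V = (\<lambda>x. (\<lambda>u. x \<cdot> u) ` U)" by (auto simp: tube_balls_def)
  show "b \<cdot> x \<in> V (b \<cdot> y) \<longleftrightarrow> x \<in> V y" unfolding U(2) by (rule tube_ball_translate[OF U(1)])
next
  fix b show "surj ((\<cdot>) b)" by (metis mult_ldiv surjI)
next
  fix x y show "\<exists>b. b \<cdot> x = y" by (metis rdiv_mult)
qed

text \<open>
Points \<open>x\<close> for which \<open>f x\<close> or some \<open>f (x u)\<close> is nonzero stay in a compact set \<open>K1\<close>. On
\<open>K1 \<times> N\<close> the function \<open>f (x u) - f x\<close> vanishes, so it is small on \<open>K1 \<times> W\<close> for a neighbourhood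
\<open>W\<close> of \<open>N\<close>.
\<close>

lemma invariant_ucont:
  assumes f: "f \<in> C00_plus" and inv: "\<And>n x. n \<in> N \<Longrightarrow> f (n \<cdot> x) = f x"
  shows "haar.ucont f"
  unfolding haar.ucont_def
proof (intro allI impI)
  fix \<epsilon> :: real assume e: "0 < \<epsilon>"
  have c: "continuous_on UNIV f" using C00_cont[OF f] .
  obtain K where K: "compact K" "\<And>x. f x \<noteq> 0 \<Longrightarrow> x \<in> K" using C00_support[OF f] by blast
  obtain U0 where U0: "U0 \<in> tubes" using small_tube[of UNIV] by blast
  then obtain K0 where K0: "compact K0" "U0 \<subseteq> K0" by (auto simp: tubes_def)
  define K1 where "K1 = (\<lambda>(u, z). rdiv z u) ` (K0 \<times> K)"
  have K1: "compact K1"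
    unfolding K1_def using continuous_rdiv
    by (intro compact_continuous_image compact_Times K K0) (auto intro: continuous_on_subset)
  have inK1: "x \<in> K1" if "u \<in> U0" "f (x \<cdot> u) \<noteq> 0" for x u
    unfolding K1_def using that K(2) K0(2) by (intro image_eqI[of _ _ "(u, x \<cdot> u)"]) auto
  define D where "D = {z. \<bar>f (snd z \<cdot> fst z) - f (snd z)\<bar> < \<epsilon>}"
  have "open D"
  proof -
    have "continuous_on UNIV (\<lambda>z. f (snd z \<cdot> fst z))" "continuous_on UNIV (\<lambda>z :: 'a \<times> 'a. f (snd z))"
      by (auto intro!: continuous_on_compose2[OF c] continuous_intros)
    then show ?thesis unfolding D_def by (intro open_Collect_less continuous_intros)
  qed
  then have op: "open {u. \<forall>x\<in>K1. (u, x) \<in> D}" using K1 by (rule open_uniformly)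
  have fn: "f (x \<cdot> n) = f x" if n: "n \<in> N" for x n
  proof -
    obtain k where "k \<in> N" "x \<cdot> n = k \<cdot> x" using conj_left[OF n, of x] by (elim bexE)
    then show ?thesis using inv by simp
  qed
  have sub: "N \<subseteq> {u. \<forall>x\<in>K1. (u, x) \<in> D} \<inter> U0"
  proof
    fix n assume n: "n \<in> N"
    then have "n \<in> U0" using U0 unfolding tubes_def by blast
    then show "n \<in> {u. \<forall>x\<in>K1. (u, x) \<in> D} \<inter> U0" using e fn[OF n] by (simp add: D_def)
  qed
  have "open ({u. \<forall>x\<in>K1. (u, x) \<in> D} \<inter> U0)" using op U0 by (auto simp: tubes_def)
  from small_tube[OF this sub] obtain U
    where U: "U \<in> tubes" "U \<subseteq> {u. \<forall>x\<in>K1. (u, x) \<in> D} \<inter> U0" .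
  have "\<bar>f (x \<cdot> u) - f x\<bar> \<le> \<epsilon>" if u: "u \<in> U" for x u
  proof (cases "x \<in> K1")
    case True
    then have "(u, x) \<in> D" using U(2) u by blast
    then show ?thesis by (simp add: D_def)
  next
    case False
    have "e \<in> U0" using U0 e_in_N by (auto simp: tubes_def)
    then have "f x = 0" using inK1[of e x] False by auto
    moreover have "f (x \<cdot> u) = 0" using inK1[of u x] False U(2) u by blast
    ultimately show ?thesis using e by simp
  qed
  then show "\<exists>V\<in>tube_balls. \<forall>x. \<forall>y\<in>V x. \<bar>f y - f x\<bar> \<le> \<epsilon>"
    unfolding tube_balls_def using U(1) by auto
qed

lemma invariant_uc_class:
  assumes f: "f \<in> C00_plus" and inv: "\<And>n x. n \<in> N \<Longrightarrow> f (n \<cdot> x) = f x"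
  shows "f \<in> haar.uc_class"
proof -
  obtain K where K: "compact K" "\<And>x. f x \<noteq> 0 \<Longrightarrow> x \<in> K" using C00_support[OF f] by blast
  have "haar.totally_bounded K"
    unfolding haar.totally_bounded_def by (intro ballI compact_tube_cover K(1))
  then have "haar.totally_bounded {x. f x \<noteq> 0}"
    by (rule haar.totally_bounded_subset) (use K(2) in auto)
  moreover have "\<exists>B. \<forall>x. f x \<le> B" using C00_bounded[OF f] by metis
  ultimately show ?thesis
    unfolding haar.uc_class_def haar.bounded_class_def
    using C00_nonneg[OF f] invariant_ucont[OF f inv] by simp
qed

text \<open>
The functional averages over the fibres \<open>N x\<close> and then applies the invariant functional on
\<open>N\<close>-invariant functions. Translations commute with the first operation and are respected by the second.
\<close>

theorem invariant_radon_functional: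
  obtains J where "radon_functional J"
    "\<And>f x. f \<in> C00_plus \<Longrightarrow> f x \<noteq> 0 \<Longrightarrow> 0 < J f"
    "\<And>f b. f \<in> C00_plus \<Longrightarrow> J (\<lambda>x. f (b \<cdot> x)) = J f"
proof -
  obtain I :: "('a \<Rightarrow> real) \<Rightarrow> real" where I:
    "\<And>f. f \<in> haar.uc_class \<Longrightarrow> 0 \<le> I f"
    "\<And>f x. f \<in> haar.uc_class \<Longrightarrow> f x \<noteq> 0 \<Longrightarrow> 0 < I f"
    "\<And>f g. f \<in> haar.uc_class \<Longrightarrow> g \<in> haar.uc_class \<Longrightarrow> I (\<lambda>x. f x + g x) = I f + I g"
    "\<And>f k. f \<in> haar.uc_class \<Longrightarrow> 0 < k \<Longrightarrow> I (\<lambda>x. k * f x) = k * I f"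
    "\<And>f b. f \<in> haar.uc_class \<Longrightarrow> I (\<lambda>x. f (b \<cdot> x)) = I f"
    using haar.exists_invariant_functional by blast
  have uc: "fibre_mean f \<in> haar.uc_class" if "f \<in> C00_plus" for f
    by (intro invariant_uc_class fibre_mean_C00 fibre_mean_invariant that C00_cont)
  show ?thesis
  proof (rule that[of "\<lambda>f. I (fibre_mean f)"])
    show "radon_functional (\<lambda>f. I (fibre_mean f))"
    proof
      show "0 \<le> I (fibre_mean f)" if "f \<in> C00_plus" for f using I(1) uc that by blast
      show "I (fibre_mean (\<lambda>x. f x + g x)) = I (fibre_mean f) + I (fibre_mean g)"
        if f: "f \<in> C00_plus" and g: "g \<in> C00_plus" for f g
      proof -
        have "fibre_mean (\<lambda>x. f x + g x) = (\<lambda>x. fibre_mean f x + fibre_mean g x)"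
          unfolding fibre_mean_def
          by (intro ext mean_add continuous_translates C00_cont f g)
        then show ?thesis using I(3)[OF uc[OF f] uc[OF g]] by simp
      qed
      show "I (fibre_mean (\<lambda>x. k * f x)) = k * I (fibre_mean f)" if f: "f \<in> C00_plus" and k: "0 < k" for f k
      proof -
        have "fibre_mean (\<lambda>x. k * f x) = (\<lambda>x. k * fibre_mean f x)"
          unfolding fibre_mean_def
          by (intro ext mean_cmult continuous_translates C00_cont f)
        then show ?thesis using I(4)[OF uc[OF f] k] by simp
      qed
    qed (rule hausdorff locally_compact)+
    show "0 < I (fibre_mean f)" if f: "f \<in> C00_plus" and x: "f x \<noteq> 0" for f x
    proof -
      have "0 < f x" using x C00_nonneg[OF f, of x] by simp
      then have "0 < fibre_mean f x"
        unfolding fibre_mean_def using C00_nonneg[OF f]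
        by (intro mean_pos continuous_translates C00_cont f) auto
      then show ?thesis using I(2)[OF uc[OF f], of x] by simp
    qed
    show "I (fibre_mean (\<lambda>x. f (b \<cdot> x))) = I (fibre_mean f)" if f: "f \<in> C00_plus" for f b
    proof -
      have "fibre_mean (\<lambda>x. f (b \<cdot> x)) = (\<lambda>x. fibre_mean f (b \<cdot> x))"
        using fibre_mean_translate[OF C00_cont[OF f]] by (intro ext)
      then show ?thesis using I(5)[OF uc[OF f]] by simp
    qed
  qed
qed

end

section \<open>Existence of a left invariant measure\<close>

theorem theorem3p16:
  fixes m :: "'a::t1_space \<Rightarrow> 'a \<Rightarrow> 'a" and e :: 'a and N0 :: "'a set"
  assumes "topological_fan_loop m e"
    and "locally_compact_space (euclidean :: 'a topology)"
    and "N0 = topological_fan_loop.fan m e"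
    and "compact N0"
    and "loop.is_subgroup m e N0"
    and "N0 \<subseteq> loop.nucleus m"
    and "\<forall>a b c. fan_loop.t m a b c \<in> N0 \<and> fan_loop.p m a b c \<in> N0"
  shows "\<exists>\<mu> :: 'a measure.
      regular_borel_measure \<mu>
    \<and> (\<forall>U. open U \<longrightarrow> U \<noteq> {} \<longrightarrow> emeasure \<mu> U > 0)
    \<and> (\<forall>A. compact A \<longrightarrow> emeasure \<mu> A < \<infinity>)
    \<and> (\<forall>B\<in>sets borel. \<forall>b. emeasure \<mu> ((\<lambda>x. m b x) ` B) = emeasure \<mu> B)
    \<and> (\<exists>J :: ('a \<Rightarrow> real) \<Rightarrow> real.
          (\<forall>f\<in>C00_plus. has_bochner_integral \<mu> f (J f))
        \<and> (\<forall>f\<in>C00_plus. J f \<ge> 0)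
        \<and> (\<forall>f\<in>C00_plus. f \<noteq> (\<lambda>x. 0) \<longrightarrow> J f > 0)
        \<and> (\<forall>(n::nat) (f :: nat \<Rightarrow> 'a \<Rightarrow> real) (\<alpha> :: nat \<Rightarrow> real).
              n \<ge> 1 \<longrightarrow> (\<forall>i\<in>{1..n}. f i \<in> C00_plus \<and> \<alpha> i \<ge> 0) \<longrightarrow>
              J (\<lambda>x. \<Sum>i=1..n. \<alpha> i * f i x) = (\<Sum>i=1..n. \<alpha> i * J (f i)))
        \<and> (\<forall>b. \<forall>f\<in>C00_plus. J (\<lambda>x. f (m b x)) = J f))"
proof -
  interpret compact_fan_loop m e N0
    using assms by (simp add: compact_fan_loop_def compact_fan_loop_axioms_def)
  obtain J where J: "radon_functional J"
    and pos: "\<And>f x. f \<in> C00_plus \<Longrightarrow> f x \<noteq> 0 \<Longrightarrow> 0 < J f"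
    and inv: "\<And>f b. f \<in> C00_plus \<Longrightarrow> J (\<lambda>x. f (m b x)) = J f"
    using invariant_radon_functional by blast
  interpret J: radon_functional J by (rule J)
  have scale: "J (\<lambda>x. k * f x) = k * J f" if "f \<in> C00_plus" "0 \<le> k" for f k
    using J.J_scale[OF that(1), of k] J.J_zero that(2) by (cases "k = 0") auto
  have lin: "J (\<lambda>x. \<Sum>i=1..n. \<alpha> i * f i x) = (\<Sum>i=1..n. \<alpha> i * J (f i))"
    if "\<forall>i\<in>{1..n}. f i \<in> C00_plus \<and> \<alpha> i \<ge> 0" for n :: nat and f \<alpha>
    using that by (subst J.J_sum) (auto intro!: C00_scale sum.cong scale)
  have nonzero: "0 < J f" if f: "f \<in> C00_plus" "f \<noteq> (\<lambda>x. 0)" for f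
    using pos f by blast
  have shift: "emeasure J.radon ((\<lambda>x. m b x) ` B) = emeasure J.radon B" if B: "B \<in> sets borel" for b B
  proof (rule J.radon_homeomorphism[where S = "ldiv b"])
    show "continuous_on UNIV (ldiv b)" "continuous_on UNIV (\<lambda>x. m b x)"
      by (intro continuous_intros)+
  qed (use inv B in auto)
  show ?thesis
  proof (intro exI[of _ J.radon] conjI exI[of _ J] allI ballI impI)
    show "regular_borel_measure J.radon" by (rule J.regular_radon)
    show "0 < emeasure J.radon U" if "open U" "U \<noteq> {}" for U
      using J.radon_positive[OF pos that] .
    show "emeasure J.radon A < \<infinity>" if "compact A" for A
      using J.radon_compact_finite[OF that] .
    show "has_bochner_integral J.radon f (J f)" if "f \<in> C00_plus" for f
      using J.radon_integral[OF that] .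
    show "0 \<le> J f" if "f \<in> C00_plus" for f using J.J_nonneg[OF that] .
  qed (use shift nonzero lin inv in auto)
qed

end
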